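(* Let $(\mathcal G,\mathcal P,\partial)\xrightarrow{(\varphi,F)}(\mathcal H,\mathcal Q,\partial)\xleftarrow{(\varphi',F')}(\mathcal G',\mathcal P',\partial)$ be morphisms of crossed modules. If one of them is a fibration, then the canonical morphism $$(\mathcal G,\mathcal P,\partial)\times_{(\mathcal H,\mathcal Q,\partial)}(\mathcal G',\mathcal P',\partial)\to(\varphi,F)\!\downarrow\!(\varphi',F')$$ induces a homotopy equivalence $$\mathrm B\big((\mathcal G,\mathcal P,\partial)\times_{(\mathcal H,\mathcal Q,\partial)}(\mathcal G',\mathcal P',\partial)\big)\simeq\mathrm B\big((\varphi,F)\!\downarrow\!(\varphi',F')\big).$$
   Context: **Crossed modules.** For a small groupoid $\mathcal P$, a $\mathcal P$-group is a functor $\mathcal G:\mathcal P\to\mathbf{Gp}$; for $p:a\to b$ write ${}^pg\in\mathcal G(b)$ for the image of $g\in\mathcal G(a)$. $\mathrm{Aut}_{\mathcal P}$ is the $\mathcal P$-group $a\mapsto\mathrm{Aut}_{\mathcal P}(a)$ with ${}^pq=p\circ q\circ p^{-1}$. A crossed module (of groupoids) $(\mathcal G,\mathcal P,\partial)$ is a groupoid $\mathcal P$, a $\mathcal P$-group $\mathcal G$ and a $\mathcal P$-group homomorphism (natural transformation) $\partial:\mathcal G\to\mathrm{Aut}_{\mathcal P}$ with ${}^{\partial g}g'=g\cdot g'\cdot g^{-1}$ for $g,g'\in\mathcal G(a)$. A morphism $(\varphi,F):(\mathcal G,\mathcal P,\partial)\to(\mathcal H,\mathcal Q,\partial)$ is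 a functor $F:\mathcal P\to\mathcal Q$ together with a $\mathcal P$-group homomorphism $\varphi:\mathcal G\to\mathcal HF$ such that $\partial\varphi g=F\partial g$. **Fibrations.** $(\varphi,F)$ is a fibration if (i) $F:\mathcal P\to\mathcal Q$ is a fibration of groupoids: for every object $a\in\mathcal P$ and morphism $q:Fa\to b$ in $\mathcal Q$ there is a morphism $p:a\to a'$ in $\mathcal P$ with $Fp=q$; and (ii) for every object $a\in\mathcal P$ the homomorphism $\varphi:\mathcal G(a)\to\mathcal H(Fa)$ is surjective. **Classifying space.** For a simplicial set $K$ with skeleta $K^{(n)}$, $\Pi(K)=(\pi_2(|K|,|K^{(1)}|),\pi(|K^{(1)}|,|K^{(0)}|),\partial)$ is its fundamental crossed module (fundamental groupoid of $|K^{(1)}|$ on the base points $|K^{(0)}|$, acting on the relative homotopy groups $\pi_2(|K|,|K^{(1)}|,a)$, with the usual boundary maps). The nerve $N(\mathcal G,\mathcal P,\partial)$ is the simplicial set $[n]\mapsto\mathbf{Xmod}(\Pi(\Delta[n]),(\mathcal G,\mathcal P,\partial))$, and $\mathrm B(\mathcal G,\mathcal P,\partial)=|N(\mathcal G,\mathcal P,\partial)|$. Up to natural isomorphism, an $n$-simplex is a system $(g_{i,j,k},p_{i,j},a_i)_{0\le i\le j\le k\le n}$ of objects $a_i$ of $\mathcal P$, arrows $p_{i,j}:a_i\to a_j$ with $p_{i,i}=1$, and $g_{i,j,k}\in\mathcal G(a_i)$ with $g_{i,i,j}=g_{i,j,j}=1$, $\partial g_{i,j,k}=p_{i,k}^{-1}\circ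 p_{j,k}\circ p_{i,j}$, and $g_{i,j,k}^{-1}\cdot g_{i,k,l}^{-1}\cdot g_{i,j,l}\cdot{}^{p_{i,j}^{-1}}g_{j,k,l}=1$ for $i\le j\le k\le l$. **Homotopy pullback crossed module $(\varphi,F)\!\downarrow\!(\varphi',F')$.** Its groupoid has objects the triples $(a,q,a')$ with $a\in\mathrm{Ob}\mathcal P$, $a'\in\mathrm{Ob}\mathcal P'$ and $q:Fa\to F'a'$ in $\mathcal Q$; morphisms $(p,h,p'):(a_0,q_0,a'_0)\to(a_1,q_1,a_1')$ consist of $p:a_0\to a_1$ in $\mathcal P$, $p':a'_0\to a_1'$ in $\mathcal P'$ and $h\in\mathcal H(Fa_0)$ with $\partial h=Fp^{-1}\circ q_1^{-1}\circ F'p'\circ q_0$; composition is $(p_2,h_2,p_2')\circ(p_1,h_1,p_1')=(p_2\circ p_1,{}^{Fp_1^{-1}}h_2\cdot h_1,p_2'\circ p_1')$, and identities are $(1_a,1,1_{a'})$. Its group functor is $(a,q,a')\mapsto\mathcal G(a)\times\mathcal G'(a')$ with ${}^{(p,h,p')}(g,g')=({}^pg,{}^{p'}g')$, and its boundary map at $(a,q,a')$ is $\partial(g,g')=(\partial g,\varphi g^{-1}\cdot{}^{q^{-1}}\varphi'g',\partial g')$. **Pullback and canonical morphism.** The pullback crossed module has groupoid $\mathcal P\times_{\mathcal Q}\mathcal P'$ (pullback of $F,F'$), group functor $(a,a')\mapsto\mathcal G(a)\times_{\mathcal H(Fa)}\mathcal G'(a')=\{(g,g')\mid\varphi g=\varphi'g'\}$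 with componentwise action, and boundary $\partial(g,g')=(\partial g,\partial g')$. The canonical morphism sends a morphism $(p,p'):(a,a')\to(b,b')$ to $(p,1_{\mathcal H(Fa)},p'):(a,1_{Fa},a')\to(b,1_{Fb},b')$ and on groups is the inclusion $\mathcal G(a)\times_{\mathcal H(Fa)}\mathcal G'(a')\hookrightarrow\mathcal G(a)\times\mathcal G'(a')$. *)

theory Defs
  imports "HOL-Homology.Simplices"
begin

section \<open>Small groupoids and crossed modules\<close>

text \<open>
  Arrows form a family of sets indexed by source and target. These sets need not be disjoint, so
  operations on arrows take the objects involved as arguments: for \<open>p : a \<rightarrow> b\<close> and
  \<open>q : b \<rightarrow> c\<close>, the term \<open>Comp P a b c q p\<close> is the composite \<open>q \<circ> p : a \<rightarrow> c\<close>.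
\<close>

record ('o, 'm) gpd =
  Obj :: "'o set"
  Arr :: "'o \<Rightarrow> 'o \<Rightarrow> 'm set"
  Comp :: "'o \<Rightarrow> 'o \<Rightarrow> 'o \<Rightarrow> 'm \<Rightarrow> 'm \<Rightarrow> 'm"
  Ident :: "'o \<Rightarrow> 'm"

locale groupoid =
  fixes P :: "('o, 'm, 'z) gpd_scheme"
  assumes comp_closed:
    "\<lbrakk>a \<in> Obj P; b \<in> Obj P; c \<in> Obj P; p \<in> Arr P a b; q \<in> Arr P b c\<rbrakk>
      \<Longrightarrow> Comp P a b c q p \<in> Arr P a c"
  and ident_closed: "a \<in> Obj P \<Longrightarrow> Ident P a \<in> Arr P a a"
  and comp_assoc:
    "\<lbrakk>a \<in> Obj P; b \<in> Obj P; c \<in> Obj P; d \<in> Obj P;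
      p \<in> Arr P a b; q \<in> Arr P b c; r \<in> Arr P c d\<rbrakk>
      \<Longrightarrow> Comp P a c d r (Comp P a b c q p) = Comp P a b d (Comp P b c d r q) p"
  and ident_left: "\<lbrakk>a \<in> Obj P; b \<in> Obj P; p \<in> Arr P a b\<rbrakk> \<Longrightarrow> Comp P a b b (Ident P b) p = p"
  and ident_right: "\<lbrakk>a \<in> Obj P; b \<in> Obj P; p \<in> Arr P a b\<rbrakk> \<Longrightarrow> Comp P a a b p (Ident P a) = p"
  and inverse_exists:
    "\<lbrakk>a \<in> Obj P; b \<in> Obj P; p \<in> Arr P a b\<rbrakk>
      \<Longrightarrow> \<exists>q\<in>Arr P b a. Comp P a b a q p = Ident P a \<and> Comp P b a b p q = Ident P b"

definition Inv :: "('o, 'm, 'z) gpd_scheme \<Rightarrow> 'o \<Rightarrow> 'o \<Rightarrow> 'm \<Rightarrow> 'm" where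
  "Inv P a b p =
    (THE q. q \<in> Arr P b a \<and> Comp P a b a q p = Ident P a \<and> Comp P b a b p q = Ident P b)"

definition Aut :: "('o, 'm, 'z) gpd_scheme \<Rightarrow> 'o \<Rightarrow> 'm monoid" where
  "Aut P a = \<lparr>carrier = Arr P a a, mult = Comp P a a a, one = Ident P a\<rparr>"

text \<open>\<open>Conj P a b p q\<close> is \<open>p \<circ> q \<circ> p\<^sup>-\<^sup>1\<close>, for \<open>p : a \<rightarrow> b\<close> and \<open>q : a \<rightarrow> a\<close>.\<close>

definition Conj :: "('o, 'm, 'z) gpd_scheme \<Rightarrow> 'o \<Rightarrow> 'o \<Rightarrow> 'm \<Rightarrow> 'm \<Rightarrow> 'm" where
  "Conj P a b p q = Comp P b a b p (Comp P b a a q (Inv P a b p))"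

text \<open>For \<open>p : a \<rightarrow> b\<close>, the map \<open>Act X a b p\<close> sends \<open>g\<close> in the group at \<open>a\<close> to \<open>\<^sup>pg\<close> in the group at \<open>b\<close>.\<close>

record ('o, 'm, 'g) xmod = "('o, 'm) gpd" +
  Grp :: "'o \<Rightarrow> 'g monoid"
  Act :: "'o \<Rightarrow> 'o \<Rightarrow> 'm \<Rightarrow> 'g \<Rightarrow> 'g"
  Bdry :: "'o \<Rightarrow> 'g \<Rightarrow> 'm"

locale crossed_module = groupoid X for X :: "('o, 'm, 'g) xmod" +
  assumes group_Grp: "a \<in> Obj X \<Longrightarrow> group (Grp X a)"
  and act_hom:
    "\<lbrakk>a \<in> Obj X; b \<in> Obj X; p \<in> Arr X a b\<rbrakk> \<Longrightarrow> Act X a b p \<in> hom (Grp X a) (Grp X b)"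
  and act_ident: "\<lbrakk>a \<in> Obj X; g \<in> carrier (Grp X a)\<rbrakk> \<Longrightarrow> Act X a a (Ident X a) g = g"
  and act_comp:
    "\<lbrakk>a \<in> Obj X; b \<in> Obj X; c \<in> Obj X; p \<in> Arr X a b; q \<in> Arr X b c; g \<in> carrier (Grp X a)\<rbrakk>
      \<Longrightarrow> Act X a c (Comp X a b c q p) g = Act X b c q (Act X a b p g)"
  and bdry_hom: "a \<in> Obj X \<Longrightarrow> Bdry X a \<in> hom (Grp X a) (Aut X a)"
  and bdry_natural:
    "\<lbrakk>a \<in> Obj X; b \<in> Obj X; p \<in> Arr X a b; g \<in> carrier (Grp X a)\<rbrakk>
      \<Longrightarrow> Bdry X b (Act X a b p g) = Conj X a b p (Bdry X a g)"
  and peiffer: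
    "\<lbrakk>a \<in> Obj X; g \<in> carrier (Grp X a); g' \<in> carrier (Grp X a)\<rbrakk>
      \<Longrightarrow> Act X a a (Bdry X a g) g' = g \<otimes>\<^bsub>Grp X a\<^esub> g' \<otimes>\<^bsub>Grp X a\<^esub> inv\<^bsub>Grp X a\<^esub> g"

record ('o, 'm, 'g, 'o1, 'm1, 'g1) xmor =
  on_obj :: "'o \<Rightarrow> 'o1"
  on_arr :: "'o \<Rightarrow> 'o \<Rightarrow> 'm \<Rightarrow> 'm1"
  on_grp :: "'o \<Rightarrow> 'g \<Rightarrow> 'g1"

locale xmod_morphism = dom: crossed_module X + cod: crossed_module Y
  for X :: "('o, 'm, 'g) xmod" and Y :: "('o1, 'm1, 'g1) xmod" +
  fixes f :: "('o, 'm, 'g, 'o1, 'm1, 'g1) xmor"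
  assumes obj_closed: "a \<in> Obj X \<Longrightarrow> on_obj f a \<in> Obj Y"
  and arr_closed:
    "\<lbrakk>a \<in> Obj X; b \<in> Obj X; p \<in> Arr X a b\<rbrakk>
      \<Longrightarrow> on_arr f a b p \<in> Arr Y (on_obj f a) (on_obj f b)"
  and arr_ident: "a \<in> Obj X \<Longrightarrow> on_arr f a a (Ident X a) = Ident Y (on_obj f a)"
  and arr_comp:
    "\<lbrakk>a \<in> Obj X; b \<in> Obj X; c \<in> Obj X; p \<in> Arr X a b; q \<in> Arr X b c\<rbrakk>
      \<Longrightarrow> on_arr f a c (Comp X a b c q p) =
          Comp Y (on_obj f a) (on_obj f b) (on_obj f c) (on_arr f b c q) (on_arr f a b p)"
  and grp_hom: "a \<in> Obj X \<Longrightarrow> on_grp f a \<in> hom (Grp X a) (Grp Y (on_obj f a))"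
  and grp_natural:
    "\<lbrakk>a \<in> Obj X; b \<in> Obj X; p \<in> Arr X a b; g \<in> carrier (Grp X a)\<rbrakk>
      \<Longrightarrow> on_grp f b (Act X a b p g) =
          Act Y (on_obj f a) (on_obj f b) (on_arr f a b p) (on_grp f a g)"
  and bdry_compat:
    "\<lbrakk>a \<in> Obj X; g \<in> carrier (Grp X a)\<rbrakk>
      \<Longrightarrow> Bdry Y (on_obj f a) (on_grp f a g) = on_arr f a a (Bdry X a g)"

locale xmod_fibration = xmod_morphism X Y f
  for X :: "('o, 'm, 'g) xmod" and Y :: "('o1, 'm1, 'g1) xmod" and f +
  assumes arr_lift:
    "\<lbrakk>a \<in> Obj X; b \<in> Obj Y; q \<in> Arr Y (on_obj f a) b\<rbrakk>
      \<Longrightarrow> \<exists>a'\<in>Obj X. \<exists>p\<in>Arr X a a'. on_obj f a' = b \<and> on_arr f a a' p = q"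
  and grp_surj:
    "a \<in> Obj X \<Longrightarrow> on_grp f a ` carrier (Grp X a) = carrier (Grp Y (on_obj f a))"


section \<open>Pullback and homotopy pullback\<close>

definition xmod_pullback ::
  "('o, 'm, 'g, 'o1, 'm1, 'g1) xmor \<Rightarrow> ('o2, 'm2, 'g2, 'o1, 'm1, 'g1) xmor \<Rightarrow>
   ('o, 'm, 'g) xmod \<Rightarrow> ('o2, 'm2, 'g2) xmod \<Rightarrow>
   ('o \<times> 'o2, 'm \<times> 'm2, 'g \<times> 'g2) xmod"
  where
  "xmod_pullback f f' X X' =
    \<lparr>Obj = {(a, a'). a \<in> Obj X \<and> a' \<in> Obj X' \<and> on_obj f a = on_obj f' a'},
     Arr = (\<lambda>(a, a') (b, b').
       {(p, p'). p \<in> Arr X a b \<and> p' \<in> Arr X' a' b' \<and> on_arr f a b p = on_arr f' a' b' p'}),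
     Comp = (\<lambda>(a, a') (b, b') (c, c') (q, q') (p, p').
       (Comp X a b c q p, Comp X' a' b' c' q' p')),
     Ident = (\<lambda>(a, a'). (Ident X a, Ident X' a')),
     Grp = (\<lambda>(a, a'). (Grp X a \<times>\<times> Grp X' a')
       \<lparr>carrier := {(g, g'). g \<in> carrier (Grp X a) \<and> g' \<in> carrier (Grp X' a') \<and>
                             on_grp f a g = on_grp f' a' g'}\<rparr>),
     Act = (\<lambda>(a, a') (b, b') (p, p') (g, g'). (Act X a b p g, Act X' a' b' p' g')),
     Bdry = (\<lambda>(a, a') (g, g'). (Bdry X a g, Bdry X' a' g'))\<rparr>"

definition xmod_hpullback ::
  "('o, 'm, 'g, 'o1, 'm1, 'g1) xmor \<Rightarrow> ('o2, 'm2, 'g2, 'o1, 'm1, 'g1) xmor \<Rightarrow>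
   ('o, 'm, 'g) xmod \<Rightarrow> ('o2, 'm2, 'g2) xmod \<Rightarrow> ('o1, 'm1, 'g1) xmod \<Rightarrow>
   ('o \<times> 'm1 \<times> 'o2, 'm \<times> 'g1 \<times> 'm2, 'g \<times> 'g2) xmod"
  where
  "xmod_hpullback f f' X X' Y =
    \<lparr>Obj = {(a, q, a'). a \<in> Obj X \<and> a' \<in> Obj X' \<and> q \<in> Arr Y (on_obj f a) (on_obj f' a')},
     Arr = (\<lambda>(a0, q0, a0') (a1, q1, a1').
       let F0 = on_obj f a0; F1 = on_obj f a1; F0' = on_obj f' a0'; F1' = on_obj f' a1' in
       {(p, h, p'). p \<in> Arr X a0 a1 \<and> p' \<in> Arr X' a0' a1' \<and> h \<in> carrier (Grp Y F0) \<and>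
          Bdry Y F0 h =
            Comp Y F0 F1 F0 (Inv Y F0 F1 (on_arr f a0 a1 p))
              (Comp Y F0 F1' F1 (Inv Y F1 F1' q1)
                (Comp Y F0 F0' F1' (on_arr f' a0' a1' p') q0))}),
     Comp = (\<lambda>(a0, q0, a0') (a1, q1, a1') (a2, q2, a2') (p2, h2, p2') (p1, h1, p1').
       let F0 = on_obj f a0; F1 = on_obj f a1 in
       (Comp X a0 a1 a2 p2 p1,
        Act Y F1 F0 (Inv Y F0 F1 (on_arr f a0 a1 p1)) h2 \<otimes>\<^bsub>Grp Y F0\<^esub> h1,
        Comp X' a0' a1' a2' p2' p1')),
     Ident = (\<lambda>(a, q, a'). (Ident X a, \<one>\<^bsub>Grp Y (on_obj f a)\<^esub>, Ident X' a')),
     Grp = (\<lambda>(a, q, a'). Grp X a \<times>\<times> Grp X' a'),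
     Act = (\<lambda>(a0, q0, a0') (a1, q1, a1') (p, h, p') (g, g').
       (Act X a0 a1 p g, Act X' a0' a1' p' g')),
     Bdry = (\<lambda>(a, q, a') (g, g').
       let F = on_obj f a; F' = on_obj f' a' in
       (Bdry X a g,
        on_grp f a (inv\<^bsub>Grp X a\<^esub> g) \<otimes>\<^bsub>Grp Y F\<^esub> Act Y F' F (Inv Y F F' q) (on_grp f' a' g'),
        Bdry X' a' g'))\<rparr>"

definition canonical_xmor ::
  "('o, 'm, 'g, 'o1, 'm1, 'g1) xmor \<Rightarrow> ('o1, 'm1, 'g1) xmod \<Rightarrow>
   ('o \<times> 'o2, 'm \<times> 'm2, 'g \<times> 'g2,
    'o \<times> 'm1 \<times> 'o2, 'm \<times> 'g1 \<times> 'm2, 'g \<times> 'g2) xmor"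
  where
  "canonical_xmor f Y =
    \<lparr>on_obj = (\<lambda>(a, a'). (a, Ident Y (on_obj f a), a')),
     on_arr = (\<lambda>(a, a') (b, b') (p, p'). (p, \<one>\<^bsub>Grp Y (on_obj f a)\<^esub>, p')),
     on_grp = (\<lambda>(a, a') (g, g'). (g, g'))\<rparr>"


section \<open>Simplicial sets and geometric realization\<close>

text \<open>Monotone maps \<open>{0..m} \<rightarrow> {0..n}\<close>; their values outside \<open>{0..m}\<close> play no role.\<close>

definition delta :: "nat \<Rightarrow> nat \<Rightarrow> (nat \<Rightarrow> nat) set" where
  "delta m n = {\<theta>. mono_on {..m} \<theta> \<and> \<theta> ` {..m} \<subseteq> {..n}}"

text \<open>For \<open>\<theta> \<in> delta m n\<close>, the map \<open>Op K m n \<theta>\<close> goes from \<open>Spx K n\<close> to \<open>Spx K m\<close>.\<close>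

record 's sset =
  Spx :: "nat \<Rightarrow> 's set"
  Op :: "nat \<Rightarrow> nat \<Rightarrow> (nat \<Rightarrow> nat) \<Rightarrow> 's \<Rightarrow> 's"

definition push_simplex :: "nat \<Rightarrow> (nat \<Rightarrow> nat) \<Rightarrow> (nat \<Rightarrow> real) \<Rightarrow> nat \<Rightarrow> real" where
  "push_simplex m \<theta> t = (\<lambda>j. \<Sum>i | i \<le> m \<and> \<theta> i = j. t i)"

text \<open>The disjoint union of the spaces \<open>K\<^sub>n \<times> \<Delta>\<^sup>n\<close>, with \<open>K\<^sub>n\<close> discrete.\<close>

definition cells :: "'s sset \<Rightarrow> ((nat \<times> 's) \<times> (nat \<Rightarrow> real)) topology" where
  "cells K = sum_topology
     (\<lambda>(n, x). subtopology (powertop_real UNIV) (standard_simplex n)) (SIGMA n:UNIV. Spx K n)"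

definition glue ::
  "'s sset \<Rightarrow> (nat \<times> 's) \<times> (nat \<Rightarrow> real) \<Rightarrow> (nat \<times> 's) \<times> (nat \<Rightarrow> real) \<Rightarrow> bool" where
  "glue K u v \<longleftrightarrow> (\<exists>m n. \<exists>\<theta>\<in>delta m n. \<exists>x\<in>Spx K n. \<exists>t\<in>standard_simplex m.
     u = ((m, Op K m n \<theta> x), t) \<and> v = ((n, x), push_simplex m \<theta> t))"

definition point ::
  "'s sset \<Rightarrow> (nat \<times> 's) \<times> (nat \<Rightarrow> real) \<Rightarrow> ((nat \<times> 's) \<times> (nat \<Rightarrow> real)) set" where
  "point K u = {v. equivclp (glue K) u v}"

definition image_topology :: "'a topology \<Rightarrow> ('a \<Rightarrow> 'b) \<Rightarrow> 'b topology" where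
  "image_topology X f =
    topology (\<lambda>U. U \<subseteq> f ` topspace X \<and> openin X {x \<in> topspace X. f x \<in> U})"

lemma openin_image_topology:
  "openin (image_topology X f) U \<longleftrightarrow>
    U \<subseteq> f ` topspace X \<and> openin X {x \<in> topspace X. f x \<in> U}"
proof -
  have "istopology (\<lambda>U. U \<subseteq> f ` topspace X \<and> openin X {x \<in> topspace X. f x \<in> U})"
    unfolding istopology_def
  proof (intro conjI allI impI; (elim conjE)?)
    fix S T
    assume S: "S \<subseteq> f ` topspace X" "openin X {x \<in> topspace X. f x \<in> S}"
      and T: "T \<subseteq> f ` topspace X" "openin X {x \<in> topspace X. f x \<in> T}"
    have "{x \<in> topspace X. f x \<in> S \<inter> T} =
        {x \<in> topspace X. f x \<in> S} \<inter> {x \<in> topspace X. f x \<in> T}"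
      by auto
    then show "openin X {x \<in> topspace X. f x \<in> S \<inter> T}"
      using S T by auto
    show "S \<inter> T \<subseteq> f ` topspace X"
      using S by auto
  next
    fix \<K>
    assume \<K>: "\<forall>K\<in>\<K>. K \<subseteq> f ` topspace X \<and> openin X {x \<in> topspace X. f x \<in> K}"
    then show "\<Union>\<K> \<subseteq> f ` topspace X"
      by auto
    have "{x \<in> topspace X. f x \<in> \<Union>\<K>} = (\<Union>K\<in>\<K>. {x \<in> topspace X. f x \<in> K})"
      by auto
    then show "openin X {x \<in> topspace X. f x \<in> \<Union>\<K>}"
      using \<K> by auto
  qed
  then show ?thesis
    unfolding image_topology_def by simp
qed

lemma quotient_map_image_topology: "quotient_map X (image_topology X f) f"
proof -
  have *: "{x \<in> topspace X. f x \<in> f ` topspace X} = topspace X"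
    by auto
  have "openin (image_topology X f) (f ` topspace X)"
    unfolding openin_image_topology * by simp
  then have "f ` topspace X \<subseteq> topspace (image_topology X f)"
    by (rule openin_subset)
  moreover have "topspace (image_topology X f) \<subseteq> f ` topspace X"
    using openin_topspace[of "image_topology X f"] unfolding openin_image_topology
    by (rule conjunct1)
  ultimately have top: "topspace (image_topology X f) = f ` topspace X"
    by (rule subset_antisym[rotated])
  show ?thesis
    unfolding quotient_map_def top openin_image_topology by blast
qed

definition realization :: "'s sset \<Rightarrow> ((nat \<times> 's) \<times> (nat \<Rightarrow> real)) set topology" where
  "realization K = image_topology (cells K) (point K)"

text \<open>The map \<open>[x, t] \<mapsto> [f x, t]\<close> of realizations induced by a simplicial map \<open>f\<close> into \<open>L\<close>.\<close>

definition realization_map ::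
  "'t sset \<Rightarrow> (nat \<Rightarrow> 's \<Rightarrow> 't) \<Rightarrow>
   ((nat \<times> 's) \<times> (nat \<Rightarrow> real)) set \<Rightarrow> ((nat \<times> 't) \<times> (nat \<Rightarrow> real)) set"
  where
  "realization_map L f c = the_elem ((\<lambda>((n, x), t). point L ((n, f n x), t)) ` c)"

definition homotopy_equivalence :: "'a topology \<Rightarrow> 'b topology \<Rightarrow> ('a \<Rightarrow> 'b) \<Rightarrow> bool" where
  "homotopy_equivalence X Y f \<longleftrightarrow> continuous_map X Y f \<and>
    (\<exists>g. continuous_map Y X g \<and>
      homotopic_with (\<lambda>_. True) X X (g \<circ> f) id \<and> homotopic_with (\<lambda>_. True) Y Y (f \<circ> g) id)"


section \<open>Nerve and classifying space\<close>

text \<open>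
  An \<open>n\<close>-simplex of the nerve is a system \<open>(g\<^sub>i\<^sub>j\<^sub>k, p\<^sub>i\<^sub>j, a\<^sub>i)\<close>, \<open>0 \<le> i \<le> j \<le> k \<le> n\<close>, which is the standard
  description, up to natural isomorphism, of a morphism to \<open>X\<close> from the fundamental crossed module
  of \<open>\<Delta>[n]\<close>. The families are \<open>undefined\<close> outside the index range, so that equality of systems is
  equality of values.
\<close>

type_synonym ('o, 'm, 'g) system =
  "(nat \<Rightarrow> nat \<Rightarrow> nat \<Rightarrow> 'g) \<times> (nat \<Rightarrow> nat \<Rightarrow> 'm) \<times> (nat \<Rightarrow> 'o)"

definition cut_system :: "nat \<Rightarrow> ('o, 'm, 'g) system \<Rightarrow> ('o, 'm, 'g) system" where
  "cut_system n = (\<lambda>(g, p, a).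
     ((\<lambda>i j k. if i \<le> j \<and> j \<le> k \<and> k \<le> n then g i j k else undefined),
      (\<lambda>i j. if i \<le> j \<and> j \<le> n then p i j else undefined),
      (\<lambda>i. if i \<le> n then a i else undefined)))"

definition nerve_simplices :: "('o, 'm, 'g) xmod \<Rightarrow> nat \<Rightarrow> ('o, 'm, 'g) system set" where
  "nerve_simplices X n = {(g, p, a). cut_system n (g, p, a) = (g, p, a) \<and>
     (\<forall>i\<le>n. a i \<in> Obj X) \<and>
     (\<forall>i j. i \<le> j \<and> j \<le> n \<longrightarrow> p i j \<in> Arr X (a i) (a j)) \<and>
     (\<forall>i\<le>n. p i i = Ident X (a i)) \<and>
     (\<forall>i j k. i \<le> j \<and> j \<le> k \<and> k \<le> n \<longrightarrow> g i j k \<in> carrier (Grp X (a i))) \<and>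
     (\<forall>i j. i \<le> j \<and> j \<le> n \<longrightarrow>
        g i i j = \<one>\<^bsub>Grp X (a i)\<^esub> \<and> g i j j = \<one>\<^bsub>Grp X (a i)\<^esub>) \<and>
     (\<forall>i j k. i \<le> j \<and> j \<le> k \<and> k \<le> n \<longrightarrow>
        Bdry X (a i) (g i j k) =
          Comp X (a i) (a k) (a i) (Inv X (a i) (a k) (p i k))
            (Comp X (a i) (a j) (a k) (p j k) (p i j))) \<and>
     (\<forall>i j k l. i \<le> j \<and> j \<le> k \<and> k \<le> l \<and> l \<le> n \<longrightarrow>
        inv\<^bsub>Grp X (a i)\<^esub> (g i j k) \<otimes>\<^bsub>Grp X (a i)\<^esub> inv\<^bsub>Grp X (a i)\<^esub> (g i k l)
          \<otimes>\<^bsub>Grp X (a i)\<^esub> g i j l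
          \<otimes>\<^bsub>Grp X (a i)\<^esub> Act X (a j) (a i) (Inv X (a i) (a j) (p i j)) (g j k l)
        = \<one>\<^bsub>Grp X (a i)\<^esub>)}"

definition nerve :: "('o, 'm, 'g) xmod \<Rightarrow> ('o, 'm, 'g) system sset" where
  "nerve X = \<lparr>Spx = nerve_simplices X,
     Op = (\<lambda>m n \<theta> (g, p, a). cut_system m
       (\<lambda>i j k. g (\<theta> i) (\<theta> j) (\<theta> k), \<lambda>i j. p (\<theta> i) (\<theta> j), \<lambda>i. a (\<theta> i)))\<rparr>"

definition nerve_map ::
  "('o, 'm, 'g, 'o1, 'm1, 'g1) xmor \<Rightarrow> nat \<Rightarrow>
   ('o, 'm, 'g) system \<Rightarrow> ('o1, 'm1, 'g1) system" where
  "nerve_map f n = (\<lambda>(g, p, a). cut_system n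
     (\<lambda>i j k. on_grp f (a i) (g i j k), \<lambda>i j. on_arr f (a i) (a j) (p i j), \<lambda>i. on_obj f (a i)))"

definition classifying_space ::
  "('o, 'm, 'g) xmod \<Rightarrow> ((nat \<times> ('o, 'm, 'g) system) \<times> (nat \<Rightarrow> real)) set topology" where
  "classifying_space X = realization (nerve X)"

text \<open>The map of classifying spaces induced by a morphism \<open>f\<close> with codomain \<open>Y\<close>.\<close>

definition classifying_map ::
  "('o1, 'm1, 'g1) xmod \<Rightarrow> ('o, 'm, 'g, 'o1, 'm1, 'g1) xmor \<Rightarrow>
   ((nat \<times> ('o, 'm, 'g) system) \<times> (nat \<Rightarrow> real)) set \<Rightarrow>
   ((nat \<times> ('o1, 'm1, 'g1) system) \<times> (nat \<Rightarrow> real)) set" where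
  "classifying_map Y f = realization_map (nerve Y) (nerve_map f)"

end

(* Call an inclusion of crossed modules dense if every object is joined by an arrow to the smaller
   one, every arrow between objects of the smaller one lies in it after multiplication by a boundary,
   and group elements with boundary in the smaller one lie in it. If either morphism is a fibration,
   lifting arrows and group elements along it shows that the canonical morphism is dense.

   For a dense inclusion, choose such connecting arrows and correcting group elements, trivial on the
   smaller crossed module. They define a gauge transformation of every simplex of the larger nerve.
   The choices are not functorial, but the result depends only on the objects and arrows of the
   simplex, so it is natural in the simplicial direction. It retracts the larger nerve onto the
   smaller one, and applying it only at the vertices of level 1 gives a simplicial homotopy from
   the identity to this retraction. *)
theory Submission
  imports Defs "HOL-Analysis.Abstract_Topological_Spaces"
begin

section \<open>Realizations of simplicial maps and homotopies\<close>

text \<open>A system does not require its arrows to compose strictly: the elements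
  \<open>g i j k\<close> record the failure. Non-functorial choices are therefore harmless. Whatever
  defect they introduce in a triangle is absorbed by the new group elements, and the Peiffer
  identity then yields the cocycle condition, with no compatibility imposed on the corrections of
  the three edges. Arrows can thus be corrected one at a time, and the group elements follow by
  themselves: their boundaries are composites of corrected arrows. The normalisation on identities
  keeps degenerate edges and triangles trivial. The other difficulty is topological. The homotopy
  must be continuous on the product of the interval with a realization, in the product topology, so
  it is constructed directly on the prism over each cell. The prism is cut into simplices, and the
  bookkeeping is done with cumulative sums of barycentric coordinates, where cutting amounts to
  inserting one number into an increasing sequence.\<close>

locale simplicial_set =
  fixes K :: "'s sset"
  assumes op_closed: "\<lbrakk>\<theta> \<in> delta m n; x \<in> Spx K n\<rbrakk> \<Longrightarrow> Op K m n \<theta> x \<in> Spx K m"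
    and op_ident: "\<lbrakk>x \<in> Spx K n; \<And>i. i \<le> n \<Longrightarrow> \<theta> i = i\<rbrakk> \<Longrightarrow> Op K n n \<theta> x = x"
    and op_comp: "\<lbrakk>\<theta> \<in> delta m n; \<phi> \<in> delta l m; x \<in> Spx K n; \<And>i. i \<le> l \<Longrightarrow> \<psi> i = \<theta> (\<phi> i)\<rbrakk>
      \<Longrightarrow> Op K l m \<phi> (Op K m n \<theta> x) = Op K l n \<psi> x"

locale simplicial_map = dom: simplicial_set K + cod: simplicial_set L
  for K :: "'s sset" and L :: "'t sset" +
  fixes f :: "nat \<Rightarrow> 's \<Rightarrow> 't"
  assumes map_closed: "x \<in> Spx K n \<Longrightarrow> f n x \<in> Spx L n"
    and map_natural:
      "\<lbrakk>\<theta> \<in> delta m n; x \<in> Spx K n\<rbrakk> \<Longrightarrow> f m (Op K m n \<theta> x) = Op L m n \<theta> (f n x)"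

section \<open>Cells, gluing and standard simplices\<close>

lemma delta_iff:
  "\<theta> \<in> delta m n \<longleftrightarrow> (\<forall>i j. i \<le> j \<and> j \<le> m \<longrightarrow> \<theta> i \<le> \<theta> j) \<and> (\<forall>i\<le>m. \<theta> i \<le> n)"
  unfolding delta_def mono_on_def by (auto simp: image_subset_iff)

lemma topspace_cells:
  "topspace (cells K) = {((n, x), t). x \<in> Spx K n \<and> t \<in> standard_simplex n}"
  unfolding cells_def by (auto simp: split: prod.splits)

lemma point_eq_iff: "point K u = point K v \<longleftrightarrow> equivclp (glue K) u v"
proof
  assume "point K u = point K v"
  moreover have "v \<in> point K v"
    by (simp add: point_def)
  ultimately have "v \<in> point K u"
    by simp
  then show "equivclp (glue K) u v"
    unfolding point_def by simp
next
  assume "equivclp (glue K) u v"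
  then show "point K u = point K v"
    unfolding point_def by (blast intro: equivclp_sym equivclp_trans)
qed

lemma point_glue:
  "\<lbrakk>\<theta> \<in> delta m n; x \<in> Spx K n; t \<in> standard_simplex m\<rbrakk>
    \<Longrightarrow> point K ((m, Op K m n \<theta> x), t) = point K ((n, x), push_simplex m \<theta> t)"
  unfolding point_eq_iff by (rule r_into_equivclp) (auto simp: glue_def)

lemma topspace_realization: "topspace (realization K) = point K ` topspace (cells K)"
  unfolding realization_def using quotient_imp_surjective_map[OF quotient_map_image_topology] by metis

lemma standard_simplexI:
  assumes "\<And>i. 0 \<le> x i" "\<And>i. i > p \<Longrightarrow> x i = 0" "(\<Sum>i\<le>p. x i) = 1"
  shows "x \<in> standard_simplex p"
proof -
  have "x i \<le> 1" for i
  proof (cases "i \<le> p")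
    case True
    then have "x i \<le> (\<Sum>i\<le>p. x i)"
      using assms(1) by (intro member_le_sum) auto
    then show ?thesis using assms(3) by simp
  qed (use assms(2) in auto)
  then show ?thesis
    using assms by (auto simp: standard_simplex_def)
qed

lemma push_simplex_closed:
  assumes "\<theta> \<in> delta m n" "t \<in> standard_simplex m"
  shows "push_simplex m \<theta> t \<in> standard_simplex n"
proof (rule standard_simplexI)
  show "0 \<le> push_simplex m \<theta> t i" for i
    using assms(2) by (auto simp: push_simplex_def standard_simplex_def intro!: sum_nonneg)
  show "push_simplex m \<theta> t i = 0" if "i > n" for i
  proof -
    have "{k. k \<le> m \<and> \<theta> k = i} = {}"
      using assms(1) that by (auto simp: delta_iff)
    then show ?thesis unfolding push_simplex_def by (simp only: sum.empty)
  qed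
  have "(\<Sum>j\<le>n. \<Sum>i | i \<in> {..m} \<and> \<theta> i = j. t i) = sum t {..m}"
    using assms(1) by (intro sum.group) (auto simp: delta_iff)
  then show "(\<Sum>i\<le>n. push_simplex m \<theta> t i) = 1"
    using assms(2) by (simp add: push_simplex_def standard_simplex_def)
qed

text \<open>Summands are open, so the slabs formed by \<open>Z\<close> times one summand are an open
  cover and the pasting lemma applies. With \<open>Z\<close> the unit interval, a homotopy can be
  defined cell by cell.\<close>

lemma continuous_map_prod_sum_topology:
  assumes "\<And>i. i \<in> I \<Longrightarrow> continuous_map (prod_topology Z (X i)) Y (\<lambda>(z, x). g (z, (i, x)))"
  shows "continuous_map (prod_topology Z (sum_topology X I)) Y g"
proof (rule pasting_lemma[where I = I and T = "\<lambda>i. topspace Z \<times> ({i} \<times> topspace (X i))" and f = "\<lambda>_. g"])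
  fix i assume i: "i \<in> I"
  have "openin (sum_topology X I) ({i} \<times> topspace (X i))"
  proof -
    have "{i} \<times> topspace (X i) = Pair i ` topspace (X i)"
      by auto
    then show ?thesis
      using open_map_component_injection[OF i, of X] unfolding open_map_def by simp
  qed
  then show "openin (prod_topology Z (sum_topology X I)) (topspace Z \<times> ({i} \<times> topspace (X i)))"
    by (simp add: openin_prod_Times_iff)
  \<comment> \<open>On a slab, \<open>snd\<close> inverts the injection of the summand, and this
    injection is an open map.\<close>
  have "continuous_map (subtopology (sum_topology X I) ({i} \<times> topspace (X i))) (X i) snd"
    unfolding continuous_map_def
  proof (intro conjI allI impI)
    fix U assume "openin (X i) U"
    then have *: "openin (sum_topology X I) (Pair i ` U)" "U \<subseteq> topspace (X i)"
      using open_map_component_injection[OF i, of X] openin_subset[of "X i" U] by (simp_all add: open_map_def)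
    have "{x \<in> topspace (subtopology (sum_topology X I) ({i} \<times> topspace (X i))). snd x \<in> U}
        = Pair i ` U \<inter> ({i} \<times> topspace (X i))"
      using * i by auto
    then show "openin (subtopology (sum_topology X I) ({i} \<times> topspace (X i)))
        {x \<in> topspace (subtopology (sum_topology X I) ({i} \<times> topspace (X i))). snd x \<in> U}"
      using *(1) by (auto simp: openin_subtopology)
  qed auto
  from continuous_map_compose[OF continuous_map_snd this, of Z]
  have "continuous_map (prod_topology Z (subtopology (sum_topology X I) ({i} \<times> topspace (X i))))
      (prod_topology Z (X i)) (\<lambda>(z, x). (z, snd x))"
    unfolding split_def o_def by (intro continuous_map_pairedI continuous_map_fst)
  then have "continuous_map (prod_topology Z (subtopology (sum_topology X I) ({i} \<times> topspace (X i)))) Y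
      ((\<lambda>(z, x). g (z, (i, x))) \<circ> (\<lambda>(z, x). (z, snd x)))"
    using assms[OF i] continuous_map_compose by blast
  then have "continuous_map (prod_topology Z (subtopology (sum_topology X I) ({i} \<times> topspace (X i)))) Y g"
    by (rule continuous_map_eq) auto
  moreover have "subtopology (prod_topology Z (sum_topology X I)) (topspace Z \<times> ({i} \<times> topspace (X i)))
      = prod_topology Z (subtopology (sum_topology X I) ({i} \<times> topspace (X i)))"
    by (simp add: subtopology_Times)
  ultimately show "continuous_map (subtopology (prod_topology Z (sum_topology X I)) 
      (topspace Z \<times> ({i} \<times> topspace (X i)))) Y g"
    by simp
qed auto

lemma continuous_map_sum_topology:
  assumes "\<And>i. i \<in> I \<Longrightarrow> continuous_map (X i) Y (\<lambda>x. g (i, x))"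
  shows "continuous_map (sum_topology X I) Y g"
  unfolding continuous_map_def
proof (intro conjI allI impI)
  show "g \<in> topspace (sum_topology X I) \<rightarrow> topspace Y"
    using assms by (fastforce simp: continuous_map_def Pi_iff)
  fix U assume U: "openin Y U"
  have "{x. (i, x) \<in> {x \<in> topspace (sum_topology X I). g x \<in> U}}
      = {x \<in> topspace (X i). g (i, x) \<in> U}" if "i \<in> I" for i
    using that by auto
  then show "openin (sum_topology X I) {x \<in> topspace (sum_topology X I). g x \<in> U}"
    using assms U by (auto simp: openin_sum_topology continuous_map_def)
qed

section \<open>Continuous maps induced by simplicial maps\<close>

context simplicial_map
begin

text \<open>By naturality of \<open>f\<close>, a generating identification of \<open>K\<close> goes
  to one of \<open>L\<close>; induction passes to the generated equivalence.\<close>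

lemma point_map_cong:
  assumes "equivclp (glue K) ((n, x), t) ((n', x'), t')"
  shows "point L ((n, f n x), t) = point L ((n', f n' x'), t')"
proof -
  define F where "F = (\<lambda>((n, x), t :: nat \<Rightarrow> real). ((n, f n x), t))"
  have *: "point L (F u) = point L (F v)" if "glue K u v" for u v
  proof -
    from that obtain m n \<theta> x t where "\<theta> \<in> delta m n" "x \<in> Spx K n" "t \<in> standard_simplex m"
      "u = ((m, Op K m n \<theta> x), t)" "v = ((n, x), push_simplex m \<theta> t)"
      unfolding glue_def by blast
    then show ?thesis
      using map_closed[of x n] by (simp add: F_def map_natural point_glue)
  qed
  have "point L (F u) = point L (F v)" if "equivclp (glue K) u v" for u v
    using that by (induction rule: equivclp_induct) (use * in auto)
  from this[OF assms] show ?thesis by (simp add: F_def)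
qed

text \<open>\<open>realization_map\<close> picks the only element of the image of a whole class;
  \<open>point_map_cong\<close> is what makes that image a singleton.\<close>

lemma realization_map_point: "realization_map L f (point K ((n, x), t)) = point L ((n, f n x), t)"
proof -
  have "(\<lambda>((n, x), t). point L ((n, f n x), t)) ` point K ((n, x), t) = {point L ((n, f n x), t)}"
  proof (intro equalityI subsetI)
    fix y assume "y \<in> (\<lambda>((n, x), t). point L ((n, f n x), t)) ` point K ((n, x), t)"
    then show "y \<in> {point L ((n, f n x), t)}"
      using point_map_cong unfolding point_def by fastforce
  next
    fix y assume "y \<in> {point L ((n, f n x), t)}"
    moreover have "((n, x), t) \<in> point K ((n, x), t)"
      by (simp add: point_def)
    ultimately show "y \<in> (\<lambda>((n, x), t). point L ((n, f n x), t)) ` point K ((n, x), t)"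
      by force
  qed
  then show ?thesis by (simp add: realization_map_def)
qed

lemma continuous_map_realization_map:
  "continuous_map (realization K) (realization L) (realization_map L f)"
proof -
  have q: "quotient_map (cells K) (realization K) (point K)"
    and q': "quotient_map (cells L) (realization L) (point L)"
    unfolding realization_def by (rule quotient_map_image_topology)+
  have "continuous_map (cells K) (cells L) (\<lambda>((n, x), t). ((n, f n x), t))"
    unfolding cells_def
  proof (rule continuous_map_sum_topology, clarsimp)
    fix n x assume "x \<in> Spx K n"
    then have "(n, f n x) \<in> (SIGMA n:UNIV. Spx L n)"
      by (simp add: map_closed)
    from continuous_map_component_injection[OF this,
        of "\<lambda>(n, x). subtopology (powertop_real UNIV) (standard_simplex n)"]
    show "continuous_map (subtopology (powertop_real UNIV) (standard_simplex n))
          (sum_topology (\<lambda>(n, x). subtopology (powertop_real UNIV) (standard_simplex n)) (Sigma UNIV (Spx L)))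
          (\<lambda>x'. ((n, f n x), x'))"
      by simp
  qed
  then have "continuous_map (cells K) (realization L) (point L \<circ> (\<lambda>((n, x), t). ((n, f n x), t)))"
    by (rule continuous_map_compose) (rule quotient_imp_continuous_map[OF q'])
  then have "continuous_map (cells K) (realization L) (realization_map L f \<circ> point K)"
    by (rule continuous_map_eq) (auto simp: realization_map_point)
  then show ?thesis
    using q by (simp add: continuous_compose_quotient_map_eq)
qed

end


section \<open>Cutting prisms by cumulative sums of barycentric coordinates\<close>

lemma simplex_partial_sum_le:
  assumes "t \<in> standard_simplex n"
  shows "sum t {..<k} \<le> 1" "0 \<le> sum t {..<k}" "k > n \<Longrightarrow> sum t {..<k} = 1"
proof -
  have nn: "0 \<le> t i" for i
    using assms by (simp add: standard_simplex_def)
  then show "0 \<le> sum t {..<k}"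
    by (simp add: sum_nonneg)
  have 1: "sum t {..<k} = 1" if "k > n" for k
  proof -
    have "sum t {..n} = sum t {..<k}"
      using that assms by (intro sum.mono_neutral_left) (auto simp: standard_simplex_def)
    then show ?thesis
      using assms by (simp add: standard_simplex_def)
  qed
  then show "k > n \<Longrightarrow> sum t {..<k} = 1" .
  have "sum t {..<k} \<le> sum t {..<max k (Suc n)}"
    using nn by (intro sum_mono2) auto
  also have "\<dots> = 1"
    by (rule 1) simp
  finally show "sum t {..<k} \<le> 1" .
qed

text \<open>The identities for \<open>cut\<close> below are compared through cumulative sums. There
  a point of a simplex is an increasing sequence from 0 to 1, cutting inserts a value, and pushing
  along a monotone map reparametrises the sequence.\<close>

lemma fun_eq_partial_sums:
  fixes f g :: "nat \<Rightarrow> real"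
  assumes "\<And>k. sum f {..<k} = sum g {..<k}"
  shows "f = g"
proof
  fix k
  show "f k = g k"
    using assms[of "Suc k"] assms[of k] by simp
qed

text \<open>The inner sums run over the fibres of \<theta>. For monotone \<theta> the resulting
  index set is an initial segment of the vertices.\<close>

lemma sum_push_simplex: "sum (push_simplex m \<theta> t) {..<j} = sum t {i. i \<le> m \<and> \<theta> i < j}"
proof -
  have "(\<Sum>k<j. \<Sum>i | i \<in> {i. i \<le> m \<and> \<theta> i < j} \<and> \<theta> i = k. t i) = sum t {i. i \<le> m \<and> \<theta> i < j}"
    by (intro sum.group) auto
  moreover have "{i. i \<in> {i. i \<le> m \<and> \<theta> i < j} \<and> \<theta> i = k} = {i. i \<le> m \<and> \<theta> i = k}" if "k < j" for k
    using that by auto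
  ultimately show ?thesis
    by (simp add: push_simplex_def)
qed

text \<open>
  \<open>cut k s t\<close> are the barycentric coordinates of \<open>(t, s)\<close> in the simplex of the prism over
  \<open>\<Delta>\<^sup>n\<close> with vertices \<open>(0, 0), \<dots>, (k, 0), (k, 1), \<dots>, (n, 1)\<close>; here \<open>s\<close> is the total mass at
  level \<open>0\<close>.
\<close>

definition cut :: "nat \<Rightarrow> real \<Rightarrow> (nat \<Rightarrow> real) \<Rightarrow> nat \<Rightarrow> real" where
  "cut k s t i =
    (if i < k then t i else if i = k then s - sum t {..<k}
     else if i = Suc k then sum t {..<Suc k} - s else t (i - 1))"

text \<open>This says that the two new coordinates of \<open>cut k s t\<close>, at positions k and k
  + 1, are nonnegative. The inequalities are weak, so the pieces are closed and neighbours share a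
  wall.\<close>

definition cuts :: "nat \<Rightarrow> real \<Rightarrow> (nat \<Rightarrow> real) \<Rightarrow> bool" where
  "cuts k s t \<longleftrightarrow> sum t {..<k} \<le> s \<and> s \<le> sum t {..<Suc k}"

text \<open>Vertex i of the k-th prism simplex is the pair of \<open>degen k i\<close> and
  \<open>level (Suc k) i\<close>; hence the shift by one wherever \<open>level\<close> is paired
  with \<open>degen\<close>.\<close>

definition level :: "nat \<Rightarrow> nat \<Rightarrow> nat" where
  "level k i = (if i < k then 0 else 1)"

definition degen :: "nat \<Rightarrow> nat \<Rightarrow> nat" where
  "degen k i = (if i \<le> k then i else i - 1)"

definition face :: "nat \<Rightarrow> nat \<Rightarrow> nat" where
  "face k i = (if i < k then i else Suc i)"

lemma level_delta: "level k \<in> delta n 1"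
  by (auto simp: delta_iff level_def)

lemma degen_delta: "k \<le> n \<Longrightarrow> degen k \<in> delta (Suc n) n"
  by (auto simp: delta_iff degen_def)

lemma face_delta: "face k \<in> delta n (Suc n)"
  by (auto simp: delta_iff face_def)

text \<open>Cutting inserts s as entry k + 1 of the sequence of cumulative sums and moves the later
  entries up by one.\<close>

lemma sum_cut:
  "sum (cut k s t) {..<j} =
    (if j \<le> k then sum t {..<j} else if j = Suc k then s else sum t {..<j - 1})"
proof (induction j)
  case (Suc j)
  consider "j < k" | "j = k" | "j = Suc k" | "j > Suc k"
    by linarith
  then show ?case
  proof cases
    case 4
    then obtain i where "j = Suc i" by (cases j) auto
    with 4 Suc show ?thesis
      by (simp add: cut_def)
  qed (use Suc in \<open>simp_all add: cut_def\<close>)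
qed simp

lemma cut_closed:
  assumes "t \<in> standard_simplex n" "k \<le> n" "cuts k s t"
  shows "cut k s t \<in> standard_simplex (Suc n)"
proof (rule standard_simplexI)
  show "0 \<le> cut k s t i" for i
    using assms by (auto simp: cut_def cuts_def standard_simplex_def)
  show "cut k s t i = 0" if "i > Suc n" for i
    using assms that by (auto simp: cut_def standard_simplex_def)
  show "sum (cut k s t) {..Suc n} = 1"
    using assms simplex_partial_sum_le(3)[of t n "Suc n"]
      sum_cut[of k s t "Suc (Suc n)"] by (simp add: lessThan_Suc_atMost[symmetric] del: sum.lessThan_Suc)
qed

text \<open>If s equals one of the two neighbouring cumulative sums, one new coordinate vanishes and
  the point lies on the face opposite to vertex j. Such faces are the walls between consecutive
  pieces and the two ends of the prism.\<close>

lemma cut_eq_push_face: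
  assumes t: "t \<in> standard_simplex n" and k: "k \<le> n" and j: "j = k \<or> j = Suc k" and s: "sum t {..<j} = s"
  shows "cut k s t = push_simplex n (face j) t"
proof (rule fun_eq_partial_sums)
  fix l
  have *: "sum t {i. i \<le> n \<and> i < m} = sum t {..<m}" for m
    using t by (intro sum.mono_neutral_left) (auto simp: standard_simplex_def not_le[symmetric])
  have "{i. i \<le> n \<and> face j i < l} = {i. i \<le> n \<and> i < (if l \<le> j then l else l - 1)}"
    by (auto simp: face_def split: if_splits)
  then have "sum (push_simplex n (face j) t) {..<l} = sum t {..<if l \<le> j then l else l - 1}"
    by (simp only: sum_push_simplex *)
  also have "\<dots> = (if l \<le> k then sum t {..<l} else if l = Suc k then sum t {..<j} else sum t {..<l - 1})"
    using j by (cases "l = Suc k") (auto simp del: sum.lessThan_Suc)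
  finally show "sum (cut k s t) {..<l} = sum (push_simplex n (face j) t) {..<l}"
    by (simp only: sum_cut s)
qed

text \<open>The product of \<theta> with the identity of the interval takes the k-th prism simplex
  into the one with number \<theta> k; this is its effect on vertex numbers. A vertex at level 1 has
  a number one larger than its position, hence both shifts.\<close>

definition prism_op :: "nat \<Rightarrow> (nat \<Rightarrow> nat) \<Rightarrow> nat \<Rightarrow> nat" where
  "prism_op k \<theta> i = (if i \<le> k then \<theta> i else Suc (\<theta> (i - 1)))"

lemma prism_op_delta:
  assumes "\<theta> \<in> delta m n" "k \<le> m"
  shows "prism_op k \<theta> \<in> delta (Suc m) (Suc n)"
proof -
  have "\<theta> i \<le> \<theta> j" if "i \<le> j" "j \<le> m" for i j
    using assms that by (auto simp: delta_iff)
  moreover have "\<theta> i \<le> n" if "i \<le> m" for i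
    using assms that by (auto simp: delta_iff)
  ultimately show ?thesis
    using assms(2) unfolding delta_iff prism_op_def
    by (fastforce intro: le_SucI)
qed

text \<open>Cutting is compatible with the affine map induced by \<theta>. The three cases compare
  cumulative sums before, at and after the inserted value.\<close>

lemma cut_push_simplex:
  assumes \<theta>: "\<theta> \<in> delta m n" and k: "k \<le> m"
  shows "cut (\<theta> k) s (push_simplex m \<theta> t) = push_simplex (Suc m) (prism_op k \<theta>) (cut k s t)"
proof (rule fun_eq_partial_sums)
  fix j
  have mono: "\<theta> i \<le> \<theta> l" if "i \<le> l" "l \<le> m" for i l
    using \<theta> that by (auto simp: delta_iff)
  consider "j \<le> \<theta> k" | "j = Suc (\<theta> k)" | "j > Suc (\<theta> k)" by linarith
  then show "sum (cut (\<theta> k) s (push_simplex m \<theta> t)) {..<j}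
      = sum (push_simplex (Suc m) (prism_op k \<theta>) (cut k s t)) {..<j}"
  proof cases
    case 1
    have "{i. i \<le> Suc m \<and> prism_op k \<theta> i < j} = {i. i \<le> m \<and> \<theta> i < j}"
    proof (intro Collect_cong)
      fix i
      have "i < k" if "i \<le> m" "\<theta> i < j"
        using mono[of k i] that 1 k by linarith
      moreover have "\<not> prism_op k \<theta> i < j" if "i > k" "i \<le> Suc m"
      proof -
        have "k \<le> i - 1" "i - 1 \<le> m"
          using that by auto
        then show ?thesis
          using mono[of k "i - 1"] that 1 by (auto simp: prism_op_def)
      qed
      ultimately show "i \<le> Suc m \<and> prism_op k \<theta> i < j \<longleftrightarrow> i \<le> m \<and> \<theta> i < j"
        using k by (cases "i \<le> k") (auto simp: prism_op_def)
    qed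
    moreover have "sum (cut k s t) {i. i \<le> m \<and> \<theta> i < j} = sum t {i. i \<le> m \<and> \<theta> i < j}"
    proof (rule sum.cong)
      fix i assume "i \<in> {i. i \<le> m \<and> \<theta> i < j}"
      then have "i < k"
        using mono[of k i] 1 by (cases "i < k") auto
      then show "cut k s t i = t i" by (simp add: cut_def)
    qed simp
    ultimately show ?thesis
      using 1 by (simp add: sum_cut sum_push_simplex)
  next
    case 2
    have "{i. i \<le> Suc m \<and> prism_op k \<theta> i < j} = {i. i < Suc k}"
    proof (intro Collect_cong)
      fix i
      have "\<not> prism_op k \<theta> i < j" if "i > k" "i \<le> Suc m"
      proof -
        have "k \<le> i - 1" "i - 1 \<le> m"
          using that by auto
        then show ?thesis
          using mono[of k "i - 1"] that 2 by (auto simp: prism_op_def)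
      qed
      moreover have "prism_op k \<theta> i < j" if "i \<le> k"
        using mono[of i k] that 2 k by (auto simp: prism_op_def)
      ultimately show "i \<le> Suc m \<and> prism_op k \<theta> i < j \<longleftrightarrow> i < Suc k"
        using k by (cases "i \<le> k") auto
    qed
    then show ?thesis
      using 2 by (simp add: sum_cut sum_push_simplex lessThan_def[symmetric] del: sum.lessThan_Suc)
  next
    case 3
    \<comment> \<open>The old vertices beyond k that contribute. In the prism they reappear shifted
      by one, after the vertices 0 to k + 1, all of which contribute because \<theta> k lies below j
      - 1.\<close>
    define A where "A = {i. k < i \<and> i \<le> m \<and> \<theta> i < j - 1}"
    have le: "\<theta> i < j - 1" if "i \<le> k" for i
      using mono[of i k] that k 3 by linarith
    have 1: "{i. i \<le> Suc m \<and> prism_op k \<theta> i < j} = {..<Suc (Suc k)} \<union> Suc ` A"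
    proof (intro equalityI subsetI)
      fix i assume i: "i \<in> {i. i \<le> Suc m \<and> prism_op k \<theta> i < j}"
      show "i \<in> {..<Suc (Suc k)} \<union> Suc ` A"
      proof (cases "i \<le> Suc k")
        case False
        then obtain l where "i = Suc l" "l > k" by (cases i) auto
        then show ?thesis using i by (auto simp: A_def prism_op_def)
      qed auto
    next
      fix i assume "i \<in> {..<Suc (Suc k)} \<union> Suc ` A"
      then show "i \<in> {i. i \<le> Suc m \<and> prism_op k \<theta> i < j}"
        using le[of i] le[of k] k 3 by (auto simp: A_def prism_op_def less_Suc_eq)
    qed
    have 2: "{i. i \<le> m \<and> \<theta> i < j - 1} = {..<Suc k} \<union> A"
      using le k by (auto simp: A_def)
    have "sum (cut k s t) ({..<Suc (Suc k)} \<union> Suc ` A) = sum t {..<Suc k} + sum (cut k s t) (Suc ` A)"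
      by (subst sum.union_disjoint) (auto simp: A_def sum_cut simp del: sum.lessThan_Suc)
    also have "sum (cut k s t) (Suc ` A) = sum t A"
      by (subst sum.reindex) (auto simp: A_def cut_def intro!: sum.cong)
    also have "sum t {..<Suc k} + sum t A = sum t ({..<Suc k} \<union> A)"
      by (subst sum.union_disjoint) (auto simp: A_def)
    finally show ?thesis
      using 3 unfolding sum_push_simplex 1 by (simp add: sum_cut sum_push_simplex 2[unfolded One_nat_def] del: sum.lessThan_Suc)
  qed
qed

text \<open>The interval for s can only grow: vertices sent below \<theta> k come before k, and all
  vertices up to k are sent to at most \<theta> k.\<close>

lemma cuts_push_simplex:
  assumes \<theta>: "\<theta> \<in> delta m n" and k: "k \<le> m" and t: "t \<in> standard_simplex m" and c: "cuts k s t"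
  shows "cuts (\<theta> k) s (push_simplex m \<theta> t)"
proof -
  have mono: "\<theta> i \<le> \<theta> l" if "i \<le> l" "l \<le> m" for i l
    using \<theta> that by (auto simp: delta_iff)
  have nn: "0 \<le> t i" for i
    using t by (simp add: standard_simplex_def)
  have "sum t {i. i \<le> m \<and> \<theta> i < \<theta> k} \<le> sum t {..<k}"
    using nn by (intro sum_mono2) (use mono in \<open>force simp: not_le[symmetric]\<close>)+
  moreover have "sum t {..<Suc k} \<le> sum t {i. i \<le> m \<and> \<theta> i < Suc (\<theta> k)}"
    using nn k by (intro sum_mono2) (auto simp: mono less_Suc_eq_le)
  ultimately show ?thesis
    using c by (simp add: cuts_def sum_push_simplex del: sum.lessThan_Suc)
qed

text \<open>The least k whose cumulative sum through k reaches s works: minimality gives the lower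
  bound, and k is at most n since the full sum is 1.\<close>

lemma cuts_exists:
  assumes "t \<in> standard_simplex n" "0 \<le> s" "s \<le> 1"
  shows "\<exists>k\<le>n. cuts k s t"
proof -
  define k where "k = (LEAST k. s \<le> sum t {..<Suc k})"
  have *: "s \<le> sum t {..<Suc n}"
    using simplex_partial_sum_le(3)[OF assms(1), of "Suc n"] assms by simp
  have "k \<le> n"
    unfolding k_def by (rule Least_le) (rule *)
  moreover have "s \<le> sum t {..<Suc k}"
    unfolding k_def by (rule LeastI) (rule *)
  moreover have "sum t {..<k} \<le> s"
  proof (cases k)
    case (Suc l)
    then have "\<not> s \<le> sum t {..<Suc l}"
      unfolding k_def by (intro not_less_Least) simp
    then show ?thesis using Suc by simp
  qed (use assms in simp)
  ultimately show ?thesis by (auto simp: cuts_def)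
qed

section \<open>Continuity of the cutting maps\<close>

lemma continuous_map_coordinate:
  "continuous_map (subtopology (powertop_real UNIV) S) euclideanreal (\<lambda>t. t i)"
  by (intro continuous_map_from_subtopology continuous_map_product_projection) simp

lemma continuous_map_prism:
  defines "P \<equiv> \<lambda>n. prod_topology (top_of_set {0..1}) (subtopology (powertop_real UNIV) (standard_simplex n))"
  shows "continuous_map (P n) euclideanreal (\<lambda>(s, t). t i)"
    and "continuous_map (P n) euclideanreal (\<lambda>(s, t). s)"
    and "continuous_map (P n) euclideanreal (\<lambda>(s, t). sum t {..<k})"
proof -
  show 1: "continuous_map (P n) euclideanreal (\<lambda>(s, t). t i)" for i
    using continuous_map_compose[OF continuous_map_snd continuous_map_coordinate]
    unfolding P_def by (simp add: o_def split_def)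
  show "continuous_map (P n) euclideanreal (\<lambda>(s, t). s)"
    unfolding P_def split_def
    by (rule continuous_map_into_fulltopology[OF continuous_map_fst])
  show "continuous_map (P n) euclideanreal (\<lambda>(s, t). sum t {..<k})"
    using 1 unfolding split_def by (intro continuous_map_sum) auto
qed

lemma closedin_cuts:
  "closedin (prod_topology (top_of_set {0..1}) (subtopology (powertop_real UNIV) (standard_simplex n)))
    {(s, t). s \<in> {0..1} \<and> t \<in> standard_simplex n \<and> cuts k s t}" (is "closedin ?P ?C")
proof -
  have "?C = {z \<in> topspace ?P. (\<lambda>(s, t). s - sum t {..<k}) z \<in> {0..}}
      \<inter> {z \<in> topspace ?P. (\<lambda>(s, t). sum t {..<Suc k} - s) z \<in> {0..}}"
    by (auto simp: cuts_def)
  moreover have "continuous_map ?P euclideanreal (\<lambda>(s, t). s - sum t {..<k})"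
      "continuous_map ?P euclideanreal (\<lambda>(s, t). sum t {..<Suc k} - s)"
    using continuous_map_prism(2,3) unfolding split_def by (intro continuous_map_diff; blast)+
  ultimately show ?thesis
    using closedin_continuous_map_preimage[of ?P euclideanreal _ "{0..}"] by (simp only: closedin_Int closed_closedin[symmetric] closed_atLeast)
qed

lemma continuous_map_cut:
  assumes "k \<le> n"
  shows "continuous_map
    (subtopology (prod_topology (top_of_set {0..1}) (subtopology (powertop_real UNIV) (standard_simplex n)))
      {(s, t). s \<in> {0..1} \<and> t \<in> standard_simplex n \<and> cuts k s t})
    (subtopology (powertop_real UNIV) (standard_simplex (Suc n))) (\<lambda>(s, t). cut k s t)"
    (is "continuous_map (subtopology ?P ?C) _ _")
proof -
  have "continuous_map ?P euclideanreal (\<lambda>(s, t). cut k s t i)" for i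
  proof -
    consider "i < k" | "i = k" | "i = Suc k" | "i > Suc k" by linarith
    then show ?thesis
    proof cases
      case 1 then show ?thesis using continuous_map_prism(1) by (simp add: cut_def)
    next
      case 2 then show ?thesis using continuous_map_prism(2,3) unfolding split_def
        by (simp add: cut_def continuous_map_diff)
    next
      case 3
      then have "(\<lambda>(s, t). cut k s t i) = (\<lambda>z. (case z of (s, t) \<Rightarrow> sum t {..<Suc k}) - (case z of (s, t) \<Rightarrow> s))"
        by (auto simp: cut_def fun_eq_iff)
      then show ?thesis using continuous_map_prism(2,3)[of n]
        by (simp only: continuous_map_diff)
    next
      case 4 then show ?thesis using continuous_map_prism(1) by (simp add: cut_def)
    qed
  qed
  then have "continuous_map ?P (powertop_real UNIV) (\<lambda>(s, t). cut k s t)"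
    by (simp add: continuous_map_componentwise_UNIV split_def)
  then show ?thesis
    using cut_closed assms
    by (auto simp: continuous_map_in_subtopology intro: continuous_map_from_subtopology)
qed

section \<open>Realizing a simplicial homotopy\<close>

text \<open>A simplicial map from the product of \<open>K\<close> with the standard 1-simplex to
  \<open>L\<close>, where \<open>delta n 1\<close> represents the n-simplices of the latter. The map
  \<upsilon> stands for the composite of \<tau> with \<theta>, prescribed only on actual
  vertices.\<close>

locale simplicial_homotopy = dom: simplicial_set K + cod: simplicial_set L
  for K :: "'s sset" and L :: "'t sset" +
  fixes h :: "nat \<Rightarrow> (nat \<Rightarrow> nat) \<Rightarrow> 's \<Rightarrow> 't"
  assumes homotopy_closed: "\<lbrakk>\<tau> \<in> delta n 1; x \<in> Spx K n\<rbrakk> \<Longrightarrow> h n \<tau> x \<in> Spx L n"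
    and homotopy_natural:
      "\<lbrakk>\<theta> \<in> delta m n; \<tau> \<in> delta n 1; x \<in> Spx K n; \<And>i. i \<le> m \<Longrightarrow> \<upsilon> i = \<tau> (\<theta> i)\<rbrakk>
        \<Longrightarrow> h m \<upsilon> (Op K m n \<theta> x) = Op L m n \<theta> (h n \<tau> x)"
begin

text \<open>The k-th simplex of the prism over x consists of the degenerate simplex given by
  \<open>degen k\<close> together with the level map; \<open>h\<close> is evaluated on this
  pair.\<close>

definition piece :: "nat \<Rightarrow> 's \<Rightarrow> nat \<Rightarrow> real \<times> (nat \<Rightarrow> real) \<Rightarrow> ((nat \<times> 't) \<times> (nat \<Rightarrow> real)) set" where
  "piece n x k = (\<lambda>(s, t).
    point L ((Suc n, h (Suc n) (level (Suc k)) (Op K (Suc n) n (degen k) x)), cut k s t))"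

text \<open>Values of \<tau> beyond n are arbitrary. Naturality along the identity allows \<tau> to
  be exchanged for any map with the same values on the vertices.\<close>

lemma homotopy_cong:
  assumes "\<tau> \<in> delta n 1" "x \<in> Spx K n" "\<And>i. i \<le> n \<Longrightarrow> \<tau> i = \<upsilon> i"
  shows "h n \<tau> x = h n \<upsilon> x"
proof -
  have id: "id \<in> delta n n"
    by (simp add: delta_iff)
  have "h n \<upsilon> (Op K n n id x) = Op L n n id (h n \<tau> x)"
    using id assms by (intro homotopy_natural) auto
  then show ?thesis
    using assms homotopy_closed by (simp add: dom.op_ident cod.op_ident)
qed

text \<open>On a wall the j-th face of the degenerate simplex is x again, and the level map
  restricts to \<open>level j\<close>. The value depends on j but not on k, so consecutive pieces
  match.\<close>

lemma piece_face:
  assumes x: "x \<in> Spx K n" and t: "t \<in> standard_simplex n" and k: "k \<le> n"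
    and j: "j = k \<or> j = Suc k" and s: "sum t {..<j} = s"
  shows "piece n x k (s, t) = point L ((n, h n (level j) x), t)"
proof -
  let ?y = "Op K (Suc n) n (degen k) x"
  have y: "?y \<in> Spx K (Suc n)"
    using x degen_delta[OF k] by (rule dom.op_closed[rotated])
  have "Op L n (Suc n) (face j) (h (Suc n) (level (Suc k)) ?y) = h n (level j) (Op K n (Suc n) (face j) ?y)"
    using j by (intro homotopy_natural[symmetric] face_delta level_delta y) (auto simp: level_def face_def)
  also have "Op K n (Suc n) (face j) ?y = Op K n n (degen k \<circ> face j) x"
    by (rule dom.op_comp[OF degen_delta[OF k] face_delta x]) simp
  also have "\<dots> = x"
    using j by (intro dom.op_ident x) (auto simp: degen_def face_def)
  finally have "Op L n (Suc n) (face j) (h (Suc n) (level (Suc k)) ?y) = h n (level j) x" .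
  then show ?thesis
    using point_glue[OF face_delta homotopy_closed[OF level_delta y] t, of j "Suc k"]
      cut_eq_push_face[OF t k j s]
    by (simp add: piece_def)
qed

text \<open>A point in pieces k and l has all cumulative sums from k + 1 to l equal to s. It
  therefore lies on every wall in between, and the walls are crossed one after the other.\<close>

lemma piece_agree:
  assumes x: "x \<in> Spx K n" and t: "t \<in> standard_simplex n"
    and kl: "k \<le> l" "l \<le> n" and ck: "cuts k s t" and cl: "cuts l s t"
  shows "piece n x k (s, t) = piece n x l (s, t)"
proof (cases "k = l")
  case False
  have nn: "0 \<le> t i" for i
    using t by (simp add: standard_simplex_def)
  have s: "sum t {..<j} = s" if "k < j" "j \<le> l" for j
  proof -
    have "sum t {..<Suc k} \<le> sum t {..<j}" "sum t {..<j} \<le> sum t {..<l}"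
      using nn that by (intro sum_mono2; auto)+
    then show ?thesis
      using ck cl by (simp add: cuts_def)
  qed
  have step: "piece n x j (s, t) = piece n x (Suc j) (s, t)" if "k \<le> j" "j < l" for j
    using piece_face[OF x t, of j "Suc j" s] piece_face[OF x t, of "Suc j" "Suc j" s] s[of "Suc j"] that kl
    by simp
  have "piece n x k (s, t) = piece n x j (s, t)" if "k \<le> j" "j \<le> l" for j
    using that by (induction rule: dec_induct) (use step in auto)
  then show ?thesis
    using kl by simp
qed simp

definition prism :: "real \<times> (nat \<times> 's) \<times> (nat \<Rightarrow> real) \<Rightarrow> ((nat \<times> 't) \<times> (nat \<Rightarrow> real)) set" where
  "prism = (\<lambda>(s, ((n, x), t)). piece n x (SOME k. k \<le> n \<and> cuts k s t) (s, t))"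

lemma prism_eq:
  assumes x: "x \<in> Spx K n" and t: "t \<in> standard_simplex n" and k: "k \<le> n" "cuts k s t"
  shows "prism (s, ((n, x), t)) = piece n x k (s, t)"
proof -
  define l where "l = (SOME k. k \<le> n \<and> cuts k s t)"
  have l: "l \<le> n \<and> cuts l s t"
    unfolding l_def by (rule someI[of _ k]) (use k in simp)
  have "piece n x l (s, t) = piece n x k (s, t)"
  proof (cases "k \<le> l")
    case True
    show ?thesis
      by (rule piece_agree[OF x t True, symmetric]) (use k l in simp_all)
  next
    case False
    then show ?thesis
      by (intro piece_agree[OF x t]) (use k l in simp_all)
  qed
  then show ?thesis by (simp add: prism_def l_def)
qed

text \<open>Piece k over the simplex pulled back along \<theta> is matched with piece \<theta> k
  over x. The composite of \<theta> with \<open>degen k\<close> equals that of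
  \<open>degen (\<theta> k)\<close> with \<open>prism_op k \<theta>\<close>, so the two points are
  glued along \<open>prism_op k \<theta>\<close>.\<close>

lemma prism_glue:
  assumes "glue K u v" "s \<in> {0..1}"
  shows "prism (s, u) = prism (s, v)"
proof -
  from assms(1) obtain m n \<theta> x t where \<theta>: "\<theta> \<in> delta m n" and x: "x \<in> Spx K n"
    and t: "t \<in> standard_simplex m"
    and uv: "u = ((m, Op K m n \<theta> x), t)" "v = ((n, x), push_simplex m \<theta> t)"
    unfolding glue_def by blast
  obtain k where k: "k \<le> m" "cuts k s t"
    using cuts_exists[OF t, of s] assms(2) by auto
  let ?y = "Op K (Suc n) n (degen (\<theta> k)) x"
  have \<theta>k: "\<theta> k \<le> n"
    using \<theta> k by (auto simp: delta_iff)
  have mono: "\<theta> i \<le> \<theta> l" if "i \<le> l" "l \<le> m" for i l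
    using \<theta> that by (auto simp: delta_iff)
  have p: "prism_op k \<theta> \<in> delta (Suc m) (Suc n)"
    by (rule prism_op_delta[OF \<theta> k(1)])
  have y: "?y \<in> Spx K (Suc n)"
    using x degen_delta[OF \<theta>k] by (rule dom.op_closed[rotated])
  have "Op K (Suc m) m (degen k) (Op K m n \<theta> x) = Op K (Suc m) n (\<theta> \<circ> degen k) x"
    by (rule dom.op_comp[OF \<theta> degen_delta[OF k(1)] x]) simp
  also have "\<dots> = Op K (Suc m) (Suc n) (prism_op k \<theta>) ?y"
  proof (rule dom.op_comp[OF degen_delta[OF \<theta>k] p x, symmetric])
    fix i assume i: "i \<le> Suc m"
    have "k < i \<Longrightarrow> k \<le> i - 1" "i - 1 \<le> m"
      using i by auto
    then show "(\<theta> \<circ> degen k) i = degen (\<theta> k) (prism_op k \<theta> i)"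
      using i mono[of i k] mono[of k "i - 1"] k by (auto simp: degen_def prism_op_def)
  qed
  finally have 1: "Op K (Suc m) m (degen k) (Op K m n \<theta> x) = Op K (Suc m) (Suc n) (prism_op k \<theta>) ?y" .
  have "h (Suc m) (level (Suc k)) (Op K (Suc m) (Suc n) (prism_op k \<theta>) ?y)
      = Op L (Suc m) (Suc n) (prism_op k \<theta>) (h (Suc n) (level (Suc (\<theta> k))) ?y)"
  proof (rule homotopy_natural[OF p level_delta y])
    fix i assume i: "i \<le> Suc m"
    have "k < i \<Longrightarrow> k \<le> i - 1" "i - 1 \<le> m"
      using i by auto
    then show "level (Suc k) i = level (Suc (\<theta> k)) (prism_op k \<theta> i)"
      using i mono[of i k] mono[of k "i - 1"] k by (auto simp: level_def prism_op_def)
  qed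
  then have "piece m (Op K m n \<theta> x) k (s, t) = piece n x (\<theta> k) (s, push_simplex m \<theta> t)"
    unfolding piece_def
    using point_glue[OF p homotopy_closed[OF level_delta y] cut_closed[OF t k], of "Suc (\<theta> k)"]
    by (simp add: 1 cut_push_simplex[OF \<theta> k(1)])
  then show ?thesis
    unfolding uv
    using prism_eq[OF dom.op_closed[OF \<theta> x] t k]
      prism_eq[OF x push_simplex_closed[OF \<theta> t] \<theta>k cuts_push_simplex[OF \<theta> k(1) t k(2)]]
    by simp
qed

text \<open>Over an n-dimensional cell the prism is a union of n + 1 closed pieces, so pasting over
  a finite closed cover applies. Overlaps agree because each piece equals \<open>prism\<close> on
  its domain.\<close>

lemma continuous_map_prism_cells:
  "continuous_map (prod_topology (top_of_set {0..1}) (cells K)) (realization L) prism"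
  unfolding cells_def
proof (rule continuous_map_prod_sum_topology, clarsimp split: prod.splits)
  fix n x assume x: "x \<in> Spx K n"
  let ?P = "prod_topology (top_of_set {0..1::real}) (subtopology (powertop_real UNIV) (standard_simplex n))"
  let ?C = "\<lambda>k. {(s::real, t). s \<in> {0..1} \<and> t \<in> standard_simplex n \<and> cuts k s t}"
  show "continuous_map ?P (realization L) (\<lambda>(s, t). prism (s, (n, x), t))"
  proof (rule pasting_lemma_closed[where I = "{..n}" and T = ?C and f = "piece n x"])
    fix k assume "k \<in> {..n}"
    then have k: "k \<le> n" by simp
    show "closedin ?P (?C k)"
      by (rule closedin_cuts)
    let ?z = "h (Suc n) (level (Suc k)) (Op K (Suc n) n (degen k) x)"
    have "?z \<in> Spx L (Suc n)"
      by (intro homotopy_closed level_delta dom.op_closed[OF degen_delta[OF k]] x)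
    then have "(Suc n, ?z) \<in> (SIGMA n:UNIV. Spx L n)" by simp
    from continuous_map_component_injection[OF this,
        of "\<lambda>(n, x). subtopology (powertop_real UNIV) (standard_simplex n)"]
    have "continuous_map (subtopology (powertop_real UNIV) (standard_simplex (Suc n))) (cells L)
        (Pair (Suc n, ?z))"
      by (simp add: cells_def)
    then have "continuous_map (subtopology (powertop_real UNIV) (standard_simplex (Suc n))) (realization L)
        (point L \<circ> Pair (Suc n, ?z))"
      unfolding realization_def
      by (rule continuous_map_compose[OF _ quotient_imp_continuous_map[OF quotient_map_image_topology]])
    from continuous_map_compose[OF continuous_map_cut[OF k] this]
    show "continuous_map (subtopology ?P (?C k)) (realization L) (piece n x k)"
      by (simp add: piece_def o_def split_def)
  next
    fix k l z assume "k \<in> {..n}" "l \<in> {..n}" "z \<in> topspace ?P \<inter> ?C k \<inter> ?C l"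
    then obtain s t where z: "z = (s, t)" "t \<in> standard_simplex n" "cuts k s t" "cuts l s t"
        "k \<le> n" "l \<le> n"
      by auto
    show "piece n x k z = piece n x l z"
      using prism_eq[OF x z(2,5,3)] prism_eq[OF x z(2,6,4)] unfolding z(1) by (rule trans[OF sym])
  next
    fix z assume "z \<in> topspace ?P"
    then obtain s t where "z = (s, t)" "s \<in> {0..1}" "t \<in> standard_simplex n" by auto
    moreover then obtain k where "k \<le> n" "cuts k s t"
      using cuts_exists[of t n s] by auto
    ultimately show "\<exists>j. j \<in> {..n} \<and> z \<in> ?C j \<and> (case z of (s, t) \<Rightarrow> prism (s, (n, x), t)) = piece n x j z"
      using prism_eq[OF x] by auto
  qed simp
qed

text \<open>Since the unit interval is locally compact, its product with a quotient map is a quotient map.\<close>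

theorem homotopic_realization_maps:
  assumes "simplicial_map K L f" "simplicial_map K L g"
    and f: "\<And>n x. x \<in> Spx K n \<Longrightarrow> h n (\<lambda>_. 0) x = f n x"
    and g: "\<And>n x. x \<in> Spx K n \<Longrightarrow> h n (\<lambda>_. 1) x = g n x"
  shows "homotopic_with (\<lambda>_. True) (realization K) (realization L)
    (realization_map L g) (realization_map L f)"
proof -
  interpret f: simplicial_map K L f by fact
  interpret g: simplicial_map K L g by fact
  let ?I = "top_of_set {0..1::real}"
  have q: "quotient_map (prod_topology ?I (cells K)) (prod_topology ?I (realization K)) (\<lambda>(s, u). (s, point K u))"
  proof (rule quotient_map_prod_right)
    have "compact_space ?I"
      by (simp add: compact_space_subtopology)
    then show "locally_compact_space ?I"
      by (rule compact_imp_locally_compact_space)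
    show "Hausdorff_space ?I \<or> regular_space ?I"
      by (simp add: Hausdorff_space_subtopology)
    show "quotient_map (cells K) (realization K) (point K)"
      unfolding realization_def by (rule quotient_map_image_topology)
  qed
  have *: "prism (s, u) = prism (s, v)" if "s \<in> {0..1}" "point K u = point K v" for s u v
  proof -
    have "equivclp (glue K) u v"
      using that(2) by (simp add: point_eq_iff)
    then show ?thesis
    proof (induction rule: equivclp_induct)
      case (step y z)
      then show ?case
        using prism_glue[of y z, OF _ that(1)] prism_glue[of z y, OF _ that(1)] by metis
    qed simp
  qed
  have prism_cong: "prism w = prism z" if "w \<in> topspace (prod_topology ?I (cells K))"
    "(\<lambda>(s, u). (s, point K u)) w = (\<lambda>(s, u). (s, point K u)) z" for w z
    using that *[of "fst w" "snd w" "snd z"] by (cases w; cases z) (simp add: topspace_prod_topology)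
  obtain H where H: "continuous_map (prod_topology ?I (realization K)) (realization L) H"
    and Hprism: "\<And>z. z \<in> topspace (prod_topology ?I (cells K)) \<Longrightarrow> H ((\<lambda>(s, u). (s, point K u)) z) = prism z"
    by (rule quotient_map_lift_exists[OF q continuous_map_prism_cells])
      ((rule prism_cong; assumption), (rule that; assumption))
  have H': "H (s, point K ((n, x), t)) = prism (s, (n, x), t)"
    if "x \<in> Spx K n" "t \<in> standard_simplex n" "s \<in> {0..1}" for s n x t
    using Hprism[of "(s, ((n, x), t))"] that by (simp add: topspace_cells)
  \<comment> \<open>Since s is the mass at level 0, s = 0 puts everything at level 1 and gives
    \<open>g\<close>, seen in piece 0, while s = 1 gives \<open>f\<close>, seen in piece n. Both
    ends are faces of prism simplices.\<close>
  have "H (0, y) = realization_map L g y \<and> H (1, y) = realization_map L f y" if y: "y \<in> topspace (realization K)" for y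
  proof -
    from y obtain n x t where x: "x \<in> Spx K n" and t: "t \<in> standard_simplex n" and yy: "y = point K ((n, x), t)"
      by (auto simp: topspace_realization topspace_cells)
    have "cuts 0 0 t"
      using t by (simp add: cuts_def standard_simplex_def)
    moreover have "cuts n 1 t"
      using simplex_partial_sum_le[OF t] by (simp add: cuts_def del: sum.lessThan_Suc)
    moreover have "h n (level 0) x = g n x"
      using homotopy_cong[OF level_delta x, of 0 "\<lambda>_. 1"] g[OF x] by (simp add: level_def)
    moreover have "h n (level (Suc n)) x = f n x"
      using homotopy_cong[OF level_delta x, of "Suc n" "\<lambda>_. 0"] f[OF x] by (simp add: level_def)
    ultimately show ?thesis
      using prism_eq[OF x t, of 0 0] prism_eq[OF x t, of n 1] piece_face[OF x t, of 0 0 0]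
        piece_face[OF x t, of n "Suc n" 1] simplex_partial_sum_le(3)[OF t, of "Suc n"]
      by (simp add: yy H' x t f.realization_map_point g.realization_map_point del: sum.lessThan_Suc)
  qed
  with H show ?thesis
    by (subst homotopic_with) auto
qed

end


section \<open>Groupoids, crossed modules and gauge transformations\<close>

context groupoid
begin

lemma Inv_unique:
  assumes "a \<in> Obj P" "b \<in> Obj P" "p \<in> Arr P a b" "q \<in> Arr P b a" "r \<in> Arr P b a"
    and "Comp P a b a q p = Ident P a" "Comp P b a b p r = Ident P b"
  shows "q = r"
  using assms comp_assoc[of b a b a r p q] ident_left[of b a r] ident_right[of b a q] by simp

lemma Inv_eqI:
  assumes "a \<in> Obj P" "b \<in> Obj P" "p \<in> Arr P a b" "q \<in> Arr P b a"
    and "Comp P a b a q p = Ident P a" "Comp P b a b p q = Ident P b"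
  shows "Inv P a b p = q"
  unfolding Inv_def by (rule the_equality) (use assms Inv_unique in blast)+

lemma Inv_props:
  assumes "a \<in> Obj P" "b \<in> Obj P" "p \<in> Arr P a b"
  shows Inv_closed: "Inv P a b p \<in> Arr P b a"
    and Inv_left: "Comp P a b a (Inv P a b p) p = Ident P a"
    and Inv_right: "Comp P b a b p (Inv P a b p) = Ident P b"
proof -
  obtain q where "q \<in> Arr P b a" "Comp P a b a q p = Ident P a" "Comp P b a b p q = Ident P b"
    using inverse_exists[OF assms] by blast
  then show "Inv P a b p \<in> Arr P b a" "Comp P a b a (Inv P a b p) p = Ident P a"
      "Comp P b a b p (Inv P a b p) = Ident P b"
    using Inv_eqI[OF assms] by auto
qed

lemma Inv_left_assoc:
  "\<lbrakk>a \<in> Obj P; b \<in> Obj P; c \<in> Obj P; p \<in> Arr P a b; r \<in> Arr P c a\<rbrakk>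
    \<Longrightarrow> Comp P c b a (Inv P a b p) (Comp P c a b p r) = r"
  using comp_assoc[of c a b a r p "Inv P a b p"] by (simp add: Inv_props ident_left)

lemma Inv_right_assoc:
  "\<lbrakk>a \<in> Obj P; b \<in> Obj P; c \<in> Obj P; p \<in> Arr P a b; r \<in> Arr P c b\<rbrakk>
    \<Longrightarrow> Comp P c a b p (Comp P c b a (Inv P a b p) r) = r"
  using comp_assoc[of c b a b r "Inv P a b p" p] by (simp add: Inv_props ident_left)

lemma Inv_ident: "a \<in> Obj P \<Longrightarrow> Inv P a a (Ident P a) = Ident P a"
  by (rule Inv_eqI) (simp_all add: ident_closed ident_left)

lemma Inv_Inv: "\<lbrakk>a \<in> Obj P; b \<in> Obj P; p \<in> Arr P a b\<rbrakk> \<Longrightarrow> Inv P b a (Inv P a b p) = p"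
  by (rule Inv_eqI) (simp_all add: Inv_props)

lemma Inv_comp:
  "\<lbrakk>a \<in> Obj P; b \<in> Obj P; c \<in> Obj P; p \<in> Arr P a b; q \<in> Arr P b c\<rbrakk>
    \<Longrightarrow> Inv P a c (Comp P a b c q p) = Comp P c b a (Inv P a b p) (Inv P b c q)"
  by (rule Inv_eqI)
    (simp_all add: comp_closed Inv_props comp_assoc[symmetric] Inv_left_assoc Inv_right_assoc)

text \<open>Composites are bracketed to the right, and the two \<open>_assoc\<close> rules cancel an
  arrow against its inverse inside such a composite. Equations between words in arrows and inverses
  are thus settled by rewriting.\<close>

lemmas gpd_simps = comp_closed ident_closed ident_left ident_right comp_assoc[symmetric]
  Inv_props Inv_left_assoc Inv_right_assoc Inv_ident Inv_Inv Inv_comp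

text \<open>Replaces a conjugation by an equation of two composites, so that naturality of a
  boundary can be checked without inverting an arrow.\<close>

lemma Conj_eqI:
  assumes "a \<in> Obj P" "b \<in> Obj P" "p \<in> Arr P a b" "q \<in> Arr P a a" "r \<in> Arr P b b"
    and "Comp P a b b r p = Comp P a a b p q"
  shows "r = Conj P a b p q"
proof -
  have "Conj P a b p q = Comp P b a b (Comp P a a b p q) (Inv P a b p)"
    using assms(1-5) by (simp add: Conj_def gpd_simps)
  also have "\<dots> = r"
    unfolding assms(6)[symmetric] using assms(1-5) by (simp add: gpd_simps)
  finally show ?thesis ..
qed

end

context group
begin

lemma inv_mult_cancel [simp]:
  "\<lbrakk>x \<in> carrier G; y \<in> carrier G\<rbrakk> \<Longrightarrow> inv x \<otimes> (x \<otimes> y) = y"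
  "\<lbrakk>x \<in> carrier G; y \<in> carrier G\<rbrakk> \<Longrightarrow> x \<otimes> (inv x \<otimes> y) = y"
  by (simp_all add: m_assoc[symmetric])

text \<open>The group identity behind \<open>gauge_assoc\<close>. Here \<open>ag\<close>,
  \<open>u\<close>, \<open>v\<close> are \<open>g123\<close>, \<open>d12\<close>, \<open>d13\<close>
  carried to the first vertex along the inverse of \<open>p01\<close>, and \<open>w\<close> is
  \<open>d23\<close> carried along the inverse of \<open>p02\<close>. Solving the hypothesis for
  \<open>ag\<close> leaves an identity valid in any group.\<close>

lemma gauge_cocycle:
  assumes "g012 \<in> carrier G" "g023 \<in> carrier G" "g013 \<in> carrier G" "ag \<in> carrier G"
    "d01 \<in> carrier G" "d02 \<in> carrier G" "d03 \<in> carrier G" "u \<in> carrier G" "v \<in> carrier G" "w \<in> carrier G"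
    and "inv g012 \<otimes> inv g023 \<otimes> g013 \<otimes> ag = \<one>"
  shows "inv (inv d02 \<otimes> g012 \<otimes> u \<otimes> d01) \<otimes> inv (inv d03 \<otimes> g023 \<otimes> w \<otimes> d02)
    \<otimes> (inv d03 \<otimes> g013 \<otimes> v \<otimes> d01)
    \<otimes> (inv d01 \<otimes> (inv v \<otimes> ag \<otimes> (inv g012 \<otimes> w \<otimes> g012) \<otimes> u) \<otimes> d01) = \<one>"
proof -
  have "inv ag = inv g012 \<otimes> inv g023 \<otimes> g013"
    using assms by (intro inv_equality) simp_all
  then have "inv (inv ag) = inv (inv g012 \<otimes> inv g023 \<otimes> g013)"
    by (rule arg_cong)
  then have "ag = inv g013 \<otimes> (g023 \<otimes> g012)"
    using assms by (simp add: inv_mult_group m_assoc)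
  then show ?thesis
    using assms(1-10) by (simp add: inv_mult_group m_assoc)
qed

end

section \<open>Calculus in a crossed module\<close>

context crossed_module
begin

lemma act_closed:
  "\<lbrakk>a \<in> Obj X; b \<in> Obj X; p \<in> Arr X a b; g \<in> carrier (Grp X a)\<rbrakk> \<Longrightarrow> Act X a b p g \<in> carrier (Grp X b)"
  by (rule hom_in_carrier[OF act_hom])

lemma act_mult:
  "\<lbrakk>a \<in> Obj X; b \<in> Obj X; p \<in> Arr X a b; g \<in> carrier (Grp X a); h \<in> carrier (Grp X a)\<rbrakk>
    \<Longrightarrow> Act X a b p (g \<otimes>\<^bsub>Grp X a\<^esub> h) = Act X a b p g \<otimes>\<^bsub>Grp X b\<^esub> Act X a b p h"
  by (rule hom_mult[OF act_hom])

lemma group_hom_act: "\<lbrakk>a \<in> Obj X; b \<in> Obj X; p \<in> Arr X a b\<rbrakk> \<Longrightarrow> group_hom (Grp X a) (Grp X b) (Act X a b p)"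
  by (simp add: group_hom_def group_hom_axioms_def group_Grp act_hom)

lemma act_one: "\<lbrakk>a \<in> Obj X; b \<in> Obj X; p \<in> Arr X a b\<rbrakk> \<Longrightarrow> Act X a b p \<one>\<^bsub>Grp X a\<^esub> = \<one>\<^bsub>Grp X b\<^esub>"
  using group_hom.hom_one[OF group_hom_act] .

lemma act_inv:
  "\<lbrakk>a \<in> Obj X; b \<in> Obj X; p \<in> Arr X a b; g \<in> carrier (Grp X a)\<rbrakk>
    \<Longrightarrow> Act X a b p (inv\<^bsub>Grp X a\<^esub> g) = inv\<^bsub>Grp X b\<^esub> Act X a b p g"
  using group_hom.hom_inv[OF group_hom_act] .

lemma group_Aut: "a \<in> Obj X \<Longrightarrow> group (Aut X a)"
  by (rule groupI)
    (auto simp: Aut_def gpd_simps intro: Inv_left Inv_closed)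

lemma group_hom_bdry: "a \<in> Obj X \<Longrightarrow> group_hom (Grp X a) (Aut X a) (Bdry X a)"
  by (simp add: group_hom_def group_hom_axioms_def group_Grp group_Aut bdry_hom)

lemma bdry_closed: "\<lbrakk>a \<in> Obj X; g \<in> carrier (Grp X a)\<rbrakk> \<Longrightarrow> Bdry X a g \<in> Arr X a a"
  using group_hom.hom_closed[OF group_hom_bdry] by (fastforce simp: Aut_def)

lemma bdry_mult:
  "\<lbrakk>a \<in> Obj X; g \<in> carrier (Grp X a); h \<in> carrier (Grp X a)\<rbrakk>
    \<Longrightarrow> Bdry X a (g \<otimes>\<^bsub>Grp X a\<^esub> h) = Comp X a a a (Bdry X a g) (Bdry X a h)"
  using group_hom.hom_mult[OF group_hom_bdry] by (fastforce simp: Aut_def)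

lemma bdry_one: "a \<in> Obj X \<Longrightarrow> Bdry X a \<one>\<^bsub>Grp X a\<^esub> = Ident X a"
  using group_hom.hom_one[OF group_hom_bdry] by (fastforce simp: Aut_def)

lemma bdry_inv:
  assumes "a \<in> Obj X" "g \<in> carrier (Grp X a)"
  shows "Bdry X a (inv\<^bsub>Grp X a\<^esub> g) = Inv X a a (Bdry X a g)"
proof -
  interpret group "Grp X a" using assms(1) by (rule group_Grp)
  show ?thesis
    by (rule Inv_eqI[symmetric])
      (use assms in \<open>simp_all add: bdry_closed bdry_mult[symmetric] bdry_one\<close>)
qed

lemma bdry_act:
  "\<lbrakk>a \<in> Obj X; b \<in> Obj X; p \<in> Arr X a b; g \<in> carrier (Grp X a)\<rbrakk>
      \<Longrightarrow> Bdry X b (Act X a b p g) = Comp X b a b p (Comp X b a a (Bdry X a g) (Inv X a b p))"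
  by (simp add: bdry_natural Conj_def)

lemma act_inv_cancel:
  "\<lbrakk>a \<in> Obj X; b \<in> Obj X; p \<in> Arr X a b; g \<in> carrier (Grp X a)\<rbrakk>
    \<Longrightarrow> Act X b a (Inv X a b p) (Act X a b p g) = g"
  "\<lbrakk>a \<in> Obj X; b \<in> Obj X; p \<in> Arr X a b; h \<in> carrier (Grp X b)\<rbrakk>
    \<Longrightarrow> Act X a b p (Act X b a (Inv X a b p) h) = h"
  by (simp_all add: act_comp[symmetric] act_ident gpd_simps)

lemma grp_mult_closed:
  "\<lbrakk>a \<in> Obj X; g \<in> carrier (Grp X a); h \<in> carrier (Grp X a)\<rbrakk> \<Longrightarrow> g \<otimes>\<^bsub>Grp X a\<^esub> h \<in> carrier (Grp X a)"
  by (meson group_Grp group.is_monoid monoid.m_closed)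

lemma grp_inv_closed: "\<lbrakk>a \<in> Obj X; g \<in> carrier (Grp X a)\<rbrakk> \<Longrightarrow> inv\<^bsub>Grp X a\<^esub> g \<in> carrier (Grp X a)"
  by (meson group_Grp group.inv_closed)

lemma grp_one_closed: "a \<in> Obj X \<Longrightarrow> \<one>\<^bsub>Grp X a\<^esub> \<in> carrier (Grp X a)"
  by (meson group_Grp group.is_monoid monoid.one_closed)

lemmas xmod_simps = gpd_simps act_closed act_mult act_one act_inv act_ident bdry_closed bdry_mult bdry_one
  bdry_inv bdry_act grp_mult_closed grp_inv_closed grp_one_closed

text \<open>
  A gauge transformation replaces the arrow \<open>p\<^sub>i\<^sub>j\<close> of a system by
  \<open>c\<^sub>j \<circ> p\<^sub>i\<^sub>j \<circ> \<partial>d\<^sub>i\<^sub>j \<circ> c\<^sub>i\<^sup>-\<^sup>1\<close>. The formula for \<open>gauge_grp\<close> is forced by the boundary condition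
  up to elements with trivial boundary.
\<close>

definition gauge_arr :: "'o \<Rightarrow> 'o \<Rightarrow> 'o \<Rightarrow> 'o \<Rightarrow> 'm \<Rightarrow> 'm \<Rightarrow> 'm \<Rightarrow> 'g \<Rightarrow> 'm" where
  "gauge_arr a0 a1 b0 b1 c0 c1 p d =
    Comp X b0 a1 b1 c1 (Comp X b0 a0 a1 (Comp X a0 a0 a1 p (Bdry X a0 d)) (Inv X a0 b0 c0))"

definition gauge_grp :: "'o \<Rightarrow> 'o \<Rightarrow> 'o \<Rightarrow> 'm \<Rightarrow> 'm \<Rightarrow> 'g \<Rightarrow> 'g \<Rightarrow> 'g \<Rightarrow> 'g \<Rightarrow> 'g" where
  "gauge_grp a0 a1 b0 c0 p01 g d01 d12 d02 = Act X a0 b0 c0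
    (inv\<^bsub>Grp X a0\<^esub> d02 \<otimes>\<^bsub>Grp X a0\<^esub> g \<otimes>\<^bsub>Grp X a0\<^esub> Act X a1 a0 (Inv X a0 a1 p01) d12 \<otimes>\<^bsub>Grp X a0\<^esub> d01)"

lemma gauge_arr_closed:
  "\<lbrakk>a0 \<in> Obj X; a1 \<in> Obj X; b0 \<in> Obj X; b1 \<in> Obj X; c0 \<in> Arr X a0 b0; c1 \<in> Arr X a1 b1;
    p \<in> Arr X a0 a1; d \<in> carrier (Grp X a0)\<rbrakk> \<Longrightarrow> gauge_arr a0 a1 b0 b1 c0 c1 p d \<in> Arr X b0 b1"
  by (simp add: gauge_arr_def xmod_simps)

lemma gauge_grp_closed:
  "\<lbrakk>a0 \<in> Obj X; a1 \<in> Obj X; b0 \<in> Obj X; c0 \<in> Arr X a0 b0;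
    p01 \<in> Arr X a0 a1; g \<in> carrier (Grp X a0); d01 \<in> carrier (Grp X a0); d12 \<in> carrier (Grp X a1);
    d02 \<in> carrier (Grp X a0)\<rbrakk> \<Longrightarrow> gauge_grp a0 a1 b0 c0 p01 g d01 d12 d02 \<in> carrier (Grp X b0)"
  by (simp add: gauge_grp_def xmod_simps)

lemma gauge_bdry:
  assumes "a0 \<in> Obj X" "a1 \<in> Obj X" "a2 \<in> Obj X" "b0 \<in> Obj X" "b1 \<in> Obj X" "b2 \<in> Obj X"
    and "c0 \<in> Arr X a0 b0" "c1 \<in> Arr X a1 b1" "c2 \<in> Arr X a2 b2"
    and "p01 \<in> Arr X a0 a1" "p12 \<in> Arr X a1 a2" "p02 \<in> Arr X a0 a2"
    and "g \<in> carrier (Grp X a0)" "d01 \<in> carrier (Grp X a0)" "d12 \<in> carrier (Grp X a1)" "d02 \<in> carrier (Grp X a0)"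
    and "Bdry X a0 g = Comp X a0 a2 a0 (Inv X a0 a2 p02) (Comp X a0 a1 a2 p12 p01)"
  shows "Bdry X b0 (gauge_grp a0 a1 b0 c0 p01 g d01 d12 d02) =
    Comp X b0 b2 b0 (Inv X b0 b2 (gauge_arr a0 a2 b0 b2 c0 c2 p02 d02))
      (Comp X b0 b1 b2 (gauge_arr a1 a2 b1 b2 c1 c2 p12 d12) (gauge_arr a0 a1 b0 b1 c0 c1 p01 d01))"
  unfolding gauge_grp_def gauge_arr_def using assms by (simp add: xmod_simps)

text \<open>All terms are carried to the group at \<open>a0\<close>. The Peiffer identity enters
  twice: for the boundary of \<open>d01\<close> inside the gauged arrow, and for the difference
  between the two ways from \<open>a2\<close> back to \<open>a0\<close>. What remains is
  \<open>gauge_cocycle\<close>.\<close>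

lemma gauge_assoc:
  assumes obj: "a0 \<in> Obj X" "a1 \<in> Obj X" "a2 \<in> Obj X" "b0 \<in> Obj X" "b1 \<in> Obj X"
    and c: "c0 \<in> Arr X a0 b0" "c1 \<in> Arr X a1 b1"
    and p: "p01 \<in> Arr X a0 a1" "p12 \<in> Arr X a1 a2" "p02 \<in> Arr X a0 a2"
    and g: "g012 \<in> carrier (Grp X a0)" "g023 \<in> carrier (Grp X a0)" "g013 \<in> carrier (Grp X a0)"
      "g123 \<in> carrier (Grp X a1)"
    and d: "d01 \<in> carrier (Grp X a0)" "d12 \<in> carrier (Grp X a1)" "d02 \<in> carrier (Grp X a0)"
      "d03 \<in> carrier (Grp X a0)" "d13 \<in> carrier (Grp X a1)" "d23 \<in> carrier (Grp X a2)"
    and bdry: "Bdry X a0 g012 = Comp X a0 a2 a0 (Inv X a0 a2 p02) (Comp X a0 a1 a2 p12 p01)"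
    and cocycle: "inv\<^bsub>Grp X a0\<^esub> g012 \<otimes>\<^bsub>Grp X a0\<^esub> inv\<^bsub>Grp X a0\<^esub> g023 \<otimes>\<^bsub>Grp X a0\<^esub> g013
      \<otimes>\<^bsub>Grp X a0\<^esub> Act X a1 a0 (Inv X a0 a1 p01) g123 = \<one>\<^bsub>Grp X a0\<^esub>"
  shows "inv\<^bsub>Grp X b0\<^esub> (gauge_grp a0 a1 b0 c0 p01 g012 d01 d12 d02)
      \<otimes>\<^bsub>Grp X b0\<^esub> inv\<^bsub>Grp X b0\<^esub> (gauge_grp a0 a2 b0 c0 p02 g023 d02 d23 d03)
      \<otimes>\<^bsub>Grp X b0\<^esub> gauge_grp a0 a1 b0 c0 p01 g013 d01 d13 d03
      \<otimes>\<^bsub>Grp X b0\<^esub> Act X b1 b0 (Inv X b0 b1 (gauge_arr a0 a1 b0 b1 c0 c1 p01 d01))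
          (gauge_grp a1 a2 b1 c1 p12 g123 d12 d23 d13)
    = \<one>\<^bsub>Grp X b0\<^esub>"
proof -
  interpret G: group "Grp X a0" using obj(1) by (rule group_Grp)
  interpret G1: group "Grp X a1" using obj(2) by (rule group_Grp)
  let ?A = "Act X a1 a0 (Inv X a0 a1 p01)"
  let ?w = "Act X a2 a0 (Inv X a0 a2 p02) d23"
  define D where "D = inv\<^bsub>Grp X a1\<^esub> d13 \<otimes>\<^bsub>Grp X a1\<^esub> g123
    \<otimes>\<^bsub>Grp X a1\<^esub> Act X a2 a1 (Inv X a1 a2 p12) d23 \<otimes>\<^bsub>Grp X a1\<^esub> d12"
  have w: "?w \<in> carrier (Grp X a0)"
    using obj p d by (simp add: xmod_simps)
  have D: "D \<in> carrier (Grp X a1)"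
    using obj p d g by (simp add: D_def xmod_simps)
  \<comment> \<open>The path \<open>c1\<close> cancels, so the translated element travels along the
    inverse of \<open>p01\<close>, the boundary of the inverse of \<open>d01\<close>, and
    \<open>c0\<close>.\<close>
  have "Comp X a1 b1 b0 (Inv X b0 b1 (gauge_arr a0 a1 b0 b1 c0 c1 p01 d01)) c1
      = Comp X a1 a0 b0 c0 (Comp X a1 a0 a0 (Bdry X a0 (inv\<^bsub>Grp X a0\<^esub> d01)) (Inv X a0 a1 p01))"
    unfolding gauge_arr_def using obj c p d by (simp add: xmod_simps)
  moreover have "Act X b1 b0 (Inv X b0 b1 (gauge_arr a0 a1 b0 b1 c0 c1 p01 d01)) (Act X a1 b1 c1 D)
      = Act X a1 b0 (Comp X a1 b1 b0 (Inv X b0 b1 (gauge_arr a0 a1 b0 b1 c0 c1 p01 d01)) c1) D"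
    using obj c p d D by (simp add: act_comp gauge_arr_closed Inv_closed)
  ultimately have "Act X b1 b0 (Inv X b0 b1 (gauge_arr a0 a1 b0 b1 c0 c1 p01 d01)) (Act X a1 b1 c1 D)
      = Act X a0 b0 c0 (Act X a0 a0 (Bdry X a0 (inv\<^bsub>Grp X a0\<^esub> d01)) (?A D))"
    using obj c p d D by (simp add: act_comp xmod_simps(1-13) bdry_closed)
  also have "\<dots> = Act X a0 b0 c0 (inv\<^bsub>Grp X a0\<^esub> d01 \<otimes>\<^bsub>Grp X a0\<^esub> ?A D \<otimes>\<^bsub>Grp X a0\<^esub> d01)"
    using obj c p d D by (simp add: peiffer act_closed Inv_closed)
  also have "?A D = inv\<^bsub>Grp X a0\<^esub> ?A d13 \<otimes>\<^bsub>Grp X a0\<^esub> ?A g123 \<otimes>\<^bsub>Grp X a0\<^esub>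
      ?A (Act X a2 a1 (Inv X a1 a2 p12) d23) \<otimes>\<^bsub>Grp X a0\<^esub> ?A d12"
    using obj p d g by (simp add: D_def xmod_simps)
  \<comment> \<open>By the boundary condition on \<open>g012\<close>, returning through
    \<open>a1\<close> is returning along the inverse of \<open>p02\<close> followed by the boundary
    of the inverse of \<open>g012\<close>.\<close>
  also have "?A (Act X a2 a1 (Inv X a1 a2 p12) d23)
      = Act X a0 a0 (Bdry X a0 (inv\<^bsub>Grp X a0\<^esub> g012)) ?w"
    using obj p d g by (simp add: act_comp[symmetric] bdry_inv bdry gpd_simps)
  also have "\<dots> = inv\<^bsub>Grp X a0\<^esub> g012 \<otimes>\<^bsub>Grp X a0\<^esub> ?w \<otimes>\<^bsub>Grp X a0\<^esub> g012"
    using obj g w by (simp add: peiffer)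
  finally have last: "Act X b1 b0 (Inv X b0 b1 (gauge_arr a0 a1 b0 b1 c0 c1 p01 d01))
        (gauge_grp a1 a2 b1 c1 p12 g123 d12 d23 d13)
      = Act X a0 b0 c0 (inv\<^bsub>Grp X a0\<^esub> d01 \<otimes>\<^bsub>Grp X a0\<^esub>
          (inv\<^bsub>Grp X a0\<^esub> ?A d13 \<otimes>\<^bsub>Grp X a0\<^esub> ?A g123 \<otimes>\<^bsub>Grp X a0\<^esub>
            (inv\<^bsub>Grp X a0\<^esub> g012 \<otimes>\<^bsub>Grp X a0\<^esub> ?w \<otimes>\<^bsub>Grp X a0\<^esub> g012) \<otimes>\<^bsub>Grp X a0\<^esub> ?A d12)
          \<otimes>\<^bsub>Grp X a0\<^esub> d01)"
    by (simp add: gauge_grp_def D_def)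
  have A: "?A x \<in> carrier (Grp X a0)" if "x \<in> carrier (Grp X a1)" for x
    using obj p that by (simp add: xmod_simps)
  show ?thesis
    unfolding last unfolding gauge_grp_def
    using G.gauge_cocycle[OF g(1,2,3) A[OF g(4)] d(1,3,4) A[OF d(2)] A[OF d(5)] w cocycle]
    by (simp add: obj c p d g w A act_inv[symmetric] act_mult[symmetric] act_one xmod_simps(1-3))
qed

lemma gauge_arr_trivial:
  "\<lbrakk>a0 \<in> Obj X; a1 \<in> Obj X; p \<in> Arr X a0 a1\<rbrakk>
    \<Longrightarrow> gauge_arr a0 a1 a0 a1 (Ident X a0) (Ident X a1) p \<one>\<^bsub>Grp X a0\<^esub> = p"
  by (simp add: gauge_arr_def xmod_simps)

lemma gauge_arr_ident:
  "\<lbrakk>a \<in> Obj X; b \<in> Obj X; c \<in> Arr X a b\<rbrakk>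
    \<Longrightarrow> gauge_arr a a b b c c (Ident X a) \<one>\<^bsub>Grp X a\<^esub> = Ident X b"
  by (simp add: gauge_arr_def xmod_simps)

lemma gauge_grp_trivial:
  assumes "a0 \<in> Obj X" "a1 \<in> Obj X" "p \<in> Arr X a0 a1" "g \<in> carrier (Grp X a0)"
  shows "gauge_grp a0 a1 a0 (Ident X a0) p g \<one>\<^bsub>Grp X a0\<^esub> \<one>\<^bsub>Grp X a1\<^esub> \<one>\<^bsub>Grp X a0\<^esub> = g"
proof -
  interpret group "Grp X a0" using assms(1) by (rule group_Grp)
  show ?thesis using assms by (simp add: gauge_grp_def xmod_simps)
qed

text \<open>The degenerate triangle i, i, k: its first edge has trivial correction and the other two
  edges share the correction d, which cancels.\<close>

lemma gauge_grp_left_ident: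
  assumes "a \<in> Obj X" "b \<in> Obj X" "c \<in> Arr X a b" "d \<in> carrier (Grp X a)"
  shows "gauge_grp a a b c (Ident X a) \<one>\<^bsub>Grp X a\<^esub> \<one>\<^bsub>Grp X a\<^esub> d d = \<one>\<^bsub>Grp X b\<^esub>"
proof -
  interpret group "Grp X a" using assms(1) by (rule group_Grp)
  show ?thesis using assms by (simp add: gauge_grp_def act_ident Inv_ident act_one)
qed

text \<open>The degenerate triangle i, k, k, where the trivial correction sits on the last
  edge.\<close>

lemma gauge_grp_right_ident:
  assumes "a0 \<in> Obj X" "a1 \<in> Obj X" "b \<in> Obj X" "c \<in> Arr X a0 b" "p \<in> Arr X a0 a1" "d \<in> carrier (Grp X a0)"
  shows "gauge_grp a0 a1 b c p \<one>\<^bsub>Grp X a0\<^esub> d \<one>\<^bsub>Grp X a1\<^esub> d = \<one>\<^bsub>Grp X b\<^esub>"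
proof -
  interpret group "Grp X a0" using assms(1) by (rule group_Grp)
  show ?thesis using assms by (simp add: gauge_grp_def act_one Inv_closed)
qed

end


section \<open>Nerves\<close>

text \<open>The conditions on a simplex apart from being \<open>undefined\<close> out of range.
  Constructions can then use arbitrary total functions and apply \<open>cut_system\<close> at the
  end.\<close>

definition is_system ::
  "('o, 'm, 'g) xmod \<Rightarrow> nat \<Rightarrow> (nat \<Rightarrow> nat \<Rightarrow> nat \<Rightarrow> 'g) \<Rightarrow> (nat \<Rightarrow> nat \<Rightarrow> 'm) \<Rightarrow> (nat \<Rightarrow> 'o) \<Rightarrow> bool" where
  "is_system X n g p a \<longleftrightarrow>
     (\<forall>i\<le>n. a i \<in> Obj X) \<and>
     (\<forall>i j. i \<le> j \<and> j \<le> n \<longrightarrow> p i j \<in> Arr X (a i) (a j)) \<and>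
     (\<forall>i\<le>n. p i i = Ident X (a i)) \<and>
     (\<forall>i j k. i \<le> j \<and> j \<le> k \<and> k \<le> n \<longrightarrow> g i j k \<in> carrier (Grp X (a i))) \<and>
     (\<forall>i j. i \<le> j \<and> j \<le> n \<longrightarrow>
        g i i j = \<one>\<^bsub>Grp X (a i)\<^esub> \<and> g i j j = \<one>\<^bsub>Grp X (a i)\<^esub>) \<and>
     (\<forall>i j k. i \<le> j \<and> j \<le> k \<and> k \<le> n \<longrightarrow>
        Bdry X (a i) (g i j k) =
          Comp X (a i) (a k) (a i) (Inv X (a i) (a k) (p i k))
            (Comp X (a i) (a j) (a k) (p j k) (p i j))) \<and>
     (\<forall>i j k l. i \<le> j \<and> j \<le> k \<and> k \<le> l \<and> l \<le> n \<longrightarrow>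
        inv\<^bsub>Grp X (a i)\<^esub> (g i j k) \<otimes>\<^bsub>Grp X (a i)\<^esub> inv\<^bsub>Grp X (a i)\<^esub> (g i k l)
          \<otimes>\<^bsub>Grp X (a i)\<^esub> g i j l
          \<otimes>\<^bsub>Grp X (a i)\<^esub> Act X (a j) (a i) (Inv X (a i) (a j) (p i j)) (g j k l)
        = \<one>\<^bsub>Grp X (a i)\<^esub>)"

lemma mem_nerve_iff:
  "(g, p, a) \<in> nerve_simplices X n \<longleftrightarrow> cut_system n (g, p, a) = (g, p, a) \<and> is_system X n g p a"
  by (simp add: nerve_simplices_def is_system_def)

lemma is_systemD:
  assumes "is_system X n g p a"
  shows "i \<le> n \<Longrightarrow> a i \<in> Obj X"
    and "i \<le> j \<Longrightarrow> j \<le> n \<Longrightarrow> p i j \<in> Arr X (a i) (a j)"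
    and "i \<le> n \<Longrightarrow> p i i = Ident X (a i)"
    and "i \<le> j \<Longrightarrow> j \<le> k \<Longrightarrow> k \<le> n \<Longrightarrow> g i j k \<in> carrier (Grp X (a i))"
    and "i \<le> j \<Longrightarrow> j \<le> n \<Longrightarrow> g i i j = \<one>\<^bsub>Grp X (a i)\<^esub>"
    and "i \<le> j \<Longrightarrow> j \<le> n \<Longrightarrow> g i j j = \<one>\<^bsub>Grp X (a i)\<^esub>"
    and "i \<le> j \<Longrightarrow> j \<le> k \<Longrightarrow> k \<le> n \<Longrightarrow> Bdry X (a i) (g i j k) =
          Comp X (a i) (a k) (a i) (Inv X (a i) (a k) (p i k)) (Comp X (a i) (a j) (a k) (p j k) (p i j))"
    and "i \<le> j \<Longrightarrow> j \<le> k \<Longrightarrow> k \<le> l \<Longrightarrow> l \<le> n \<Longrightarrow>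
        inv\<^bsub>Grp X (a i)\<^esub> (g i j k) \<otimes>\<^bsub>Grp X (a i)\<^esub> inv\<^bsub>Grp X (a i)\<^esub> (g i k l)
          \<otimes>\<^bsub>Grp X (a i)\<^esub> g i j l
          \<otimes>\<^bsub>Grp X (a i)\<^esub> Act X (a j) (a i) (Inv X (a i) (a j) (p i j)) (g j k l)
        = \<one>\<^bsub>Grp X (a i)\<^esub>"
  using assms by (simp_all add: is_system_def)

lemma cut_system_idem: "cut_system n (cut_system n s) = cut_system n s"
  by (cases s) (simp add: cut_system_def fun_eq_iff)

lemma cut_system_cong:
  assumes "\<And>i j k. \<lbrakk>i \<le> j; j \<le> k; k \<le> n\<rbrakk> \<Longrightarrow> g i j k = g' i j k"
    and "\<And>i j. \<lbrakk>i \<le> j; j \<le> n\<rbrakk> \<Longrightarrow> p i j = p' i j"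
    and "\<And>i. i \<le> n \<Longrightarrow> a i = a' i"
  shows "cut_system n (g, p, a) = cut_system n (g', p', a')"
  using assms by (auto simp: cut_system_def fun_eq_iff)

lemma cut_system_eqD:
  assumes "cut_system n (g, p, a) = cut_system n (g', p', a')"
  shows "\<lbrakk>i \<le> j; j \<le> k; k \<le> n\<rbrakk> \<Longrightarrow> g i j k = g' i j k"
    and "\<lbrakk>i \<le> j; j \<le> n\<rbrakk> \<Longrightarrow> p i j = p' i j"
    and "i \<le> n \<Longrightarrow> a i = a' i"
  using assms by (auto simp: cut_system_def fun_eq_iff) metis+

lemma is_system_cong:
  assumes g: "\<And>i j k. \<lbrakk>i \<le> j; j \<le> k; k \<le> n\<rbrakk> \<Longrightarrow> g i j k = g' i j k"
    and p: "\<And>i j. \<lbrakk>i \<le> j; j \<le> n\<rbrakk> \<Longrightarrow> p i j = p' i j"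
    and a: "\<And>i. i \<le> n \<Longrightarrow> a i = a' i"
    and s: "is_system X n g p a"
  shows "is_system X n g' p' a'"
proof -
  note eqs = g[symmetric] p[symmetric] a[symmetric]
  show ?thesis
    unfolding is_system_def using is_systemD[OF s] by (auto simp: eqs)
qed

lemma cut_system_mem_nerve:
  "cut_system n (g, p, a) \<in> nerve_simplices X n \<longleftrightarrow> is_system X n g p a"
proof -
  obtain g' p' a' where c: "cut_system n (g, p, a) = (g', p', a')"
    by (cases "cut_system n (g, p, a)") auto
  then have eqs: "\<And>i j k. \<lbrakk>i \<le> j; j \<le> k; k \<le> n\<rbrakk> \<Longrightarrow> g' i j k = g i j k"
    "\<And>i j. \<lbrakk>i \<le> j; j \<le> n\<rbrakk> \<Longrightarrow> p' i j = p i j" "\<And>i. i \<le> n \<Longrightarrow> a' i = a i"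
    by (auto simp: cut_system_def)
  have "cut_system n (g', p', a') = (g', p', a')"
    unfolding c[symmetric] by (rule cut_system_idem)
  moreover have "is_system X n g' p' a' \<longleftrightarrow> is_system X n g p a"
    using is_system_cong[of n g' g p' p a' a X] is_system_cong[of n g g' p p' a a' X] eqs by auto
  ultimately show ?thesis
    by (simp add: c mem_nerve_iff)
qed

lemma Spx_nerve [simp]: "Spx (nerve X) = nerve_simplices X"
  by (simp add: nerve_def)

lemma Op_nerve_cut:
  assumes "\<theta> \<in> delta m n"
  shows "Op (nerve X) m n \<theta> (cut_system n (g, p, a)) =
    cut_system m (\<lambda>i j k. g (\<theta> i) (\<theta> j) (\<theta> k), \<lambda>i j. p (\<theta> i) (\<theta> j), \<lambda>i. a (\<theta> i))"
  using assms unfolding nerve_def delta_iff by (simp add: cut_system_def fun_eq_iff)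

text \<open>Presenting a simplex as a cut system is what allows operators and induced maps to be
  computed on representatives, by \<open>Op_nerve_cut\<close> and
  \<open>nerve_map_cut\<close>.\<close>

lemma nerve_cases:
  assumes "x \<in> nerve_simplices X n"
  obtains g p a where "x = cut_system n (g, p, a)" "is_system X n g p a"
  using assms by (cases x) (metis mem_nerve_iff)

text \<open>All conditions are stated for weakly increasing indices, so they survive monotone maps
  that are not injective as well.\<close>

lemma is_system_reindex:
  assumes "is_system X n g p a" "\<theta> \<in> delta m n"
  shows "is_system X m (\<lambda>i j k. g (\<theta> i) (\<theta> j) (\<theta> k)) (\<lambda>i j. p (\<theta> i) (\<theta> j)) (\<lambda>i. a (\<theta> i))"
proof -
  have "\<theta> i \<le> \<theta> j" if "i \<le> j" "j \<le> m" for i j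
    using assms that by (auto simp: delta_iff)
  moreover have "\<theta> i \<le> n" if "i \<le> m" for i
    using assms that by (auto simp: delta_iff)
  ultimately show ?thesis
    unfolding is_system_def using is_systemD[OF assms(1)] by simp
qed

lemma simplicial_set_nerve: "simplicial_set (nerve X)"
proof
  show "Op (nerve X) m n \<theta> x \<in> Spx (nerve X) m" if "\<theta> \<in> delta m n" "x \<in> Spx (nerve X) n" for \<theta> m n x
    using that by (auto elim!: nerve_cases simp: Op_nerve_cut cut_system_mem_nerve is_system_reindex)
  show "Op (nerve X) n n \<theta> x = x" if "x \<in> Spx (nerve X) n" "\<And>i. i \<le> n \<Longrightarrow> \<theta> i = i" for x n \<theta>
  proof -
    have "\<theta> \<in> delta n n"
      using that by (simp add: delta_iff)
    then show ?thesis
      using that by (auto elim!: nerve_cases simp: Op_nerve_cut intro!: cut_system_cong)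
  qed
  show "Op (nerve X) l m \<phi> (Op (nerve X) m n \<theta> x) = Op (nerve X) l n \<psi> x"
    if "\<theta> \<in> delta m n" "\<phi> \<in> delta l m" "x \<in> Spx (nerve X) n" "\<And>i. i \<le> l \<Longrightarrow> \<psi> i = \<theta> (\<phi> i)" for \<theta> m n \<phi> l x \<psi>
  proof -
    have "\<psi> \<in> delta l n"
      using that(1,2,4) by (simp add: delta_iff)
    then show ?thesis
      using that by (auto elim!: nerve_cases simp: Op_nerve_cut intro!: cut_system_cong)
  qed
qed

section \<open>Maps induced on nerves\<close>

context xmod_morphism
begin

lemma arr_inv:
  assumes "a \<in> Obj X" "b \<in> Obj X" "p \<in> Arr X a b"
  shows "on_arr f b a (Inv X a b p) = Inv Y (on_obj f a) (on_obj f b) (on_arr f a b p)"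
  by (rule cod.Inv_eqI[symmetric])
    (use assms in \<open>simp_all add: obj_closed arr_closed dom.Inv_props arr_comp[symmetric] arr_ident\<close>)

lemma group_hom_grp: "a \<in> Obj X \<Longrightarrow> group_hom (Grp X a) (Grp Y (on_obj f a)) (on_grp f a)"
  by (simp add: group_hom_def group_hom_axioms_def dom.group_Grp cod.group_Grp obj_closed grp_hom)

lemma grp_closed: "\<lbrakk>a \<in> Obj X; g \<in> carrier (Grp X a)\<rbrakk> \<Longrightarrow> on_grp f a g \<in> carrier (Grp Y (on_obj f a))"
  by (rule hom_in_carrier[OF grp_hom])

lemma grp_mult:
  "\<lbrakk>a \<in> Obj X; g \<in> carrier (Grp X a); h \<in> carrier (Grp X a)\<rbrakk>
    \<Longrightarrow> on_grp f a (g \<otimes>\<^bsub>Grp X a\<^esub> h) = on_grp f a g \<otimes>\<^bsub>Grp Y (on_obj f a)\<^esub> on_grp f a h"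
  by (rule hom_mult[OF grp_hom])

lemma grp_one: "a \<in> Obj X \<Longrightarrow> on_grp f a \<one>\<^bsub>Grp X a\<^esub> = \<one>\<^bsub>Grp Y (on_obj f a)\<^esub>"
  by (rule group_hom.hom_one[OF group_hom_grp])

lemma grp_inv:
  "\<lbrakk>a \<in> Obj X; g \<in> carrier (Grp X a)\<rbrakk>
    \<Longrightarrow> on_grp f a (inv\<^bsub>Grp X a\<^esub> g) = inv\<^bsub>Grp Y (on_obj f a)\<^esub> on_grp f a g"
  by (rule group_hom.hom_inv[OF group_hom_grp])

lemmas map_simps = obj_closed arr_closed arr_ident arr_comp arr_inv grp_closed grp_mult grp_one grp_inv
  grp_natural bdry_compat

lemma nerve_map_cut:
  "nerve_map f n (cut_system n (g, p, a)) =
    cut_system n (\<lambda>i j k. on_grp f (a i) (g i j k), \<lambda>i j. on_arr f (a i) (a j) (p i j), \<lambda>i. on_obj f (a i))"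
proof -
  have *: "cut_system n (g, p, a) = ((\<lambda>i j k. if i \<le> j \<and> j \<le> k \<and> k \<le> n then g i j k else undefined),
      (\<lambda>i j. if i \<le> j \<and> j \<le> n then p i j else undefined), (\<lambda>i. if i \<le> n then a i else undefined))"
    by (simp add: cut_system_def)
  show ?thesis
    unfolding nerve_map_def * prod.case by (rule cut_system_cong) auto
qed

lemma is_system_map:
  assumes s: "is_system X n g p a"
  shows "is_system Y n (\<lambda>i j k. on_grp f (a i) (g i j k)) (\<lambda>i j. on_arr f (a i) (a j) (p i j)) (\<lambda>i. on_obj f (a i))"
proof -
  note D = is_systemD[OF s]
  have cocycle: "inv\<^bsub>Grp Y (on_obj f (a i))\<^esub> on_grp f (a i) (g i j k) \<otimes>\<^bsub>Grp Y (on_obj f (a i))\<^esub>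
       inv\<^bsub>Grp Y (on_obj f (a i))\<^esub> on_grp f (a i) (g i k l) \<otimes>\<^bsub>Grp Y (on_obj f (a i))\<^esub>
       on_grp f (a i) (g i j l) \<otimes>\<^bsub>Grp Y (on_obj f (a i))\<^esub>
       Act Y (on_obj f (a j)) (on_obj f (a i))
        (Inv Y (on_obj f (a i)) (on_obj f (a j)) (on_arr f (a i) (a j) (p i j)))
        (on_grp f (a j) (g j k l)) = \<one>\<^bsub>Grp Y (on_obj f (a i))\<^esub>"
    if "i \<le> j" "j \<le> k" "k \<le> l" "l \<le> n" for i j k l
    using arg_cong[OF D(8)[OF that], of "on_grp f (a i)"] that
    by (simp add: map_simps D(1-6) dom.xmod_simps)
  have bdry: "Bdry Y (on_obj f (a i)) (on_grp f (a i) (g i j k)) =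
          Comp Y (on_obj f (a i)) (on_obj f (a k)) (on_obj f (a i))
            (Inv Y (on_obj f (a i)) (on_obj f (a k)) (on_arr f (a i) (a k) (p i k)))
            (Comp Y (on_obj f (a i)) (on_obj f (a j)) (on_obj f (a k)) (on_arr f (a j) (a k) (p j k))
              (on_arr f (a i) (a j) (p i j)))" if "i \<le> j" "j \<le> k" "k \<le> n" for i j k
    using that by (simp add: map_simps D(1-6) D(7)[OF that] dom.Inv_closed dom.comp_closed)
  show ?thesis
    unfolding is_system_def using D(1-6) by (simp add: cocycle bdry map_simps(1-10))
qed

lemma simplicial_map_nerve_map: "simplicial_map (nerve X) (nerve Y) (nerve_map f)"
proof (intro simplicial_map.intro simplicial_set_nerve simplicial_map_axioms.intro)
  show "nerve_map f n x \<in> Spx (nerve Y) n" if "x \<in> Spx (nerve X) n" for x n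
    using that by (auto elim!: nerve_cases simp: nerve_map_cut cut_system_mem_nerve is_system_map)
  show "nerve_map f m (Op (nerve X) m n \<theta> x) = Op (nerve Y) m n \<theta> (nerve_map f n x)"
    if "\<theta> \<in> delta m n" "x \<in> Spx (nerve X) n" for \<theta> m n x
    using that by (auto elim!: nerve_cases simp: nerve_map_cut Op_nerve_cut)
qed

end

section \<open>Gauge transformations of whole simplices\<close>

context crossed_module
begin

text \<open>The corrections of different edges are independent of one another, since
  \<open>gauge_grp\<close> absorbs their mismatch in each triangle. The condition
  \<open>d_refl\<close> serves the degenerate edges and triangles.\<close>

lemma is_system_gauge:
  assumes s: "is_system X n g p a"
    and b: "\<And>i. i \<le> n \<Longrightarrow> b i \<in> Obj X"
    and c: "\<And>i. i \<le> n \<Longrightarrow> c i \<in> Arr X (a i) (b i)"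
    and d: "\<And>i j. \<lbrakk>i \<le> j; j \<le> n\<rbrakk> \<Longrightarrow> d i j \<in> carrier (Grp X (a i))"
    and d_refl: "\<And>i. i \<le> n \<Longrightarrow> d i i = \<one>\<^bsub>Grp X (a i)\<^esub>"
  shows "is_system X n
    (\<lambda>i j k. gauge_grp (a i) (a j) (b i) (c i) (p i j) (g i j k) (d i j) (d j k) (d i k))
    (\<lambda>i j. gauge_arr (a i) (a j) (b i) (b j) (c i) (c j) (p i j) (d i j)) b"
proof -
  note D = is_systemD[OF s]
  show ?thesis
    unfolding is_system_def
  proof (intro conjI allI impI; (elim conjE)?)
    fix i j k l assume ijkl: "i \<le> j" "j \<le> k" "k \<le> l" "l \<le> n"
    then have le: "i \<le> n" "j \<le> n" "k \<le> n" "i \<le> k" "i \<le> l" "j \<le> l"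
      by auto
    show "inv\<^bsub>Grp X (b i)\<^esub> gauge_grp (a i) (a j) (b i) (c i) (p i j) (g i j k) (d i j) (d j k) (d i k)
          \<otimes>\<^bsub>Grp X (b i)\<^esub> inv\<^bsub>Grp X (b i)\<^esub> gauge_grp (a i) (a k) (b i) (c i) (p i k) (g i k l) (d i k) (d k l) (d i l)
          \<otimes>\<^bsub>Grp X (b i)\<^esub> gauge_grp (a i) (a j) (b i) (c i) (p i j) (g i j l) (d i j) (d j l) (d i l)
          \<otimes>\<^bsub>Grp X (b i)\<^esub> Act X (b j) (b i)
            (Inv X (b i) (b j) (gauge_arr (a i) (a j) (b i) (b j) (c i) (c j) (p i j) (d i j)))
            (gauge_grp (a j) (a k) (b j) (c j) (p j k) (g j k l) (d j k) (d k l) (d j l))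
        = \<one>\<^bsub>Grp X (b i)\<^esub>"
      by (rule gauge_assoc[where ?p02.0 = "p i k" and ?a2.0 = "a k"])
        (use ijkl le in \<open>simp_all add: D(1-4) b c d D(7)[of i j k] D(8)[of i j k l]\<close>)
  next
    fix i j k assume "i \<le> j" "j \<le> k" "k \<le> n"
    moreover from this have "i \<le> n" "j \<le> n" "i \<le> k" by auto
    ultimately show "Bdry X (b i) (gauge_grp (a i) (a j) (b i) (c i) (p i j) (g i j k) (d i j) (d j k) (d i k)) =
       Comp X (b i) (b k) (b i) (Inv X (b i) (b k) (gauge_arr (a i) (a k) (b i) (b k) (c i) (c k) (p i k) (d i k)))
        (Comp X (b i) (b j) (b k) (gauge_arr (a j) (a k) (b j) (b k) (c j) (c k) (p j k) (d j k))
          (gauge_arr (a i) (a j) (b i) (b j) (c i) (c j) (p i j) (d i j)))"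
      by (intro gauge_bdry) (simp_all add: D(1-4) b c d D(7)[of i j k])
  qed (simp_all add: D(1-6) b c d d_refl gauge_arr_closed gauge_grp_closed gauge_arr_ident
      gauge_grp_left_ident gauge_grp_right_ident)
qed

end


section \<open>Dense inclusions of crossed modules\<close>

text \<open>Taking for p an identity, \<open>bdry_reflect\<close> identifies the kernels of the
  boundary maps; for general p it works with \<open>full\<close> to identify arrows modulo
  boundaries. With \<open>ess_surj\<close> this is the crossed module form of an equivalence of
  homotopy types.\<close>

locale dense_inclusion = xmod_morphism W Z j
  for W :: "('o, 'm, 'g) xmod" and Z :: "('o1, 'm1, 'g1) xmod" and j +
  assumes inj_obj: "inj_on (on_obj j) (Obj W)"
    and inj_arr: "\<lbrakk>a \<in> Obj W; b \<in> Obj W\<rbrakk> \<Longrightarrow> inj_on (on_arr j a b) (Arr W a b)"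
    and inj_grp: "a \<in> Obj W \<Longrightarrow> inj_on (on_grp j a) (carrier (Grp W a))"
    and bdry_reflect: "\<lbrakk>a \<in> Obj W; g \<in> carrier (Grp Z (on_obj j a)); p \<in> Arr W a a;
        Bdry Z (on_obj j a) g = on_arr j a a p\<rbrakk> \<Longrightarrow> g \<in> on_grp j a ` carrier (Grp W a)"
    and ess_surj: "z \<in> Obj Z \<Longrightarrow> \<exists>w\<in>Obj W. \<exists>c. c \<in> Arr Z z (on_obj j w)"
    and full: "\<lbrakk>a \<in> Obj W; b \<in> Obj W; q \<in> Arr Z (on_obj j a) (on_obj j b)\<rbrakk>
      \<Longrightarrow> \<exists>d\<in>carrier (Grp Z (on_obj j a)).
        Comp Z (on_obj j a) (on_obj j a) (on_obj j b) q (Bdry Z (on_obj j a) d) \<in> on_arr j a b ` Arr W a b"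
begin

lemma inj_nerve_map: "inj_on (nerve_map j n) (nerve_simplices W n)"
proof (rule inj_onI)
  fix x y assume "x \<in> nerve_simplices W n" "y \<in> nerve_simplices W n" and eq: "nerve_map j n x = nerve_map j n y"
  then obtain g p a g' p' a' where x: "x = cut_system n (g, p, a)" "is_system W n g p a"
    and y: "y = cut_system n (g', p', a')" "is_system W n g' p' a'"
    by (metis nerve_cases)
  note D = is_systemD[OF x(2)] and D' = is_systemD[OF y(2)]
  note E = cut_system_eqD[OF eq[unfolded x(1) y(1) nerve_map_cut]]
  have a: "a i = a' i" if "i \<le> n" for i
    using E(3)[OF that] D(1) D'(1) that inj_obj by (auto dest: inj_onD)
  have p: "p i k = p' i k" if "i \<le> k" "k \<le> n" for i k
    using E(2)[OF that] D(1)[of i] D(1)[of k] D(2)[OF that] D'(2)[OF that] that inj_arr[of "a i" "a k"]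
    by (auto simp: a[symmetric] dest: inj_onD)
  have g: "g i k l = g' i k l" if "i \<le> k" "k \<le> l" "l \<le> n" for i k l
    using E(1)[OF that] D(1)[of i] D(4)[OF that] D'(4)[OF that] that inj_grp[of "a i"]
    by (auto simp: a[symmetric] dest: inj_onD)
  show "x = y"
    unfolding x y by (rule cut_system_cong) (use a p g in auto)
qed

definition image_arr :: "'o1 \<Rightarrow> 'o1 \<Rightarrow> 'm1 set" where
  "image_arr y z = {q. \<exists>a\<in>Obj W. \<exists>b\<in>Obj W. \<exists>p\<in>Arr W a b. y = on_obj j a \<and> z = on_obj j b \<and> q = on_arr j a b p}"

text \<open>Injectivity on objects identifies the endpoints hidden in \<open>image_arr\<close> with
  a and b. Arrow sets may overlap, so the endpoints cannot be read off from q itself.\<close>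

lemma image_arr_obtain:
  assumes "a \<in> Obj W" "b \<in> Obj W" "q \<in> image_arr (on_obj j a) (on_obj j b)"
  obtains p where "p \<in> Arr W a b" "q = on_arr j a b p"
  using assms inj_onD[OF inj_obj] unfolding image_arr_def by blast

text \<open>Only vertices and edges have to be placed in the image: the boundary of each group
  element is a composite of lifted edges, so \<open>bdry_reflect\<close> lifts the element too. The
  identities of a system are then reflected by injectivity.\<close>

lemma nerve_lift:
  assumes s: "is_system Z n g p a"
    and a: "\<And>i. i \<le> n \<Longrightarrow> a i \<in> on_obj j ` Obj W"
    and p: "\<And>i k. \<lbrakk>i \<le> k; k \<le> n\<rbrakk> \<Longrightarrow> p i k \<in> image_arr (a i) (a k)"
  shows "cut_system n (g, p, a) \<in> nerve_map j n ` nerve_simplices W n"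
proof -
  note D = is_systemD[OF s]
  define w where "w i = (SOME b. b \<in> Obj W \<and> on_obj j b = a i)" for i
  have w: "w i \<in> Obj W \<and> on_obj j (w i) = a i" if "i \<le> n" for i
    unfolding w_def by (rule someI_ex) (use a[OF that] in auto)
  then have wO: "i \<le> n \<Longrightarrow> w i \<in> Obj W" and wj: "i \<le> n \<Longrightarrow> on_obj j (w i) = a i" for i
    by auto
  define p0 where "p0 i k = (SOME q. q \<in> Arr W (w i) (w k) \<and> on_arr j (w i) (w k) q = p i k)" for i k
  have p0: "p0 i k \<in> Arr W (w i) (w k) \<and> on_arr j (w i) (w k) (p0 i k) = p i k" if ik: "i \<le> k" "k \<le> n" for i k
  proof -
    have i: "i \<le> n"
      using ik by simp
    have "p i k \<in> image_arr (on_obj j (w i)) (on_obj j (w k))"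
      using p[OF ik] by (simp add: wj i ik(2))
    then obtain q where "q \<in> Arr W (w i) (w k)" "p i k = on_arr j (w i) (w k) q"
      by (rule image_arr_obtain[OF wO[OF i] wO[OF ik(2)]])
    then have "\<exists>q. q \<in> Arr W (w i) (w k) \<and> on_arr j (w i) (w k) q = p i k"
      by auto
    then show ?thesis
      unfolding p0_def by (rule someI_ex)
  qed
  then have pA: "p0 i k \<in> Arr W (w i) (w k)" and pj: "on_arr j (w i) (w k) (p0 i k) = p i k"
    if "i \<le> k" "k \<le> n" for i k
    using that by auto
  define g0 where "g0 i k l = (SOME h. h \<in> carrier (Grp W (w i)) \<and> on_grp j (w i) h = g i k l)" for i k l
  have g0: "g0 i k l \<in> carrier (Grp W (w i)) \<and> on_grp j (w i) (g0 i k l) = g i k l"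
    if ikl: "i \<le> k" "k \<le> l" "l \<le> n" for i k l
  proof -
    have le: "i \<le> l" "i \<le> n" "k \<le> n" using that by auto
    define q where "q = Comp W (w i) (w l) (w i) (Inv W (w i) (w l) (p0 i l))
        (Comp W (w i) (w k) (w l) (p0 k l) (p0 i k))"
    have q: "q \<in> Arr W (w i) (w i)"
      unfolding q_def using ikl le by (simp add: dom.comp_closed dom.Inv_closed wO pA)
    have "Bdry Z (a i) (g i k l) = on_arr j (w i) (w i) q"
      unfolding q_def D(7)[OF ikl]
      using ikl le by (simp add: arr_comp arr_inv dom.comp_closed dom.Inv_closed wO wj pA pj)
    then have "g i k l \<in> on_grp j (w i) ` carrier (Grp W (w i))"
      using bdry_reflect[OF wO[OF le(2)] _ q, of "g i k l"] D(4)[OF ikl] wj[OF le(2)] by simp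
    then have "\<exists>h. h \<in> carrier (Grp W (w i)) \<and> on_grp j (w i) h = g i k l"
      by auto
    then show ?thesis
      unfolding g0_def by (rule someI_ex)
  qed
  then have gA: "g0 i k l \<in> carrier (Grp W (w i))" and gj: "on_grp j (w i) (g0 i k l) = g i k l"
    if "i \<le> k" "k \<le> l" "l \<le> n" for i k l
    using that by auto
  have arr_eqI: "q = r" if "a \<in> Obj W" "b \<in> Obj W" "q \<in> Arr W a b" "r \<in> Arr W a b" "on_arr j a b q = on_arr j a b r"
    for a b q r
    using inj_arr[OF that(1,2)] that by (auto dest: inj_onD)
  have grp_eqI: "q = r" if "a \<in> Obj W" "q \<in> carrier (Grp W a)" "r \<in> carrier (Grp W a)" "on_grp j a q = on_grp j a r"
    for a q r
    using inj_grp[OF that(1)] that by (auto dest: inj_onD)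
  note closed = dom.comp_closed dom.ident_closed dom.Inv_closed dom.act_closed dom.bdry_closed
      dom.grp_mult_closed dom.grp_inv_closed dom.grp_one_closed
  have "is_system W n g0 p0 w"
    unfolding is_system_def
  proof (intro conjI allI impI; (elim conjE)?)
    fix i assume "i \<le> n"
    then show "p0 i i = Ident W (w i)"
      by (intro arr_eqI[of "w i" "w i"]) (simp_all add: wO pA pj closed arr_ident wj D)
  next
    fix i k assume "i \<le> k" "k \<le> n"
    then show "g0 i i k = \<one>\<^bsub>Grp W (w i)\<^esub>" "g0 i k k = \<one>\<^bsub>Grp W (w i)\<^esub>"
      by (auto intro!: grp_eqI[of "w i"] simp: wO gA gj closed grp_one wj D)
  next
    fix i k l assume ikl: "i \<le> k" "k \<le> l" "l \<le> n"
    then show "Bdry W (w i) (g0 i k l) = Comp W (w i) (w l) (w i) (Inv W (w i) (w l) (p0 i l))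
        (Comp W (w i) (w k) (w l) (p0 k l) (p0 i k))"
      by (intro arr_eqI[of "w i" "w i"])
        (simp_all add: wO pA gA closed bdry_compat[symmetric] gj wj D(7)[OF ikl] arr_comp arr_inv pj)
  next
    fix i k l m assume ijkl: "i \<le> k" "k \<le> l" "l \<le> m" "m \<le> n"
    then show "inv\<^bsub>Grp W (w i)\<^esub> g0 i k l \<otimes>\<^bsub>Grp W (w i)\<^esub> inv\<^bsub>Grp W (w i)\<^esub> g0 i l m \<otimes>\<^bsub>Grp W (w i)\<^esub> g0 i k m
        \<otimes>\<^bsub>Grp W (w i)\<^esub> Act W (w k) (w i) (Inv W (w i) (w k) (p0 i k)) (g0 k l m) = \<one>\<^bsub>Grp W (w i)\<^esub>"
      by (intro grp_eqI[of "w i"])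
        (simp_all add: wO pA gA closed grp_mult grp_inv grp_natural grp_one gj wj arr_inv pj D(8)[OF ijkl])
  qed (simp_all add: wO pA gA)
  moreover have "cut_system n (g, p, a) = nerve_map j n (cut_system n (g0, p0, w))"
    unfolding nerve_map_cut by (rule cut_system_cong) (simp_all add: wj pj gj)
  ultimately show ?thesis
    by (auto simp: cut_system_mem_nerve)
qed

section \<open>Chosen paths and corrections, and the transport they define\<close>

definition root :: "'o1 \<Rightarrow> 'o1" where
  "root z = (if z \<in> on_obj j ` Obj W then z
    else SOME y. y \<in> on_obj j ` Obj W \<and> (\<exists>c. c \<in> Arr Z z y))"

definition path :: "'o1 \<Rightarrow> 'm1" where
  "path z = (if z \<in> on_obj j ` Obj W then Ident Z z else SOME c. c \<in> Arr Z z (root z))"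

text \<open>The first branch makes identities cost nothing, as the condition on degenerate edges
  demands, and fixes simplices that already come from \<open>W\<close>, so that the retraction is
  strict.\<close>

definition correction :: "'o1 \<Rightarrow> 'o1 \<Rightarrow> 'm1 \<Rightarrow> 'g1" where
  "correction y z p = (if p \<in> image_arr y z then \<one>\<^bsub>Grp Z y\<^esub>
    else SOME d. d \<in> carrier (Grp Z y) \<and> Comp Z y y z p (Bdry Z y d) \<in> image_arr y z)"

lemma root_path:
  assumes "z \<in> Obj Z"
  shows "root z \<in> on_obj j ` Obj W" "path z \<in> Arr Z z (root z)"
proof -
  have *: "root z \<in> on_obj j ` Obj W \<and> (\<exists>c. c \<in> Arr Z z (root z))"
  proof (cases "z \<in> on_obj j ` Obj W")
    case True
    then show ?thesis
      using assms cod.ident_closed by (auto simp: root_def)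
  next
    case False
    have "\<exists>y. y \<in> on_obj j ` Obj W \<and> (\<exists>c. c \<in> Arr Z z y)"
      using ess_surj[OF assms] by blast
    from someI_ex[OF this] False show ?thesis
      by (simp add: root_def)
  qed
  then show "root z \<in> on_obj j ` Obj W" by simp
  show "path z \<in> Arr Z z (root z)"
  proof (cases "z \<in> on_obj j ` Obj W")
    case True
    then show ?thesis
      using assms cod.ident_closed by (simp add: path_def root_def)
  next
    case False
    have "(SOME c. c \<in> Arr Z z (root z)) \<in> Arr Z z (root z)"
      using * by (rule someI_ex[OF conjunct2])
    with False show ?thesis
      by (simp add: path_def)
  qed
qed

lemma root_closed: "z \<in> Obj Z \<Longrightarrow> root z \<in> Obj Z"
  using root_path(1)[of z] by (auto simp: obj_closed)

lemma correction:
  assumes "y \<in> on_obj j ` Obj W" "z \<in> on_obj j ` Obj W" "p \<in> Arr Z y z"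
  shows "correction y z p \<in> carrier (Grp Z y)"
    and "Comp Z y y z p (Bdry Z y (correction y z p)) \<in> image_arr y z"
proof -
  have o: "y \<in> Obj Z" "z \<in> Obj Z"
    using assms obj_closed by auto
  have "correction y z p \<in> carrier (Grp Z y) \<and> Comp Z y y z p (Bdry Z y (correction y z p)) \<in> image_arr y z"
  proof (cases "p \<in> image_arr y z")
    case True
    then show ?thesis
      using o assms(3) by (simp add: correction_def cod.grp_one_closed cod.bdry_one cod.ident_right)
  next
    case False
    have "\<exists>d. d \<in> carrier (Grp Z y) \<and> Comp Z y y z p (Bdry Z y d) \<in> image_arr y z"
      using assms full unfolding image_arr_def by fastforce
    from someI_ex[OF this] False show ?thesis
      by (simp add: correction_def)
  qed
  then show "correction y z p \<in> carrier (Grp Z y)"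
    and "Comp Z y y z p (Bdry Z y (correction y z p)) \<in> image_arr y z"
    by auto
qed

text \<open>A vertex is moved into the image of \<open>j\<close> along \<open>path\<close> at level \<open>1\<close> and left alone at level \<open>0\<close>.\<close>

definition lroot :: "nat \<Rightarrow> 'o1 \<Rightarrow> 'o1" where
  "lroot e z = (if e = 0 then z else root z)"

definition lpath :: "nat \<Rightarrow> 'o1 \<Rightarrow> 'm1" where
  "lpath e z = (if e = 0 then Ident Z z else path z)"

text \<open>A correction is called for only when both ends are moved. It is chosen at
  \<open>root y\<close> for the conjugated arrow, then carried back along the path to y, because
  \<open>gauge_arr\<close> inserts its correction before the conjugation.\<close>

definition lcorr :: "nat \<Rightarrow> nat \<Rightarrow> 'o1 \<Rightarrow> 'o1 \<Rightarrow> 'm1 \<Rightarrow> 'g1" where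
  "lcorr e e' y z p = (if e = 0 \<or> e' = 0 then \<one>\<^bsub>Grp Z y\<^esub> else
    Act Z (root y) y (Inv Z y (root y) (path y)) (correction (root y) (root z)
      (Comp Z (root y) z (root z) (path z) (Comp Z (root y) y z p (Inv Z y (root y) (path y))))))"

definition transport :: "nat \<Rightarrow> (nat \<Rightarrow> nat) \<Rightarrow> ('o1, 'm1, 'g1) system \<Rightarrow> ('o1, 'm1, 'g1) system" where
  "transport n \<tau> = (\<lambda>(g, p, a). let d = \<lambda>i k. lcorr (\<tau> i) (\<tau> k) (a i) (a k) (p i k) in cut_system n
    (\<lambda>i k l. cod.gauge_grp (a i) (a k) (lroot (\<tau> i) (a i)) (lpath (\<tau> i) (a i)) (p i k) (g i k l)
        (d i k) (d k l) (d i l),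
     \<lambda>i k. cod.gauge_arr (a i) (a k) (lroot (\<tau> i) (a i)) (lroot (\<tau> k) (a k))
        (lpath (\<tau> i) (a i)) (lpath (\<tau> k) (a k)) (p i k) (d i k),
     \<lambda>i. lroot (\<tau> i) (a i)))"

lemma transport_cut:
  "transport n \<tau> (cut_system n (g, p, a)) = transport n \<tau> (g, p, a)"
proof -
  have *: "cut_system n (g, p, a) = ((\<lambda>i j k. if i \<le> j \<and> j \<le> k \<and> k \<le> n then g i j k else undefined),
      (\<lambda>i j. if i \<le> j \<and> j \<le> n then p i j else undefined), (\<lambda>i. if i \<le> n then a i else undefined))"
    by (simp add: cut_system_def)
  show ?thesis
    unfolding transport_def Let_def * prod.case by (rule cut_system_cong) auto
qed

lemma lroot_closed: "z \<in> Obj Z \<Longrightarrow> lroot e z \<in> Obj Z"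
  by (simp add: lroot_def root_closed)

lemma lpath_closed: "z \<in> Obj Z \<Longrightarrow> lpath e z \<in> Arr Z z (lroot e z)"
  by (simp add: lroot_def lpath_def root_path cod.ident_closed)

lemma lcorr_closed:
  "\<lbrakk>y \<in> Obj Z; z \<in> Obj Z; p \<in> Arr Z y z\<rbrakk> \<Longrightarrow> lcorr e e' y z p \<in> carrier (Grp Z y)"
  by (simp add: lcorr_def cod.grp_one_closed root_closed root_path correction cod.act_closed
      cod.Inv_closed cod.comp_closed)

lemma ident_image_arr: "y \<in> on_obj j ` Obj W \<Longrightarrow> Ident Z y \<in> image_arr y y"
proof -
  assume "y \<in> on_obj j ` Obj W"
  then obtain w where "w \<in> Obj W" "y = on_obj j w" by blast
  then show ?thesis
    unfolding image_arr_def
    by (intro CollectI bexI[of _ w] bexI[of _ "Ident W w"]) (simp_all add: arr_ident dom.ident_closed)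
qed

text \<open>Conjugating an identity by a path gives an identity at the root. This lies in the image,
  so its correction is trivial.\<close>

lemma lcorr_ident: "y \<in> Obj Z \<Longrightarrow> lcorr e e y y (Ident Z y) = \<one>\<^bsub>Grp Z y\<^esub>"
  by (simp add: lcorr_def root_closed root_path cod.Inv_props cod.ident_left
      ident_image_arr correction_def cod.act_one)

lemma is_system_transport:
  assumes s: "is_system Z n g p a"
  defines "d \<equiv> \<lambda>\<tau> i k. lcorr (\<tau> i) (\<tau> k) (a i) (a k) (p i k)"
  shows "is_system Z n
    (\<lambda>i k l. cod.gauge_grp (a i) (a k) (lroot (\<tau> i) (a i)) (lpath (\<tau> i) (a i)) (p i k) (g i k l)
        (d \<tau> i k) (d \<tau> k l) (d \<tau> i l))
    (\<lambda>i k. cod.gauge_arr (a i) (a k) (lroot (\<tau> i) (a i)) (lroot (\<tau> k) (a k))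
        (lpath (\<tau> i) (a i)) (lpath (\<tau> k) (a k)) (p i k) (d \<tau> i k))
    (\<lambda>i. lroot (\<tau> i) (a i))"
  unfolding d_def
  by (rule cod.is_system_gauge[OF s])
    (simp_all add: is_systemD[OF s] lroot_closed lpath_closed lcorr_closed lcorr_ident)

lemma transport_closed: "x \<in> nerve_simplices Z n \<Longrightarrow> transport n \<tau> x \<in> nerve_simplices Z n"
  by (auto elim!: nerve_cases simp: transport_cut)
    (simp add: transport_def Let_def cut_system_mem_nerve is_system_transport)

text \<open>Each entry of the result depends on its indices only through the entries of the system
  and the levels found there. Reindexing before or after therefore gives the same
  expression.\<close>

lemma transport_natural:
  assumes "\<theta> \<in> delta m n" "x \<in> nerve_simplices Z n" "\<And>i. i \<le> m \<Longrightarrow> \<upsilon> i = \<tau> (\<theta> i)"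
  shows "transport m \<upsilon> (Op (nerve Z) m n \<theta> x) = Op (nerve Z) m n \<theta> (transport n \<tau> x)"
proof -
  obtain g p a where x: "x = cut_system n (g, p, a)"
    using assms(2) by (rule nerve_cases)
  show ?thesis
    unfolding x Op_nerve_cut[OF assms(1)] transport_cut
    unfolding transport_def Let_def prod.case Op_nerve_cut[OF assms(1)]
    by (rule cut_system_cong) (simp_all add: assms(3))
qed

lemma simplicial_homotopy_transport: "simplicial_homotopy (nerve Z) (nerve Z) transport"
  by (intro simplicial_homotopy.intro simplicial_homotopy_axioms.intro simplicial_set_nerve)
    (simp_all add: transport_closed transport_natural)

lemma transport_trivial:
  assumes s: "is_system Z n g p a"
    and "\<And>i. i \<le> n \<Longrightarrow> lroot (\<tau> i) (a i) = a i" "\<And>i. i \<le> n \<Longrightarrow> lpath (\<tau> i) (a i) = Ident Z (a i)"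
    and "\<And>i k. \<lbrakk>i \<le> k; k \<le> n\<rbrakk> \<Longrightarrow> lcorr (\<tau> i) (\<tau> k) (a i) (a k) (p i k) = \<one>\<^bsub>Grp Z (a i)\<^esub>"
  shows "transport n \<tau> (cut_system n (g, p, a)) = cut_system n (g, p, a)"
  unfolding transport_cut unfolding transport_def Let_def prod.case
  by (rule cut_system_cong)
    (simp_all add: assms(2-) is_systemD[OF s] cod.gauge_arr_trivial cod.gauge_grp_trivial)

lemma transport_0: "x \<in> nerve_simplices Z n \<Longrightarrow> transport n (\<lambda>_. 0) x = x"
  by (auto elim!: nerve_cases intro!: transport_trivial simp: lroot_def lpath_def lcorr_def)

lemma transport_1_nerve_map:
  assumes "x \<in> nerve_simplices W n"
  shows "transport n (\<lambda>_. 1) (nerve_map j n x) = nerve_map j n x"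
proof -
  obtain g p a where x: "x = cut_system n (g, p, a)" and s: "is_system W n g p a"
    using assms by (rule nerve_cases)
  note D = is_systemD[OF s] and D' = is_systemD[OF is_system_map[OF s]]
  have r: "root (on_obj j b) = on_obj j b" "path (on_obj j b) = Ident Z (on_obj j b)" if "b \<in> Obj W" for b
    using that by (auto simp: root_def path_def)
  have "on_arr j (a i) (a k) (p i k) \<in> image_arr (on_obj j (a i)) (on_obj j (a k))" if "i \<le> k" "k \<le> n" for i k
    using D(1)[of i] D(1)[of k] D(2)[OF that] that by (auto simp: image_arr_def)
  then show ?thesis
    unfolding x nerve_map_cut
    by (intro transport_trivial is_system_map s)
      (simp_all add: lroot_def lpath_def lcorr_def r D(1,2) D'(1,2) cod.Inv_ident cod.ident_left cod.ident_right
        correction_def cod.act_one cod.ident_closed)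
qed

text \<open>With both ends at level 1, the gauged edge is the conjugated edge q followed on the
  right by the boundary of its own correction, which is in the image by choice.
  \<open>nerve_lift\<close> supplies the rest.\<close>

lemma transport_1_image:
  assumes "x \<in> nerve_simplices Z n"
  shows "transport n (\<lambda>_. 1) x \<in> nerve_map j n ` nerve_simplices W n"
proof -
  obtain g p a where x: "x = cut_system n (g, p, a)" and s: "is_system Z n g p a"
    using assms by (rule nerve_cases)
  note D = is_systemD[OF s]
  have "cod.gauge_arr y z (root y) (root z) (path y) (path z) p (lcorr 1 1 y z p) \<in> image_arr (root y) (root z)"
    if y: "y \<in> Obj Z" and z: "z \<in> Obj Z" and p: "p \<in> Arr Z y z" for y z p
  proof -
    define q where "q = Comp Z (root y) z (root z) (path z) (Comp Z (root y) y z p (Inv Z y (root y) (path y)))"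
    have q: "q \<in> Arr Z (root y) (root z)"
      using y z p by (simp add: q_def root_closed root_path cod.gpd_simps)
    note e = correction[OF root_path(1)[OF y] root_path(1)[OF z] q]
    \<comment> \<open>The boundary of the element carried back along \<open>path y\<close> is a
      conjugate by that path; the conjugation in \<open>gauge_arr\<close> undoes it.\<close>
    have "cod.gauge_arr y z (root y) (root z) (path y) (path z) p (lcorr 1 1 y z p)
        = Comp Z (root y) (root y) (root z) q (Bdry Z (root y) (correction (root y) (root z) q))"
      using y z p e(1)
      by (simp add: cod.gauge_arr_def lcorr_def q_def[symmetric] root_closed root_path cod.xmod_simps)
        (simp add: q_def root_closed root_path cod.xmod_simps)
    then show ?thesis
      using e(2) by simp
  qed
  then show ?thesis
    unfolding x transport_cut unfolding transport_def Let_def prod.case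
    by (intro nerve_lift is_system_transport[OF s]) (simp_all add: lroot_def lpath_def D root_path)
qed

section \<open>The retraction of nerves and the homotopy equivalence\<close>

definition retract :: "nat \<Rightarrow> ('o1, 'm1, 'g1) system \<Rightarrow> ('o, 'm, 'g) system" where
  "retract n x = inv_into (nerve_simplices W n) (nerve_map j n) (transport n (\<lambda>_. 1) x)"

lemma retract:
  assumes "x \<in> nerve_simplices Z n"
  shows "retract n x \<in> nerve_simplices W n" "nerve_map j n (retract n x) = transport n (\<lambda>_. 1) x"
  using transport_1_image[OF assms] unfolding retract_def by (rule inv_into_into f_inv_into_f)+

text \<open>Naturality is checked after the injective map \<open>nerve_map j\<close>, where
  \<open>retract\<close> becomes the natural \<open>transport\<close> at level 1.\<close>

lemma simplicial_map_retract: "simplicial_map (nerve Z) (nerve W) retract"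
proof (intro simplicial_map.intro simplicial_set_nerve simplicial_map_axioms.intro)
  interpret N: simplicial_map "nerve W" "nerve Z" "nerve_map j"
    by (rule simplicial_map_nerve_map)
  fix m n \<theta> x assume \<theta>: "\<theta> \<in> delta m n" and x: "x \<in> Spx (nerve Z) n"
  have "nerve_map j m (retract m (Op (nerve Z) m n \<theta> x)) = Op (nerve Z) m n \<theta> (nerve_map j n (retract n x))"
    using \<theta> x N.cod.op_closed[OF \<theta> x] by (simp add: retract transport_natural)
  also have "\<dots> = nerve_map j m (Op (nerve W) m n \<theta> (retract n x))"
    using \<theta> x by (simp add: N.map_natural retract)
  finally show "retract m (Op (nerve Z) m n \<theta> x) = Op (nerve W) m n \<theta> (retract n x)"
    using \<theta> x N.cod.op_closed[OF \<theta> x] N.dom.op_closed[OF \<theta>, of "retract n x"]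
    by (auto intro!: inj_onD[OF inj_nerve_map[of m]] simp: retract)
qed (simp add: retract)

text \<open>One composite is the identity on the nose, so its homotopy is constant; the other is the
  realization of \<open>transport\<close> at level 1, which is homotopic to its value at level
  0.\<close>

theorem homotopy_equivalence_classifying_map:
  "homotopy_equivalence (classifying_space W) (classifying_space Z) (classifying_map Z j)"
proof -
  interpret J: simplicial_map "nerve W" "nerve Z" "nerve_map j"
    by (rule simplicial_map_nerve_map)
  interpret R: simplicial_map "nerve Z" "nerve W" retract
    by (rule simplicial_map_retract)
  interpret H: simplicial_homotopy "nerve Z" "nerve Z" transport
    by (rule simplicial_homotopy_transport)
  let ?J = "realization_map (nerve Z) (nerve_map j)" and ?R = "realization_map (nerve W) retract"
  have id: "simplicial_map (nerve Z) (nerve Z) (\<lambda>n x. x)"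
    by unfold_locales auto
  have T: "simplicial_map (nerve Z) (nerve Z) (\<lambda>n. transport n (\<lambda>_. 1))"
    by unfold_locales (simp_all add: transport_closed transport_natural)
  have RJ: "(?R \<circ> ?J) y = id y" if y: "y \<in> topspace (realization (nerve W))" for y
  proof -
    from y obtain n x t where x: "x \<in> nerve_simplices W n" and y: "y = point (nerve W) ((n, x), t)"
      by (auto simp: topspace_realization topspace_cells)
    have "nerve_map j n (retract n (nerve_map j n x)) = nerve_map j n x"
      using x J.map_closed[of x n] by (simp add: retract transport_1_nerve_map del: One_nat_def)
    then have "retract n (nerve_map j n x) = x"
      using x J.map_closed[of x n] by (auto intro!: inj_onD[OF inj_nerve_map] simp: retract)
    then show ?thesis
      by (simp add: y J.realization_map_point R.realization_map_point)
  qed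
  have JR: "realization_map (nerve Z) (\<lambda>n. transport n (\<lambda>_. 1)) y = (?J \<circ> ?R) y"
      "realization_map (nerve Z) (\<lambda>n x. x) y = id y" if y: "y \<in> topspace (realization (nerve Z))" for y
  proof -
    from y obtain n x t where x: "x \<in> nerve_simplices Z n" and y: "y = point (nerve Z) ((n, x), t)"
      by (auto simp: topspace_realization topspace_cells)
    then show "realization_map (nerve Z) (\<lambda>n. transport n (\<lambda>_. 1)) y = (?J \<circ> ?R) y"
      "realization_map (nerve Z) (\<lambda>n x. x) y = id y"
      by (simp_all add: J.realization_map_point R.realization_map_point retract
          simplicial_map.realization_map_point[OF T] simplicial_map.realization_map_point[OF id]
          del: One_nat_def)
  qed
  have "homotopic_with (\<lambda>_. True) (realization (nerve Z)) (realization (nerve Z))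
      (realization_map (nerve Z) (\<lambda>n. transport n (\<lambda>_. 1))) (realization_map (nerve Z) (\<lambda>n x. x))"
    by (rule H.homotopic_realization_maps[OF id T]) (simp_all add: transport_0)
  then have "homotopic_with (\<lambda>_. True) (realization (nerve Z)) (realization (nerve Z)) (?J \<circ> ?R) id"
    by (rule homotopic_with_eq) (simp_all only: JR)
  moreover have "homotopic_with (\<lambda>_. True) (realization (nerve W)) (realization (nerve W)) (?R \<circ> ?J) id"
    by (rule homotopic_with_equal)
      (simp_all only: RJ continuous_map_compose[OF J.continuous_map_realization_map R.continuous_map_realization_map])
  ultimately show ?thesis
    using J.continuous_map_realization_map R.continuous_map_realization_map
    unfolding homotopy_equivalence_def classifying_space_def classifying_map_def by blast
qed

end


section \<open>The homotopy pullback\<close>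

locale cospan = f: xmod_morphism X Y f + f': xmod_morphism X' Y f'
  for X :: "('o, 'm, 'g) xmod" and X' :: "('o2, 'm2, 'g2) xmod" and Y :: "('o1, 'm1, 'g1) xmod"
    and f f'
begin

abbreviation "F \<equiv> on_obj f"
abbreviation "F' \<equiv> on_obj f'"
abbreviation "H \<equiv> xmod_hpullback f f' X X' Y"
abbreviation "W \<equiv> xmod_pullback f f' X X'"

lemma hp_Obj: "(a, q, a') \<in> Obj H \<longleftrightarrow> a \<in> Obj X \<and> a' \<in> Obj X' \<and> q \<in> Arr Y (F a) (F' a')"
  by (simp add: xmod_hpullback_def)

lemma hp_Arr:
  "(p, h, p') \<in> Arr H (a0, q0, a0') (a1, q1, a1') \<longleftrightarrow>
    p \<in> Arr X a0 a1 \<and> p' \<in> Arr X' a0' a1' \<and> h \<in> carrier (Grp Y (F a0)) \<and>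
    Bdry Y (F a0) h = Comp Y (F a0) (F a1) (F a0) (Inv Y (F a0) (F a1) (on_arr f a0 a1 p))
      (Comp Y (F a0) (F' a1') (F a1) (Inv Y (F a1) (F' a1') q1)
        (Comp Y (F a0) (F' a0') (F' a1') (on_arr f' a0' a1' p') q0))"
  by (simp add: xmod_hpullback_def Let_def)

lemma hp_ops:
  "Comp H (a0, q0, a0') (a1, q1, a1') (a2, q2, a2') (p2, h2, p2') (p1, h1, p1') =
    (Comp X a0 a1 a2 p2 p1,
      Act Y (F a1) (F a0) (Inv Y (F a0) (F a1) (on_arr f a0 a1 p1)) h2 \<otimes>\<^bsub>Grp Y (F a0)\<^esub> h1,
      Comp X' a0' a1' a2' p2' p1')"
  "Ident H (a, q, a') = (Ident X a, \<one>\<^bsub>Grp Y (F a)\<^esub>, Ident X' a')"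
  "Grp H (a, q, a') = Grp X a \<times>\<times> Grp X' a'"
  "Act H (a0, q0, a0') (a1, q1, a1') (p, h, p') (g, g') = (Act X a0 a1 p g, Act X' a0' a1' p' g')"
  "Bdry H (a, q, a') (g, g') = (Bdry X a g,
    on_grp f a (inv\<^bsub>Grp X a\<^esub> g) \<otimes>\<^bsub>Grp Y (F a)\<^esub> Act Y (F' a') (F a) (Inv Y (F a) (F' a') q) (on_grp f' a' g'),
    Bdry X' a' g')"
  by (simp_all add: xmod_hpullback_def Let_def)

text \<open>Group laws with the object as a parameter, so that rewriting can use them in all groups
  of \<open>Y\<close> at once.\<close>

lemma Y_assoc:
  "\<lbrakk>b \<in> Obj Y; x \<in> carrier (Grp Y b); y \<in> carrier (Grp Y b); z \<in> carrier (Grp Y b)\<rbrakk>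
    \<Longrightarrow> x \<otimes>\<^bsub>Grp Y b\<^esub> y \<otimes>\<^bsub>Grp Y b\<^esub> z = x \<otimes>\<^bsub>Grp Y b\<^esub> (y \<otimes>\<^bsub>Grp Y b\<^esub> z)"
  by (meson f.cod.group_Grp group.is_monoid monoid.m_assoc)

lemma Y_cancel:
  assumes "b \<in> Obj Y" "x \<in> carrier (Grp Y b)"
  shows "x \<otimes>\<^bsub>Grp Y b\<^esub> inv\<^bsub>Grp Y b\<^esub> x = \<one>\<^bsub>Grp Y b\<^esub>" "inv\<^bsub>Grp Y b\<^esub> x \<otimes>\<^bsub>Grp Y b\<^esub> x = \<one>\<^bsub>Grp Y b\<^esub>"
    "x \<otimes>\<^bsub>Grp Y b\<^esub> \<one>\<^bsub>Grp Y b\<^esub> = x" "\<one>\<^bsub>Grp Y b\<^esub> \<otimes>\<^bsub>Grp Y b\<^esub> x = x"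
    "inv\<^bsub>Grp Y b\<^esub> (inv\<^bsub>Grp Y b\<^esub> x) = x" "inv\<^bsub>Grp Y b\<^esub> \<one>\<^bsub>Grp Y b\<^esub> = \<one>\<^bsub>Grp Y b\<^esub>"
    "y \<in> carrier (Grp Y b) \<Longrightarrow> x \<otimes>\<^bsub>Grp Y b\<^esub> (inv\<^bsub>Grp Y b\<^esub> x \<otimes>\<^bsub>Grp Y b\<^esub> y) = y"
    "y \<in> carrier (Grp Y b) \<Longrightarrow> inv\<^bsub>Grp Y b\<^esub> x \<otimes>\<^bsub>Grp Y b\<^esub> (x \<otimes>\<^bsub>Grp Y b\<^esub> y) = y"
    "y \<in> carrier (Grp Y b) \<Longrightarrow> inv\<^bsub>Grp Y b\<^esub> (x \<otimes>\<^bsub>Grp Y b\<^esub> y) = inv\<^bsub>Grp Y b\<^esub> y \<otimes>\<^bsub>Grp Y b\<^esub> inv\<^bsub>Grp Y b\<^esub> x"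
proof -
  interpret group "Grp Y b" using assms(1) by (rule f.cod.group_Grp)
  show "x \<otimes>\<^bsub>Grp Y b\<^esub> inv\<^bsub>Grp Y b\<^esub> x = \<one>\<^bsub>Grp Y b\<^esub>" "inv\<^bsub>Grp Y b\<^esub> x \<otimes>\<^bsub>Grp Y b\<^esub> x = \<one>\<^bsub>Grp Y b\<^esub>"
    "x \<otimes>\<^bsub>Grp Y b\<^esub> \<one>\<^bsub>Grp Y b\<^esub> = x" "\<one>\<^bsub>Grp Y b\<^esub> \<otimes>\<^bsub>Grp Y b\<^esub> x = x"
    "inv\<^bsub>Grp Y b\<^esub> (inv\<^bsub>Grp Y b\<^esub> x) = x" "inv\<^bsub>Grp Y b\<^esub> \<one>\<^bsub>Grp Y b\<^esub> = \<one>\<^bsub>Grp Y b\<^esub>"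
    "y \<in> carrier (Grp Y b) \<Longrightarrow> x \<otimes>\<^bsub>Grp Y b\<^esub> (inv\<^bsub>Grp Y b\<^esub> x \<otimes>\<^bsub>Grp Y b\<^esub> y) = y"
    "y \<in> carrier (Grp Y b) \<Longrightarrow> inv\<^bsub>Grp Y b\<^esub> x \<otimes>\<^bsub>Grp Y b\<^esub> (x \<otimes>\<^bsub>Grp Y b\<^esub> y) = y"
    "y \<in> carrier (Grp Y b) \<Longrightarrow> inv\<^bsub>Grp Y b\<^esub> (x \<otimes>\<^bsub>Grp Y b\<^esub> y) = inv\<^bsub>Grp Y b\<^esub> y \<otimes>\<^bsub>Grp Y b\<^esub> inv\<^bsub>Grp Y b\<^esub> x"
    using assms(2) by (simp_all add: inv_mult_group)
qed

lemmas calc = f.map_simps f'.map_simps f.dom.xmod_simps f'.dom.xmod_simps f.cod.xmod_simps Y_assoc Y_cancel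

text \<open>The boundary of the middle component telescopes: after cancelling the image of
  \<open>p1\<close>, the arrow \<open>q1\<close> ending one condition meets its inverse in the
  other.\<close>

lemma hp_comp_closed:
  assumes "(a0, q0, a0') \<in> Obj H" "(a1, q1, a1') \<in> Obj H" "(a2, q2, a2') \<in> Obj H"
    and "(p1, h1, p1') \<in> Arr H (a0, q0, a0') (a1, q1, a1')" "(p2, h2, p2') \<in> Arr H (a1, q1, a1') (a2, q2, a2')"
  shows "Comp H (a0, q0, a0') (a1, q1, a1') (a2, q2, a2') (p2, h2, p2') (p1, h1, p1') \<in> Arr H (a0, q0, a0') (a2, q2, a2')"
  using assms unfolding hp_ops hp_Obj hp_Arr by (simp add: calc)

lemma hp_assoc:
  assumes "(a0, q0, a0') \<in> Obj H" "(a1, q1, a1') \<in> Obj H" "(a2, q2, a2') \<in> Obj H" "(a3, q3, a3') \<in> Obj H"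
    and "(p1, h1, p1') \<in> Arr H (a0, q0, a0') (a1, q1, a1')" "(p2, h2, p2') \<in> Arr H (a1, q1, a1') (a2, q2, a2')"
      "(p3, h3, p3') \<in> Arr H (a2, q2, a2') (a3, q3, a3')"
  shows "Comp H (a0, q0, a0') (a2, q2, a2') (a3, q3, a3') (p3, h3, p3')
      (Comp H (a0, q0, a0') (a1, q1, a1') (a2, q2, a2') (p2, h2, p2') (p1, h1, p1'))
    = Comp H (a0, q0, a0') (a1, q1, a1') (a3, q3, a3')
      (Comp H (a1, q1, a1') (a2, q2, a2') (a3, q3, a3') (p3, h3, p3') (p2, h2, p2')) (p1, h1, p1')"
  using assms unfolding hp_ops hp_Obj hp_Arr by (simp add: calc f.cod.act_comp)

lemma hp_inverse:
  assumes "(a0, q0, a0') \<in> Obj H" "(a1, q1, a1') \<in> Obj H" "(p, h, p') \<in> Arr H (a0, q0, a0') (a1, q1, a1')"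
  shows "\<exists>q\<in>Arr H (a1, q1, a1') (a0, q0, a0').
    Comp H (a0, q0, a0') (a1, q1, a1') (a0, q0, a0') q (p, h, p') = Ident H (a0, q0, a0') \<and>
    Comp H (a1, q1, a1') (a0, q0, a0') (a1, q1, a1') (p, h, p') q = Ident H (a1, q1, a1')"
proof
  \<comment> \<open>The middle entry is forced: translated back along the image of p, it must cancel
    h.\<close>
  let ?q = "(Inv X a0 a1 p, Act Y (F a0) (F a1) (on_arr f a0 a1 p) (inv\<^bsub>Grp Y (F a0)\<^esub> h), Inv X' a0' a1' p')"
  show "?q \<in> Arr H (a1, q1, a1') (a0, q0, a0')"
    using assms unfolding hp_Obj hp_Arr by (simp add: calc)
  show "Comp H (a0, q0, a0') (a1, q1, a1') (a0, q0, a0') ?q (p, h, p') = Ident H (a0, q0, a0') \<and>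
    Comp H (a1, q1, a1') (a0, q0, a0') (a1, q1, a1') (p, h, p') ?q = Ident H (a1, q1, a1')"
    using assms unfolding hp_ops hp_Obj hp_Arr by (simp add: calc f.cod.act_inv_cancel)
qed

lemma groupoid_hp: "groupoid H"
proof
  show "Comp H a b c q p \<in> Arr H a c"
    if "a \<in> Obj H" "b \<in> Obj H" "c \<in> Obj H" "p \<in> Arr H a b" "q \<in> Arr H b c" for a b c p q
    using that by (cases a; cases b; cases c; cases p; cases q) (simp only: hp_comp_closed)
  show "Ident H a \<in> Arr H a a" if "a \<in> Obj H" for a
    using that by (cases a) (simp add: hp_ops hp_Obj hp_Arr calc)
  show "Comp H a c d r (Comp H a b c q p) = Comp H a b d (Comp H b c d r q) p"
    if "a \<in> Obj H" "b \<in> Obj H" "c \<in> Obj H" "d \<in> Obj H" "p \<in> Arr H a b" "q \<in> Arr H b c" "r \<in> Arr H c d"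
    for a b c d p q r
    using that by (cases a; cases b; cases c; cases d; cases p; cases q; cases r) (simp only: hp_assoc)
  show "Comp H a b b (Ident H b) p = p" if "a \<in> Obj H" "b \<in> Obj H" "p \<in> Arr H a b" for a b p
    using that by (cases a; cases b; cases p) (simp add: hp_ops hp_Obj hp_Arr calc)
  show "Comp H a a b p (Ident H a) = p" if "a \<in> Obj H" "b \<in> Obj H" "p \<in> Arr H a b" for a b p
    using that by (cases a; cases b; cases p) (simp add: hp_ops hp_Obj hp_Arr calc)
  show "\<exists>q\<in>Arr H b a. Comp H a b a q p = Ident H a \<and> Comp H b a b p q = Ident H b"
    if "a \<in> Obj H" "b \<in> Obj H" "p \<in> Arr H a b" for a b p
    using that by (cases a; cases b; cases p) (simp only: hp_inverse)
qed

lemma hp_bdry_closed: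
  assumes "(a, q, a') \<in> Obj H" "(g, g') \<in> carrier (Grp H (a, q, a'))"
  shows "Bdry H (a, q, a') (g, g') \<in> Arr H (a, q, a') (a, q, a')"
  using assms unfolding hp_ops hp_Obj hp_Arr by (simp add: calc)

text \<open>Composition in \<open>H\<close> acts by the inverse of the image of the first arrow.
  When that arrow is a boundary, the Peiffer identity turns the action into conjugation, which is
  how boundaries in \<open>H\<close> are multiplied.\<close>

lemma act_bdry_f:
  "\<lbrakk>a \<in> Obj X; g \<in> carrier (Grp X a); h \<in> carrier (Grp Y (F a))\<rbrakk>
    \<Longrightarrow> Act Y (F a) (F a) (Inv Y (F a) (F a) (on_arr f a a (Bdry X a g))) h
      = inv\<^bsub>Grp Y (F a)\<^esub> on_grp f a g \<otimes>\<^bsub>Grp Y (F a)\<^esub> (h \<otimes>\<^bsub>Grp Y (F a)\<^esub> on_grp f a g)"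
  using f.cod.peiffer[of "F a" "inv\<^bsub>Grp Y (F a)\<^esub> on_grp f a g" h]
  by (simp add: calc)

lemma hp_bdry_mult:
  assumes "(a, q, a') \<in> Obj H" "(g, g') \<in> carrier (Grp H (a, q, a'))" "(k, k') \<in> carrier (Grp H (a, q, a'))"
  shows "Bdry H (a, q, a') (g \<otimes>\<^bsub>Grp X a\<^esub> k, g' \<otimes>\<^bsub>Grp X' a'\<^esub> k')
    = Comp H (a, q, a') (a, q, a') (a, q, a') (Bdry H (a, q, a') (g, g')) (Bdry H (a, q, a') (k, k'))"
  using assms unfolding hp_ops hp_Obj by (simp add: calc act_bdry_f)

text \<open>The outer components are naturality in \<open>X\<close> and \<open>X'\<close>. The
  content is the middle one, where the two routes from \<open>F' a0'\<close> to \<open>F a0\<close>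
  differ by the boundary of h.\<close>

lemma hp_bdry_natural:
  assumes o: "(a0, q0, a0') \<in> Obj H" "(a1, q1, a1') \<in> Obj H"
    and p: "(p, h, p') \<in> Arr H (a0, q0, a0') (a1, q1, a1')"
    and g: "(g, g') \<in> carrier (Grp H (a0, q0, a0'))"
  shows "Bdry H (a1, q1, a1') (Act H (a0, q0, a0') (a1, q1, a1') (p, h, p') (g, g'))
    = Conj H (a0, q0, a0') (a1, q1, a1') (p, h, p') (Bdry H (a0, q0, a0') (g, g'))"
proof -
  interpret H: groupoid H by (rule groupoid_hp)
  have b: "Bdry H (a0, q0, a0') (g, g') \<in> Arr H (a0, q0, a0') (a0, q0, a0')"
    by (rule hp_bdry_closed[OF o(1) g])
  have "(Act X a0 a1 p g, Act X' a0' a1' p' g') \<in> carrier (Grp H (a1, q1, a1'))"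
    using assms unfolding hp_ops hp_Obj hp_Arr by (simp add: calc)
  from hp_bdry_closed[OF o(2) this]
  have b': "Bdry H (a1, q1, a1') (Act H (a0, q0, a0') (a1, q1, a1') (p, h, p') (g, g'))
      \<in> Arr H (a1, q1, a1') (a1, q1, a1')"
    by (simp add: hp_ops)
  let ?y = "on_grp f' a0' g'"
  have mem: "a0 \<in> Obj X" "a0' \<in> Obj X'" "q0 \<in> Arr Y (F a0) (F' a0')"
      "a1 \<in> Obj X" "a1' \<in> Obj X'" "q1 \<in> Arr Y (F a1) (F' a1')"
      "p \<in> Arr X a0 a1" "p' \<in> Arr X' a0' a1'" "h \<in> carrier (Grp Y (F a0))"
      "g \<in> carrier (Grp X a0)" "g' \<in> carrier (Grp X' a0')"
    and h: "Bdry Y (F a0) h = Comp Y (F a0) (F a1) (F a0) (Inv Y (F a0) (F a1) (on_arr f a0 a1 p))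
      (Comp Y (F a0) (F' a1') (F a1) (Inv Y (F a1) (F' a1') q1)
        (Comp Y (F a0) (F' a0') (F' a1') (on_arr f' a0' a1' p') q0))"
    using assms unfolding hp_ops hp_Obj hp_Arr by auto
  \<comment> \<open>Going around through \<open>q1\<close> instead of back along \<open>q0\<close>
    is acting by the boundary of h, by the condition on arrows of \<open>H\<close>; by Peiffer it is
    conjugation by h.\<close>
  have "Act Y (F a1) (F a0) (Inv Y (F a0) (F a1) (on_arr f a0 a1 p))
        (Act Y (F' a1') (F a1) (Inv Y (F a1) (F' a1') q1) (Act Y (F' a0') (F' a1') (on_arr f' a0' a1' p') ?y))
      = Act Y (F a0) (F a0) (Bdry Y (F a0) h) (Act Y (F' a0') (F a0) (Inv Y (F a0) (F' a0') q0) ?y)"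
    unfolding h using mem
    by (simp add: f.map_simps f'.map_simps f.cod.gpd_simps f.cod.act_comp[symmetric])
  also have "\<dots> = h \<otimes>\<^bsub>Grp Y (F a0)\<^esub> Act Y (F' a0') (F a0) (Inv Y (F a0) (F' a0') q0) ?y
      \<otimes>\<^bsub>Grp Y (F a0)\<^esub> inv\<^bsub>Grp Y (F a0)\<^esub> h"
    using mem by (intro f.cod.peiffer) (simp_all add: calc)
  finally have "Comp H (a0, q0, a0') (a1, q1, a1') (a1, q1, a1')
        (Bdry H (a1, q1, a1') (Act H (a0, q0, a0') (a1, q1, a1') (p, h, p') (g, g'))) (p, h, p')
      = Comp H (a0, q0, a0') (a0, q0, a0') (a1, q1, a1') (p, h, p') (Bdry H (a0, q0, a0') (g, g'))"
    unfolding hp_ops using mem by (simp add: calc act_bdry_f f.cod.act_inv_cancel)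
  with o p b b' show ?thesis
    by (intro H.Conj_eqI)
qed

lemma crossed_module_hp: "crossed_module H"
proof (intro crossed_module.intro groupoid_hp crossed_module_axioms.intro)
  show grp: "group (Grp H a)" if "a \<in> Obj H" for a
    using that by (cases a) (simp add: hp_ops hp_Obj DirProd_group f.dom.group_Grp f'.dom.group_Grp)
  show "Act H a b p \<in> hom (Grp H a) (Grp H b)" if "a \<in> Obj H" "b \<in> Obj H" "p \<in> Arr H a b" for a b p
    using that by (cases a; cases b; cases p)
      (auto simp: hom_def hp_ops hp_Obj hp_Arr f.dom.xmod_simps f'.dom.xmod_simps)
  show "Act H a a (Ident H a) g = g" if "a \<in> Obj H" "g \<in> carrier (Grp H a)" for a g
    using that by (cases a; cases g) (auto simp: hp_ops hp_Obj f.dom.act_ident f'.dom.act_ident)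
  show "Act H a c (Comp H a b c q p) g = Act H b c q (Act H a b p g)"
    if "a \<in> Obj H" "b \<in> Obj H" "c \<in> Obj H" "p \<in> Arr H a b" "q \<in> Arr H b c" "g \<in> carrier (Grp H a)"
    for a b c p q g
    using that by (cases a; cases b; cases c; cases p; cases q; cases g)
      (auto simp: hp_ops hp_Obj hp_Arr f.dom.act_comp f'.dom.act_comp)
  show "Bdry H a \<in> hom (Grp H a) (Aut H a)" if "a \<in> Obj H" for a
  proof (cases a)
    case [simp]: (fields a0 q a0')
    show ?thesis
      unfolding hom_def Aut_def using that hp_bdry_closed[of a0 q a0'] hp_bdry_mult[of a0 q a0']
      by (auto simp: hp_ops(3))
  qed
  show "Bdry H b (Act H a b p g) = Conj H a b p (Bdry H a g)"
    if "a \<in> Obj H" "b \<in> Obj H" "p \<in> Arr H a b" "g \<in> carrier (Grp H a)" for a b p g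
    using that by (cases a; cases b; cases p; cases g) (simp only: hp_bdry_natural)
  show "Act H a a (Bdry H a g) k = g \<otimes>\<^bsub>Grp H a\<^esub> k \<otimes>\<^bsub>Grp H a\<^esub> inv\<^bsub>Grp H a\<^esub> g"
    if "a \<in> Obj H" "g \<in> carrier (Grp H a)" "k \<in> carrier (Grp H a)" for a g k
    using that by (cases a; cases g; cases k)
      (auto simp: hp_ops hp_Obj f.dom.peiffer f'.dom.peiffer f.dom.group_Grp f'.dom.group_Grp inv_DirProd)
qed


section \<open>The strict pullback and the canonical morphism\<close>

lemma pb_Obj: "(a, a') \<in> Obj W \<longleftrightarrow> a \<in> Obj X \<and> a' \<in> Obj X' \<and> F a = F' a'"
  by (simp add: xmod_pullback_def)

lemma pb_Arr:
  "(p, p') \<in> Arr W (a, a') (b, b') \<longleftrightarrow> p \<in> Arr X a b \<and> p' \<in> Arr X' a' b' \<and> on_arr f a b p = on_arr f' a' b' p'"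
  by (simp add: xmod_pullback_def)

lemma pb_carrier:
  "(g, g') \<in> carrier (Grp W (a, a')) \<longleftrightarrow>
    g \<in> carrier (Grp X a) \<and> g' \<in> carrier (Grp X' a') \<and> on_grp f a g = on_grp f' a' g'"
  by (simp add: xmod_pullback_def)

lemma pb_ops:
  "Comp W (a, a') (b, b') (c, c') (q, q') (p, p') = (Comp X a b c q p, Comp X' a' b' c' q' p')"
  "Ident W (a, a') = (Ident X a, Ident X' a')"
  "(g, g') \<otimes>\<^bsub>Grp W (a, a')\<^esub> (k, k') = (g \<otimes>\<^bsub>Grp X a\<^esub> k, g' \<otimes>\<^bsub>Grp X' a'\<^esub> k')"
  "\<one>\<^bsub>Grp W (a, a')\<^esub> = (\<one>\<^bsub>Grp X a\<^esub>, \<one>\<^bsub>Grp X' a'\<^esub>)"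
  "Act W (a, a') (b, b') (p, p') (g, g') = (Act X a b p g, Act X' a' b' p' g')"
  "Bdry W (a, a') (g, g') = (Bdry X a g, Bdry X' a' g')"
  by (simp_all add: xmod_pullback_def DirProd_def)

text \<open>This is the part of the product on which two homomorphisms to a group of
  \<open>Y\<close> agree; the group axioms of the pullback are inherited from it through
  \<open>pb_Grp\<close>.\<close>

lemma subgroup_pb:
  assumes "a \<in> Obj X" "a' \<in> Obj X'" "F a = F' a'"
  shows "subgroup (carrier (Grp W (a, a'))) (Grp X a \<times>\<times> Grp X' a')"
proof (rule group.subgroupI)
  show G: "group (Grp X a \<times>\<times> Grp X' a')"
    using assms by (simp add: DirProd_group f.dom.group_Grp f'.dom.group_Grp)
  have "(\<one>\<^bsub>Grp X a\<^esub>, \<one>\<^bsub>Grp X' a'\<^esub>) \<in> carrier (Grp W (a, a'))"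
    using assms by (simp add: pb_carrier calc)
  then show "carrier (Grp W (a, a')) \<noteq> {}" by blast
  show "carrier (Grp W (a, a')) \<subseteq> carrier (Grp X a \<times>\<times> Grp X' a')"
    by (auto simp: pb_carrier)
  show "inv\<^bsub>Grp X a \<times>\<times> Grp X' a'\<^esub> x \<in> carrier (Grp W (a, a'))" if "x \<in> carrier (Grp W (a, a'))" for x
    using assms that
    by (cases x) (simp add: pb_carrier calc inv_DirProd f.dom.group_Grp f'.dom.group_Grp)
  show "x \<otimes>\<^bsub>Grp X a \<times>\<times> Grp X' a'\<^esub> y \<in> carrier (Grp W (a, a'))"
    if "x \<in> carrier (Grp W (a, a'))" "y \<in> carrier (Grp W (a, a'))" for x y
    using assms that by (cases x; cases y) (simp add: pb_carrier calc)
qed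

lemma pb_Grp: "Grp W (a, a') = (Grp X a \<times>\<times> Grp X' a') \<lparr>carrier := carrier (Grp W (a, a'))\<rparr>"
  by (simp add: xmod_pullback_def)

lemma group_pb: "a \<in> Obj W \<Longrightarrow> group (Grp W a)"
  by (cases a) (metis pb_Grp pb_Obj subgroup_pb subgroup.subgroup_is_group DirProd_group f.dom.group_Grp f'.dom.group_Grp)

lemma pb_inv:
  assumes "(a, a') \<in> Obj W" "(g, g') \<in> carrier (Grp W (a, a'))"
  shows "inv\<^bsub>Grp W (a, a')\<^esub> (g, g') = (inv\<^bsub>Grp X a\<^esub> g, inv\<^bsub>Grp X' a'\<^esub> g')"
proof -
  interpret group "Grp W (a, a')"
    using assms(1) by (rule group_pb)
  show ?thesis
    using assms group.l_inv[OF f.dom.group_Grp, of a g] group.l_inv[OF f'.dom.group_Grp, of a' g']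
    by (intro inv_equality) (simp_all add: pb_carrier pb_Obj pb_ops calc)
qed

lemma pb_inverse:
  assumes "(a, a') \<in> Obj W" "(b, b') \<in> Obj W" "(p, p') \<in> Arr W (a, a') (b, b')"
  shows "(Inv X a b p, Inv X' a' b' p') \<in> Arr W (b, b') (a, a')"
    "Comp W (a, a') (b, b') (a, a') (Inv X a b p, Inv X' a' b' p') (p, p') = Ident W (a, a')"
    "Comp W (b, b') (a, a') (b, b') (p, p') (Inv X a b p, Inv X' a' b' p') = Ident W (b, b')"
  using assms by (simp_all add: pb_Obj pb_Arr pb_ops calc)

lemma groupoid_pb: "groupoid W"
proof
  show "Comp W a b c q p \<in> Arr W a c"
    if "a \<in> Obj W" "b \<in> Obj W" "c \<in> Obj W" "p \<in> Arr W a b" "q \<in> Arr W b c" for a b c p q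
    using that by (cases a; cases b; cases c; cases p; cases q) (simp add: pb_ops pb_Obj pb_Arr calc)
  show "Ident W a \<in> Arr W a a" if "a \<in> Obj W" for a
    using that by (cases a) (simp add: pb_ops pb_Obj pb_Arr calc)
  show "Comp W a c d r (Comp W a b c q p) = Comp W a b d (Comp W b c d r q) p"
    if "a \<in> Obj W" "b \<in> Obj W" "c \<in> Obj W" "d \<in> Obj W" "p \<in> Arr W a b" "q \<in> Arr W b c" "r \<in> Arr W c d"
    for a b c d p q r
    using that by (cases a; cases b; cases c; cases d; cases p; cases q; cases r)
      (simp add: pb_ops pb_Obj pb_Arr calc)
  show "Comp W a b b (Ident W b) p = p" if "a \<in> Obj W" "b \<in> Obj W" "p \<in> Arr W a b" for a b p
    using that by (cases a; cases b; cases p) (simp add: pb_ops pb_Obj pb_Arr calc)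
  show "Comp W a a b p (Ident W a) = p" if "a \<in> Obj W" "b \<in> Obj W" "p \<in> Arr W a b" for a b p
    using that by (cases a; cases b; cases p) (simp add: pb_ops pb_Obj pb_Arr calc)
  show "\<exists>q\<in>Arr W b a. Comp W a b a q p = Ident W a \<and> Comp W b a b p q = Ident W b"
    if "a \<in> Obj W" "b \<in> Obj W" "p \<in> Arr W a b" for a b p
    using that pb_inverse by (cases a; cases b; cases p) blast
qed

lemma pb_Inv:
  assumes "(a, a') \<in> Obj W" "(b, b') \<in> Obj W" "(p, p') \<in> Arr W (a, a') (b, b')"
  shows "Inv W (a, a') (b, b') (p, p') = (Inv X a b p, Inv X' a' b' p')"
  by (rule groupoid.Inv_eqI[OF groupoid_pb assms pb_inverse[OF assms]])

lemma crossed_module_pb: "crossed_module W"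
proof (intro crossed_module.intro groupoid_pb crossed_module_axioms.intro)
  show "group (Grp W a)" if "a \<in> Obj W" for a
    using that by (rule group_pb)
  show "Act W a b p \<in> hom (Grp W a) (Grp W b)" if "a \<in> Obj W" "b \<in> Obj W" "p \<in> Arr W a b" for a b p
    using that by (cases a; cases b; cases p)
      (auto simp: hom_def pb_ops pb_Obj pb_Arr pb_carrier calc)
  show "Act W a a (Ident W a) g = g" if "a \<in> Obj W" "g \<in> carrier (Grp W a)" for a g
    using that by (cases a; cases g) (auto simp: pb_ops pb_Obj pb_carrier f.dom.act_ident f'.dom.act_ident)
  show "Act W a c (Comp W a b c q p) g = Act W b c q (Act W a b p g)"
    if "a \<in> Obj W" "b \<in> Obj W" "c \<in> Obj W" "p \<in> Arr W a b" "q \<in> Arr W b c" "g \<in> carrier (Grp W a)"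
    for a b c p q g
    using that by (cases a; cases b; cases c; cases p; cases q; cases g)
      (auto simp: pb_ops pb_Obj pb_Arr pb_carrier f.dom.act_comp f'.dom.act_comp)
  show "Bdry W a \<in> hom (Grp W a) (Aut W a)" if "a \<in> Obj W" for a
    using that f.bdry_compat[symmetric] f'.bdry_compat[symmetric] by (cases a)
      (auto simp: hom_def Aut_def pb_ops pb_Obj pb_Arr pb_carrier f.dom.xmod_simps f'.dom.xmod_simps)
  show "Bdry W b (Act W a b p g) = Conj W a b p (Bdry W a g)"
    if "a \<in> Obj W" "b \<in> Obj W" "p \<in> Arr W a b" "g \<in> carrier (Grp W a)" for a b p g
    using that by (cases a; cases b; cases p; cases g)
      (auto simp: pb_ops pb_Obj pb_Arr pb_carrier Conj_def pb_Inv f.dom.bdry_act f'.dom.bdry_act)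
  show "Act W a a (Bdry W a g) k = g \<otimes>\<^bsub>Grp W a\<^esub> k \<otimes>\<^bsub>Grp W a\<^esub> inv\<^bsub>Grp W a\<^esub> g"
    if "a \<in> Obj W" "g \<in> carrier (Grp W a)" "k \<in> carrier (Grp W a)" for a g k
    using that by (cases a; cases g; cases k)
      (auto simp: pb_ops pb_Obj pb_carrier pb_inv f.dom.peiffer f'.dom.peiffer)
qed

abbreviation J :: "('o \<times> 'o2, 'm \<times> 'm2, 'g \<times> 'g2,
    'o \<times> 'm1 \<times> 'o2, 'm \<times> 'g1 \<times> 'm2, 'g \<times> 'g2) xmor" where
  "J \<equiv> canonical_xmor f Y"

lemma J_ops:
  "on_obj J (a, a') = (a, Ident Y (F a), a')"
  "on_arr J (a, a') (b, b') (p, p') = (p, \<one>\<^bsub>Grp Y (F a)\<^esub>, p')"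
  "on_grp J (a, a') (g, g') = (g, g')"
  by (simp_all add: canonical_xmor_def)

lemma xmod_morphism_J: "xmod_morphism W H J"
proof (intro xmod_morphism.intro crossed_module_pb crossed_module_hp xmod_morphism_axioms.intro)
  show "on_obj J a \<in> Obj H" if "a \<in> Obj W" for a
    using that by (cases a) (simp add: J_ops pb_Obj hp_Obj f.cod.ident_closed f'.obj_closed)
  show "on_arr J a b p \<in> Arr H (on_obj J a) (on_obj J b)" if "a \<in> Obj W" "b \<in> Obj W" "p \<in> Arr W a b" for a b p
  proof (cases a; cases b; cases p)
    fix a0 a0' b0 b0' p0 p0' assume [simp]: "a = (a0, a0')" "b = (b0, b0')" "p = (p0, p0')"
    have *: "on_arr f' a0' b0' p0' = on_arr f a0 b0 p0" "F' a0' = F a0" "F' b0' = F b0"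
        "a0 \<in> Obj X" "b0 \<in> Obj X" "p0 \<in> Arr X a0 b0" "p0' \<in> Arr X' a0' b0'"
      using that by (simp_all add: pb_Obj pb_Arr)
    show ?thesis
      by (simp add: J_ops hp_Arr * calc)
  qed
  show "on_arr J a a (Ident W a) = Ident H (on_obj J a)" if "a \<in> Obj W" for a
    using that by (cases a) (simp add: J_ops hp_ops pb_ops)
  show "on_arr J a c (Comp W a b c q p) = Comp H (on_obj J a) (on_obj J b) (on_obj J c) (on_arr J b c q) (on_arr J a b p)"
    if "a \<in> Obj W" "b \<in> Obj W" "c \<in> Obj W" "p \<in> Arr W a b" "q \<in> Arr W b c" for a b c p q
    using that by (cases a; cases b; cases c; cases p; cases q)
      (simp add: J_ops hp_ops pb_ops pb_Obj pb_Arr calc)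
  show "on_grp J a \<in> hom (Grp W a) (Grp H (on_obj J a))" if "a \<in> Obj W" for a
    using that by (cases a) (auto simp: hom_def J_ops hp_ops pb_ops pb_carrier)
  show "on_grp J b (Act W a b p g) = Act H (on_obj J a) (on_obj J b) (on_arr J a b p) (on_grp J a g)"
    if "a \<in> Obj W" "b \<in> Obj W" "p \<in> Arr W a b" "g \<in> carrier (Grp W a)" for a b p g
    using that by (cases a; cases b; cases p; cases g) (simp add: J_ops hp_ops pb_ops)
  show "Bdry H (on_obj J a) (on_grp J a g) = on_arr J a a (Bdry W a g)"
    if "a \<in> Obj W" "g \<in> carrier (Grp W a)" for a g
  proof (cases a; cases g)
    fix a0 a0' g0 g0' assume [simp]: "a = (a0, a0')" "g = (g0, g0')"
    have *: "F' a0' = F a0" "on_grp f' a0' g0' = on_grp f a0 g0" "a0 \<in> Obj X" "g0 \<in> carrier (Grp X a0)"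
      using that by (simp_all add: pb_Obj pb_carrier)
    show ?thesis
      by (simp add: J_ops hp_ops pb_ops * calc)
  qed
qed

text \<open>With identities in the middle of both objects, the condition says that h measures the
  failure of p and \<open>p'\<close> to have the same image in \<open>Y\<close>.\<close>

lemma hp_Arr_ident:
  assumes "(a, a') \<in> Obj W" "(b, b') \<in> Obj W"
  shows "(p, h, p') \<in> Arr H (on_obj J (a, a')) (on_obj J (b, b')) \<longleftrightarrow>
    p \<in> Arr X a b \<and> p' \<in> Arr X' a' b' \<and> h \<in> carrier (Grp Y (F a)) \<and>
    Bdry Y (F a) h = Comp Y (F a) (F b) (F a) (Inv Y (F a) (F b) (on_arr f a b p)) (on_arr f' a' b' p')"
proof -
  have *: "F' a' = F a" "F' b' = F b" "a \<in> Obj X" "b \<in> Obj X" "a' \<in> Obj X'" "b' \<in> Obj X'"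
    using assms by (simp_all add: pb_Obj)
  have "p' \<in> Arr X' a' b' \<Longrightarrow> on_arr f' a' b' p' \<in> Arr Y (F a) (F b)"
    using f'.arr_closed[of a' b' p'] * by simp
  then show ?thesis
    by (auto simp: J_ops hp_Arr * f.cod.gpd_simps f.obj_closed)
qed

section \<open>Density of the canonical morphism\<close>

text \<open>Injectivity and reflection along boundaries come from the formulas alone: a boundary in
  the image has middle entry 1, which forces the two group elements to agree in \<open>Y\<close>.
  Existence of connecting arrows and corrections is left to the fibration.\<close>

lemma dense_inclusion_J:
  assumes ess: "\<And>a q a'. (a, q, a') \<in> Obj H \<Longrightarrow> \<exists>w\<in>Obj W. \<exists>c. c \<in> Arr H (a, q, a') (on_obj J w)"
    and full: "\<And>a a' b b' p h p'. \<lbrakk>(a, a') \<in> Obj W; (b, b') \<in> Obj W;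
        (p, h, p') \<in> Arr H (on_obj J (a, a')) (on_obj J (b, b'))\<rbrakk>
      \<Longrightarrow> \<exists>d\<in>carrier (Grp H (on_obj J (a, a'))).
        Comp H (on_obj J (a, a')) (on_obj J (a, a')) (on_obj J (b, b')) (p, h, p') (Bdry H (on_obj J (a, a')) d)
          \<in> on_arr J (a, a') (b, b') ` Arr W (a, a') (b, b')"
  shows "dense_inclusion W H J"
proof (intro dense_inclusion.intro xmod_morphism_J dense_inclusion_axioms.intro)
  show "inj_on (on_obj J) (Obj W)"
    by (auto simp: inj_on_def J_ops)
  show "inj_on (on_arr J a b) (Arr W a b)" for a b
    by (cases a; cases b) (auto simp: inj_on_def J_ops)
  show "inj_on (on_grp J a) (carrier (Grp W a))" for a
    by (cases a) (auto simp: inj_on_def J_ops)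
  show "\<exists>w\<in>Obj W. \<exists>c. c \<in> Arr H z (on_obj J w)" if "z \<in> Obj H" for z
  proof (cases z)
    case [simp]: (fields a q a')
    show ?thesis
      using that ess[of a q a'] by simp
  qed
  show "\<exists>d\<in>carrier (Grp H (on_obj J a)). Comp H (on_obj J a) (on_obj J a) (on_obj J b) q (Bdry H (on_obj J a) d)
      \<in> on_arr J a b ` Arr W a b"
    if "a \<in> Obj W" "b \<in> Obj W" "q \<in> Arr H (on_obj J a) (on_obj J b)" for a b q
  proof (cases a; cases b; cases q)
    fix a0 a0' b0 b0' p h p' assume [simp]: "a = (a0, a0')" "b = (b0, b0')" "q = (p, h, p')"
    show ?thesis
      using that full[of a0 a0' b0 b0' p h p'] by simp
  qed
  show "g \<in> on_grp J a ` carrier (Grp W a)"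
    if "a \<in> Obj W" "g \<in> carrier (Grp H (on_obj J a))" "p \<in> Arr W a a" "Bdry H (on_obj J a) g = on_arr J a a p"
    for a g p
  proof (cases a; cases g; cases p)
    fix a0 a0' g0 g0' p0 p0' assume [simp]: "a = (a0, a0')" "g = (g0, g0')" "p = (p0, p0')"
    have *: "F' a0' = F a0" "a0 \<in> Obj X" "a0' \<in> Obj X'" "g0 \<in> carrier (Grp X a0)" "g0' \<in> carrier (Grp X' a0')"
      using that by (simp_all add: pb_Obj J_ops hp_ops)
    interpret group "Grp Y (F a0)" using * by (intro f.cod.group_Grp f.obj_closed)
    have y: "on_grp f' a0' g0' \<in> carrier (Grp Y (F a0))"
      using f'.grp_closed[of a0' g0'] * by simp
    have "inv\<^bsub>Grp Y (F a0)\<^esub> on_grp f a0 g0 \<otimes>\<^bsub>Grp Y (F a0)\<^esub> on_grp f' a0' g0' = \<one>\<^bsub>Grp Y (F a0)\<^esub>"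
      using that(4) y by (simp add: J_ops hp_ops * f.grp_inv f.cod.act_ident f.cod.Inv_ident f.obj_closed)
    then have "on_grp f' a0' g0' = on_grp f a0 g0"
      using y * f.grp_closed[of a0 g0] by (metis inv_closed inv_equality inv_inv inv_comm)
    then have "(g0, g0') \<in> carrier (Grp W (a0, a0'))"
      using * by (simp add: pb_carrier)
    then show ?thesis
      by (force simp: J_ops image_iff)
  qed
qed

lemma dense_inclusion_left:
  assumes "xmod_fibration X Y f"
  shows "dense_inclusion W H J"
proof -
  interpret fib: xmod_fibration X Y f by fact
  show ?thesis
  proof (rule dense_inclusion_J)
    fix a q a' assume z: "(a, q, a') \<in> Obj H"
    then obtain b s where b: "b \<in> Obj X" "s \<in> Arr X a b" "F b = F' a'" "on_arr f a b s = q"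
      using fib.arr_lift[of a "F' a'" q] by (auto simp: hp_Obj f'.obj_closed)
    have "(b, a') \<in> Obj W"
      using z b by (simp add: pb_Obj hp_Obj)
    \<comment> \<open>The lift s of q makes the arrow condition for middle entry 1 an identity, as q
      cancels against its own lift.\<close>
    moreover have "(s, \<one>\<^bsub>Grp Y (F a)\<^esub>, Ident X' a') \<in> Arr H (a, q, a') (on_obj J (b, a'))"
      using z b by (simp add: hp_Obj hp_Arr J_ops f'.arr_ident f.cod.xmod_simps f'.dom.ident_closed
          f.obj_closed f'.obj_closed)
    ultimately show "\<exists>w\<in>Obj W. \<exists>c. c \<in> Arr H (a, q, a') (on_obj J w)"
      by blast
  next
    fix a a' b b' p h p'
    assume o: "(a, a') \<in> Obj W" "(b, b') \<in> Obj W" and p: "(p, h, p') \<in> Arr H (on_obj J (a, a')) (on_obj J (b, b'))"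
    have *: "F' a' = F a" "F' b' = F b" "a \<in> Obj X" "b \<in> Obj X" "a' \<in> Obj X'" "b' \<in> Obj X'"
      using o by (simp_all add: pb_Obj)
    note h = p[unfolded hp_Arr_ident[OF o]]
    have p': "on_arr f' a' b' p' \<in> Arr Y (F a) (F b)"
      using f'.arr_closed[of a' b' p'] * h by simp
    \<comment> \<open>Correcting by the boundary of \<open>(g, 1)\<close> multiplies p by the
      boundary of g and, after the conjugation of h, leaves the middle entry \<open>h\<close>
      divided by itself.\<close>
    obtain g where g: "g \<in> carrier (Grp X a)" "on_grp f a g = h"
      using fib.grp_surj[of a] * h by (metis imageE)
    have "on_arr f a b (Comp X a a b p (Bdry X a g)) = on_arr f' a' b' p'"
      using * h g p' by (simp add: f.arr_comp f.bdry_compat[symmetric] f.dom.bdry_closed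
          f.cod.gpd_simps f.obj_closed f.arr_closed)
    then have "(Comp X a a b p (Bdry X a g), p') \<in> Arr W (a, a') (b, b')"
      using * h g by (simp add: pb_Arr f.dom.xmod_simps)
    moreover have "Comp H (on_obj J (a, a')) (on_obj J (a, a')) (on_obj J (b, b')) (p, h, p')
        (Bdry H (on_obj J (a, a')) (g, \<one>\<^bsub>Grp X' a'\<^esub>))
      = on_arr J (a, a') (b, b') (Comp X a a b p (Bdry X a g), p')"
    proof -
      have "on_grp f' a' \<one>\<^bsub>Grp X' a'\<^esub> = \<one>\<^bsub>Grp Y (F a)\<^esub>"
        using f'.grp_one[of a'] * by simp
      then show ?thesis
        using * h g by (simp add: J_ops hp_ops act_bdry_f f.grp_inv f.cod.xmod_simps f.obj_closed
            f'.dom.bdry_one f'.dom.ident_right Y_assoc Y_cancel)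
    qed
    moreover have "(g, \<one>\<^bsub>Grp X' a'\<^esub>) \<in> carrier (Grp H (on_obj J (a, a')))"
      using g * by (simp add: J_ops hp_ops f'.dom.grp_one_closed)
    ultimately show "\<exists>d\<in>carrier (Grp H (on_obj J (a, a'))).
        Comp H (on_obj J (a, a')) (on_obj J (a, a')) (on_obj J (b, b')) (p, h, p') (Bdry H (on_obj J (a, a')) d)
          \<in> on_arr J (a, a') (b, b') ` Arr W (a, a') (b, b')"
      by (metis image_eqI)
  qed
qed

lemma dense_inclusion_right:
  assumes "xmod_fibration X' Y f'"
  shows "dense_inclusion W H J"
proof -
  interpret fib: xmod_fibration X' Y f' by fact
  show ?thesis
  proof (rule dense_inclusion_J)
    fix a q a' assume z: "(a, q, a') \<in> Obj H"
    \<comment> \<open>Now the arrow to lift starts at the image of \<open>a'\<close>, so it is the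
      inverse of q.\<close>
    then have "Inv Y (F a) (F' a') q \<in> Arr Y (F' a') (F a)"
      by (simp add: hp_Obj f.cod.Inv_closed f.obj_closed f'.obj_closed)
    then obtain b s where b: "b \<in> Obj X'" "s \<in> Arr X' a' b" "F' b = F a"
        "on_arr f' a' b s = Inv Y (F a) (F' a') q"
      using z fib.arr_lift[of a' "F a" "Inv Y (F a) (F' a') q"] by (auto simp: hp_Obj f.obj_closed)
    have "(a, b) \<in> Obj W"
      using z b by (simp add: pb_Obj hp_Obj)
    moreover have "(Ident X a, \<one>\<^bsub>Grp Y (F a)\<^esub>, s) \<in> Arr H (a, q, a') (on_obj J (a, b))"
      using z b by (simp add: hp_Obj hp_Arr J_ops f.arr_ident f.cod.xmod_simps f.dom.ident_closed
          f.obj_closed f'.obj_closed)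
    ultimately show "\<exists>w\<in>Obj W. \<exists>c. c \<in> Arr H (a, q, a') (on_obj J w)"
      by blast
  next
    fix a a' b b' p h p'
    assume o: "(a, a') \<in> Obj W" "(b, b') \<in> Obj W" and p: "(p, h, p') \<in> Arr H (on_obj J (a, a')) (on_obj J (b, b'))"
    have *: "F' a' = F a" "F' b' = F b" "a \<in> Obj X" "b \<in> Obj X" "a' \<in> Obj X'" "b' \<in> Obj X'"
      using o by (simp_all add: pb_Obj)
    note h = p[unfolded hp_Arr_ident[OF o]]
    have p': "on_arr f' a' b' p' \<in> Arr Y (F a) (F b)"
      using f'.arr_closed[of a' b' p'] * h by simp
    have "inv\<^bsub>Grp Y (F a)\<^esub> h \<in> carrier (Grp Y (F' a'))"
      using * h by (simp add: f.cod.grp_inv_closed f.obj_closed)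
    \<comment> \<open>The inverse of h is lifted here: the image of g enters the middle entry of the
      boundary uninverted, whereas that of an element of \<open>X\<close> enters inverted.\<close>
    then obtain g where g: "g \<in> carrier (Grp X' a')" "on_grp f' a' g = inv\<^bsub>Grp Y (F a)\<^esub> h"
      using fib.grp_surj[of a'] * by (metis imageE)
    have "on_arr f' a' a' (Bdry X' a' g) = Bdry Y (F a) (inv\<^bsub>Grp Y (F a)\<^esub> h)"
      using f'.bdry_compat[of a' g] * g by simp
    then have "on_arr f' a' b' (Comp X' a' a' b' p' (Bdry X' a' g)) = on_arr f a b p"
      using * h g p' by (simp add: f'.arr_comp f'.dom.bdry_closed f.cod.bdry_inv
          f.cod.gpd_simps f.obj_closed f.arr_closed)
    then have "(p, Comp X' a' a' b' p' (Bdry X' a' g)) \<in> Arr W (a, a') (b, b')"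
      using * h g by (simp add: pb_Arr f'.dom.xmod_simps)
    moreover have "Comp H (on_obj J (a, a')) (on_obj J (a, a')) (on_obj J (b, b')) (p, h, p')
        (Bdry H (on_obj J (a, a')) (\<one>\<^bsub>Grp X a\<^esub>, g))
      = on_arr J (a, a') (b, b') (p, Comp X' a' a' b' p' (Bdry X' a' g))"
    proof -
      interpret G: group "Grp X a" using *(3) by (rule f.dom.group_Grp)
      show ?thesis
        using * h g by (simp add: J_ops hp_ops f.grp_one f.cod.xmod_simps f.obj_closed
            f.dom.bdry_one f.dom.ident_right f.arr_ident Y_assoc Y_cancel)
    qed
    moreover have "(\<one>\<^bsub>Grp X a\<^esub>, g) \<in> carrier (Grp H (on_obj J (a, a')))"
      using g * by (simp add: J_ops hp_ops f.dom.grp_one_closed)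
    ultimately show "\<exists>d\<in>carrier (Grp H (on_obj J (a, a'))).
        Comp H (on_obj J (a, a')) (on_obj J (a, a')) (on_obj J (b, b')) (p, h, p') (Bdry H (on_obj J (a, a')) d)
          \<in> on_arr J (a, a') (b, b') ` Arr W (a, a') (b, b')"
      by (metis image_eqI)
  qed
qed

end

theorem theorem5p6:
  fixes X :: "('o, 'm, 'g) xmod"
    and X' :: "('o2, 'm2, 'g2) xmod"
    and Y :: "('o1, 'm1, 'g1) xmod"
    and f :: "('o, 'm, 'g, 'o1, 'm1, 'g1) xmor"
    and f' :: "('o2, 'm2, 'g2, 'o1, 'm1, 'g1) xmor"
  assumes "xmod_morphism X Y f"
    and "xmod_morphism X' Y f'"
    and "xmod_fibration X Y f \<or> xmod_fibration X' Y f'"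
  shows "homotopy_equivalence
           (classifying_space (xmod_pullback f f' X X'))
           (classifying_space (xmod_hpullback f f' X X' Y))
           (classifying_map (xmod_hpullback f f' X X' Y) (canonical_xmor f Y))"
proof -
  interpret cospan X X' Y f f'
    by (rule cospan.intro; fact)
  have "dense_inclusion (xmod_pullback f f' X X') (xmod_hpullback f f' X X' Y) (canonical_xmor f Y)"
    using assms(3) dense_inclusion_left dense_inclusion_right by blast
  then show ?thesis
    by (rule dense_inclusion.homotopy_equivalence_classifying_map)
qed

end
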